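(* Let $|0\rangle,|\phi\rangle\in\mathcal H_Q$ be unit vectors with $\langle\phi|0\rangle\neq 0$, let $\mathcal E_{Q\to Q}$ be a quantum channel (the probe), and set $\rho_Q^0=\mathcal E(|0\rangle\langle0|)$, $\rho_Q^1=\mathcal E(|\phi\rangle\langle\phi|)$, assuming $\operatorname{supp}\rho_Q^1\subseteq\operatorname{supp}\rho_Q^0$. Let $m_x,\ell\ge1$ be integers and $E^m$ a finite-dimensional system. For $x\in\{1,\dots,m_x\}$ let $\tilde\sigma^x_{Q^{m_x}}=|0\rangle\langle0|^{\otimes(x-1)}\otimes|\phi\rangle\langle\phi|\otimes|0\rangle\langle0|^{\otimes(m_x-x)}$ and $\tilde\tau^x_{Q^{m_x}}=\mathcal E^{\otimes m_x}(\tilde\sigma^x_{Q^{m_x}})$. Let $U:\mathcal H_Q^{\otimes m_x}\to\mathcal H_Q^{\otimes m_x}\otimes\mathcal H_{E^m}$ be any isometry (Eve's attack, applied identically to each block), and define $\tau^x_{Q^{m_x}E^m}=U\tilde\tau^x U^\dagger$, $\tau_{XQ^{m_x}E^m}=\frac1{m_x}\sum_{x=1}^{m_x}|x\rangle\langle x|_X\otimes\tau^x_{Q^{m_x}E^m}$, $\sigma_{X^\ell Q^{m_x\ell}E^n}=\tau_{XQ^{m_x}E^m}^{\otimes\ell}$, $\tilde\rho^0_{Q^{m_x}}=(\rho_Q^0)^{\otimes m_x}$, $\rho^0_{Q^{m_x}E^m}=U\tilde\rho^0U^\dagger$. Let $\delta_0=C(|0\rangle\langle0|,\rho_Q^0)$,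 $\delta_1=C(|\phi\rangle\langle\phi|,\rho_Q^1)$, $\delta=\delta_0+\delta_1$, $f_0=F(|0\rangle\langle0|,|\phi\rangle\langle\phi|)$. Let $\eta^x\in(0,1)$, $x=1,\dots,m_x$, be such that, with $\lambda^x=2\delta_0+\sqrt{\eta^x+4\sqrt{\eta^x}\delta_1+4\delta_1^2}$, $$F(\tau^x_{Q^{m_x}},\rho^0_{Q^{m_x}})\le\aleph(\lambda^x,f_0)-2\sqrt{1-f_0}\,\delta-\delta^2\quad\text{for all }x.$$ Then for every smoothing parameter $\varepsilon\in(0,1)$, $$\mathbb H_{\min}^{\varepsilon}(X^\ell|E^n)_\sigma\ge\log m_x-D(\rho_Q^1\|\rho_Q^0)+\frac1{m_x}\sum_{x=1}^{m_x}\log(1-\eta^x)-(2\log m_x+3)\sqrt{\frac{\log\frac1\varepsilon+1}{\ell}}.$$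
   Context: All Hilbert spaces are finite-dimensional; logs are base 2. Fidelity: $F(\rho,\sigma)=\|\sqrt\rho\sqrt\sigma\|_1^2$ with $\|X\|_1=\operatorname{tr}\sqrt{X^\dagger X}$; $C(\rho,\sigma)=\sqrt{1-F(\rho,\sigma)}$. Quantum relative entropy $D(\rho\|\sigma)=\operatorname{tr}\rho(\log\rho-\log\sigma)$ (or $+\infty$ if the support condition fails). For $x\ge0$, $y\in(0,1]$: $\aleph(x,y)=1-\frac{2\sqrt{1-y}\,x+x^2}{y}-2\sqrt{\frac{2\sqrt{1-y}\,x+x^2}{y}}\,x-x^2$. $\tau^x_{Q^{m_x}}$ and $\rho^0_{Q^{m_x}}$ denote the marginals on $Q^{m_x}$ (Bob's system) of the corresponding states; $E^n=(E^m)^{\otimes \ell}$ and $X^\ell$ is the classical register of $\sigma$. $\mathbb H_{\min}^\varepsilon(X|E)$ is the $\varepsilon$-smooth conditional min-entropy in the sense of Renner (Security of QKD, 2005). *)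

theory Defs
  imports Complex_Main "HOL-Library.Extended_Real"
begin

text \<open>Operators on a finite-dimensional Hilbert space with orthonormal basis
  indexed by a finite carrier set S are represented as matrices
  'a => 'a => complex (only entries on S x S matter); vectors as 'a => complex.\<close>

type_synonym 'a op = "'a \<Rightarrow> 'a \<Rightarrow> complex"

definition lists_len :: "nat \<Rightarrow> 'a set \<Rightarrow> 'a list set" where
  "lists_len n A = {xs. length xs = n \<and> set xs \<subseteq> A}"

definition supported :: "'a set \<Rightarrow> 'a op \<Rightarrow> bool" where
  "supported S A \<longleftrightarrow> (\<forall>a b. (a \<notin> S \<or> b \<notin> S) \<longrightarrow> A a b = 0)"

definition op_eq :: "'a set \<Rightarrow> 'a op \<Rightarrow> 'a op \<Rightarrow> bool" where
  "op_eq S A B \<longleftrightarrow> (\<forall>a\<in>S. \<forall>b\<in>S. A a b = B a b)"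

definition inner_on :: "'a set \<Rightarrow> ('a \<Rightarrow> complex) \<Rightarrow> ('a \<Rightarrow> complex) \<Rightarrow> complex" where
  "inner_on S u v = (\<Sum>a\<in>S. cnj (u a) * v a)"

definition op_mult :: "'a set \<Rightarrow> 'a op \<Rightarrow> 'a op \<Rightarrow> 'a op" where
  "op_mult S A B = (\<lambda>a c. \<Sum>b\<in>S. A a b * B b c)"

definition op_apply :: "'a set \<Rightarrow> 'a op \<Rightarrow> ('a \<Rightarrow> complex) \<Rightarrow> ('a \<Rightarrow> complex)" where
  "op_apply S A v = (\<lambda>a. if a \<in> S then (\<Sum>b\<in>S. A a b * v b) else 0)"

definition op_adj :: "'a op \<Rightarrow> 'a op" where
  "op_adj A = (\<lambda>a b. cnj (A b a))"

definition op_trace :: "'a set \<Rightarrow> 'a op \<Rightarrow> complex" where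
  "op_trace S A = (\<Sum>a\<in>S. A a a)"

definition ident :: "'a op" where
  "ident = (\<lambda>a b. if a = b then 1 else 0)"

definition ketbra :: "('a \<Rightarrow> complex) \<Rightarrow> ('a \<Rightarrow> complex) \<Rightarrow> 'a op" where
  "ketbra u v = (\<lambda>a b. u a * cnj (v b))"

definition proj :: "('a \<Rightarrow> complex) \<Rightarrow> 'a op" where
  "proj v = ketbra v v"

definition basis_vec :: "'a \<Rightarrow> ('a \<Rightarrow> complex)" where
  "basis_vec a = (\<lambda>b. if b = a then 1 else 0)"

definition psd :: "'a set \<Rightarrow> 'a op \<Rightarrow> bool" where
  "psd S A \<longleftrightarrow> (\<forall>a\<in>S. \<forall>b\<in>S. A a b = cnj (A b a)) \<and>
     (\<forall>v. Im (inner_on S v (op_apply S A v)) = 0 \<and> Re (inner_on S v (op_apply S A v)) \<ge> 0)"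

definition density :: "'a set \<Rightarrow> 'a op \<Rightarrow> bool" where
  "density S A \<longleftrightarrow> supported S A \<and> psd S A \<and> op_trace S A = 1"

definition supp :: "'a set \<Rightarrow> 'a op \<Rightarrow> ('a \<Rightarrow> complex) set" where
  "supp S A = range (op_apply S A)"

definition psd_sqrt :: "'a set \<Rightarrow> 'a op \<Rightarrow> 'a op" where
  "psd_sqrt S A = (THE B. supported S B \<and> psd S B \<and> op_eq S (op_mult S B B) A)"

definition trace_norm :: "'a set \<Rightarrow> 'a op \<Rightarrow> real" where
  "trace_norm S X = Re (op_trace S (psd_sqrt S (op_mult S (op_adj X) X)))"

definition fidelity :: "'a set \<Rightarrow> 'a op \<Rightarrow> 'a op \<Rightarrow> real" where
  "fidelity S \<rho> \<sigma> = (trace_norm S (op_mult S (psd_sqrt S \<rho>) (psd_sqrt S \<sigma>)))\<^sup>2"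

definition purif_C :: "'a set \<Rightarrow> 'a op \<Rightarrow> 'a op \<Rightarrow> real" where
  "purif_C S \<rho> \<sigma> = sqrt (1 - fidelity S \<rho> \<sigma>)"

definition spec_decomp :: "'a set \<Rightarrow> 'a op \<Rightarrow> ('a \<Rightarrow> 'a \<Rightarrow> complex) \<Rightarrow> ('a \<Rightarrow> real) \<Rightarrow> bool" where
  "spec_decomp S A u l \<longleftrightarrow>
     (\<forall>b\<in>S. \<forall>c\<in>S. inner_on S (u b) (u c) = (if b = c then 1 else 0)) \<and>
     op_eq S A (\<lambda>a a'. \<Sum>b\<in>S. of_real (l b) * u b a * cnj (u b a'))"

definition mfun :: "'a set \<Rightarrow> (real \<Rightarrow> real) \<Rightarrow> 'a op \<Rightarrow> 'a op" where
  "mfun S f A = (case (SOME (u, l). spec_decomp S A u l) of (u, l) \<Rightarrow>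
      (\<lambda>a a'. \<Sum>b\<in>S. of_real (f (l b)) * u b a * cnj (u b a')))"

text \<open>log base 2, taken on the support (0 on the kernel).\<close>
definition log_supp :: "real \<Rightarrow> real" where
  "log_supp x = (if x > 0 then log 2 x else 0)"

definition rel_entropy :: "'a set \<Rightarrow> 'a op \<Rightarrow> 'a op \<Rightarrow> ereal" where
  "rel_entropy S \<rho> \<sigma> = (if supp S \<rho> \<subseteq> supp S \<sigma>
      then ereal (Re (op_trace S (op_mult S \<rho> (\<lambda>a b. mfun S log_supp \<rho> a b - mfun S log_supp \<sigma> a b))))
      else \<infinity>)"

definition aleph :: "real \<Rightarrow> real \<Rightarrow> real" where
  "aleph x y = 1 - (2 * sqrt (1 - y) * x + x\<^sup>2) / y
      - 2 * sqrt ((2 * sqrt (1 - y) * x + x\<^sup>2) / y) * x - x\<^sup>2"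

definition op_tensor :: "'a op \<Rightarrow> 'b op \<Rightarrow> ('a \<times> 'b) op" where
  "op_tensor A B = (\<lambda>(a, b) (a', b'). A a a' * B b b')"

text \<open>A_1 (x) ... (x) A_m on lists of basis labels of length m.\<close>
definition tensor_list :: "'a op list \<Rightarrow> 'a list op" where
  "tensor_list As = (\<lambda>ks ls. \<Prod>i<length As. (As ! i) (ks ! i) (ls ! i))"

definition id_tensor_chan :: "nat \<Rightarrow> ('q op \<Rightarrow> 'q op) \<Rightarrow> (nat \<times> 'q) op \<Rightarrow> (nat \<times> 'q) op" where
  "id_tensor_chan n \<E> X = (\<lambda>(i, a) (j, b). if i < n \<and> j < n then \<E> (\<lambda>a' b'. X (i, a') (j, b')) a b else 0)"

definition quantum_channel :: "('q::finite op \<Rightarrow> 'q op) \<Rightarrow> bool" where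
  "quantum_channel \<E> \<longleftrightarrow>
     (\<forall>A B. \<E> (\<lambda>a b. A a b + B a b) = (\<lambda>a b. \<E> A a b + \<E> B a b)) \<and>
     (\<forall>c A. \<E> (\<lambda>a b. c * A a b) = (\<lambda>a b. c * \<E> A a b)) \<and>
     (\<forall>n X. psd ({..<n} \<times> UNIV) X \<longrightarrow> psd ({..<n} \<times> UNIV) (id_tensor_chan n \<E> X)) \<and>
     (\<forall>X. op_trace UNIV (\<E> X) = op_trace UNIV X)"

text \<open>E^{(x) m}, defined on the product basis |ks><ls| = (x)_i |k_i><l_i| and extended linearly.\<close>
definition chan_pow :: "nat \<Rightarrow> ('q::finite op \<Rightarrow> 'q op) \<Rightarrow> 'q list op \<Rightarrow> 'q list op" where
  "chan_pow m \<E> X = (\<lambda>ks' ls'. \<Sum>ks\<in>lists_len m UNIV. \<Sum>ls\<in>lists_len m UNIV.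
      X ks ls * (\<Prod>i<m. \<E> (ketbra (basis_vec (ks ! i)) (basis_vec (ls ! i))) (ks' ! i) (ls' ! i)))"

definition isometry :: "'a set \<Rightarrow> 'b set \<Rightarrow> ('b \<Rightarrow> 'a \<Rightarrow> complex) \<Rightarrow> bool" where
  "isometry SI SO U \<longleftrightarrow> (\<forall>a\<in>SI. \<forall>b\<in>SI. (\<Sum>w\<in>SO. cnj (U w a) * U w b) = (if a = b then 1 else 0))"

definition iso_conj :: "'a set \<Rightarrow> ('b \<Rightarrow> 'a \<Rightarrow> complex) \<Rightarrow> 'a op \<Rightarrow> 'b op" where
  "iso_conj SI U X = (\<lambda>w w'. \<Sum>a\<in>SI. \<Sum>b\<in>SI. U w a * X a b * cnj (U w' b))"

definition ptrace2 :: "'b set \<Rightarrow> ('a \<times> 'b) op \<Rightarrow> 'a op" where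
  "ptrace2 SB T = (\<lambda>a a'. \<Sum>b\<in>SB. T (a, b) (a', b))"

text \<open>Conditional min-entropy (Renner 2005, Def. 3.1.1) and its smooth version (Def. 3.2.1).\<close>
definition hmin_rel :: "'a set \<Rightarrow> 'b set \<Rightarrow> ('a \<times> 'b) op \<Rightarrow> 'b op \<Rightarrow> ereal" where
  "hmin_rel SA SB \<rho> \<sigma> = (let L = {lam::real. 0 \<le> lam \<and>
        psd (SA \<times> SB) (\<lambda>p p'. of_real lam * op_tensor ident \<sigma> p p' - \<rho> p p')} in
     if L = {} then -\<infinity> else if Inf L = 0 then \<infinity> else ereal (- log 2 (Inf L)))"

definition hmin_cond :: "'a set \<Rightarrow> 'b set \<Rightarrow> ('a \<times> 'b) op \<Rightarrow> ereal" where
  "hmin_cond SA SB \<rho> = (SUP \<sigma>\<in>{\<sigma>. density SB \<sigma>}. hmin_rel SA SB \<rho> \<sigma>)"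

definition smooth_ball :: "'a set \<Rightarrow> real \<Rightarrow> 'a op \<Rightarrow> 'a op set" where
  "smooth_ball S \<epsilon> \<rho> = {\<rho>'. supported S \<rho>' \<and> psd S \<rho>' \<and>
      trace_norm S (\<lambda>a b. \<rho>' a b - \<rho> a b) \<le> Re (op_trace S \<rho>) * \<epsilon>}"

definition smooth_hmin :: "real \<Rightarrow> 'a set \<Rightarrow> 'b set \<Rightarrow> ('a \<times> 'b) op \<Rightarrow> ereal" where
  "smooth_hmin \<epsilon> SA SB \<rho> = (SUP \<rho>'\<in>smooth_ball (SA \<times> SB) \<epsilon> \<rho>. hmin_cond SA SB \<rho>')"

end

theory Submission
  imports Defs "HOL-Analysis.Function_Topology" "HOL-Analysis.Topology_Euclidean_Space"
    "HOL-Analysis.Convex" "HOL-Analysis.Harmonic_Numbers"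
begin

text \<open>
  All estimates are made before Eve's isometry, on the products of copies of \<open>\<rho>0\<close> and \<open>\<rho>1\<close>: the isometry
  followed by the partial trace acts linearly on vectors, so it preserves operator inequalities and
  does not increase distances. Let \<open>\<tau>bar\<close> be the average over the pulse position of these products.
  Truncating the eigenvectors of the blocks of the classical-quantum state to the eigenvectors of
  \<open>\<tau>bar\<close> with large enough eigenvalue gives a nearby state dominated by a multiple of the marginal;
  the error is the tail of a classical log-likelihood ratio (for the Nussbaum--Szkola distribution),
  which for independent blocks is a sum of independent variables and obeys a Chernoff bound. The two
  exponential moments needed for it come from the domination of every block by \<open>\<tau>bar\<close> and
  from the number of positions. The mean is at least \<open>log 2 mx\<close> minus the relative entropy
  by Klein's inequality, comparing \<open>\<tau>bar\<close> with the power of \<open>\<rho>0\<close>. Since \<open>log 2 (1 - \<eta> x) \<le> 0\<close>, the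
  \<open>\<eta>\<close>-terms only weaken the resulting bound.
\<close>

subsection \<open>Orthonormal families and the spectral theorem\<close>

text \<open>The eigenvectors of a block do not diagonalise \<open>\<tau>bar\<close>, so there is no
  common spectrum along which to cut. Each eigenvector is cut at a threshold set by its own
  eigenvalue. This keeps the state positive, but the cut vectors are no longer orthogonal, and their
  sum is controlled by rounding eigenvalues to powers of two, at the price of one factor 2 for the
  rounding and one for adding the layers. The trace distance is bounded by a product of two square
  roots, so the squared norm lost may be at most \<open>\<epsilon>\<^sup>2 / 4\<close>, which is
  \<open>2 powr (- 2 * k)\<close> for \<open>k = log 2 (1 / \<epsilon>) + 1\<close>.

  The bound to be reached contains the mean \<open>h\<close> of a single block. If it is not
  positive, nonnegativity of the entropy suffices; otherwise the other blocks pay for the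
  fluctuations. With \<open>L = log 2 mx\<close> and \<open>t = sqrt (k / ell)\<close>, the
  parameter \<open>2 * t / (L + 1)\<close> is optimal for a deviation of
  \<open>2 * (L + 1) * t\<close> per block under the cumulant bound; the remaining \<open>t\<close>
  of \<open>(2 * L + 3) * t\<close> covers the two factors 2, because
  \<open>ell * t \<ge> 2\<close>.\<close>

definition nsq :: "'a set \<Rightarrow> ('a \<Rightarrow> complex) \<Rightarrow> real" where
  "nsq S v = (\<Sum>a\<in>S. (cmod (v a))\<^sup>2)"

definition orthonormal :: "'a set \<Rightarrow> 'b set \<Rightarrow> ('b \<Rightarrow> 'a \<Rightarrow> complex) \<Rightarrow> bool" where
  "orthonormal S T u \<longleftrightarrow> (\<forall>b\<in>T. \<forall>c\<in>T. inner_on S (u b) (u c) = (if b = c then 1 else 0))"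

lemma nsq_nonneg [simp]: "nsq S v \<ge> 0"
  by (simp add: nsq_def sum_nonneg)

lemma inner_on_self: "inner_on S v v = of_real (nsq S v)"
  unfolding inner_on_def nsq_def
  by (simp add: complex_norm_square mult.commute del: of_real_power)

lemma cnj_inner_on: "cnj (inner_on S u v) = inner_on S v u"
  by (simp add: inner_on_def mult.commute)

lemma cmod_inner_on_commute: "cmod (inner_on S u v) = cmod (inner_on S v u)"
  by (metis cnj_inner_on complex_mod_cnj)

lemma inner_on_diff_right: "inner_on S u (\<lambda>a. v a - w a) = inner_on S u v - inner_on S u w"
  by (simp add: inner_on_def algebra_simps sum_subtractf)

lemma inner_on_diff_left: "inner_on S (\<lambda>a. v a - w a) u = inner_on S v u - inner_on S w u"
  by (simp add: inner_on_def algebra_simps sum_subtractf)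

lemma inner_on_scale_right: "inner_on S u (\<lambda>a. k * v a) = k * inner_on S u v"
  by (simp add: inner_on_def algebra_simps sum_distrib_left)

lemma inner_on_scale_left: "inner_on S (\<lambda>a. k * v a) u = cnj k * inner_on S v u"
  by (simp add: inner_on_def algebra_simps sum_distrib_left)

lemma inner_on_sum_right:
  "inner_on S u (\<lambda>a. \<Sum>i\<in>I. c i * w i a) = (\<Sum>i\<in>I. c i * inner_on S u (w i))"
proof -
  have "inner_on S u (\<lambda>a. \<Sum>i\<in>I. c i * w i a) = (\<Sum>a\<in>S. \<Sum>i\<in>I. c i * (cnj (u a) * w i a))"
    by (simp add: inner_on_def sum_distrib_left mult_ac)
  also have "\<dots> = (\<Sum>i\<in>I. \<Sum>a\<in>S. c i * (cnj (u a) * w i a))" by (rule sum.swap)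
  finally show ?thesis by (simp add: inner_on_def sum_distrib_left)
qed

lemma inner_on_sum_left:
  "inner_on S (\<lambda>a. \<Sum>i\<in>I. c i * w i a) u = (\<Sum>i\<in>I. cnj (c i) * inner_on S (w i) u)"
proof -
  have "inner_on S (\<lambda>a. \<Sum>i\<in>I. c i * w i a) u = cnj (inner_on S u (\<lambda>a. \<Sum>i\<in>I. c i * w i a))"
    by (simp add: cnj_inner_on)
  also have "\<dots> = (\<Sum>i\<in>I. cnj (c i) * cnj (inner_on S u (w i)))"
    by (simp add: inner_on_sum_right)
  finally show ?thesis by (simp add: cnj_inner_on)
qed

lemma inner_on_cong:
  "(\<And>a. a \<in> S \<Longrightarrow> u a = u' a) \<Longrightarrow> (\<And>a. a \<in> S \<Longrightarrow> v a = v' a) \<Longrightarrow> inner_on S u v = inner_on S u' v'"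
  by (simp add: inner_on_def)

lemma nsq_cong: "(\<And>a. a \<in> S \<Longrightarrow> u a = u' a) \<Longrightarrow> nsq S u = nsq S u'"
  by (simp add: nsq_def)

lemma nsq_diff: "nsq S (\<lambda>a. v a - w a) = nsq S v - 2 * Re (inner_on S w v) + nsq S w"
proof -
  have "complex_of_real (nsq S (\<lambda>a. v a - w a))
      = of_real (nsq S v) - inner_on S v w - inner_on S w v + of_real (nsq S w)"
    by (simp only: inner_on_self[symmetric] inner_on_diff_right inner_on_diff_left) (simp add: algebra_simps)
  then have "Re (complex_of_real (nsq S (\<lambda>a. v a - w a)))
      = nsq S v - Re (inner_on S v w) - Re (inner_on S w v) + nsq S w"
    by simp
  moreover have "Re (inner_on S v w) = Re (inner_on S w v)"
    by (metis cnj_inner_on complex_cnj cnj.sel(1))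
  ultimately show ?thesis by simp
qed

lemma nsq_scale: "nsq S (\<lambda>a. k * v a) = (cmod k)\<^sup>2 * nsq S v"
  by (simp add: nsq_def norm_mult power_mult_distrib sum_distrib_left)

lemma nsq_eq_0_iff: "finite S \<Longrightarrow> nsq S v = 0 \<longleftrightarrow> (\<forall>a\<in>S. v a = 0)"
  by (simp add: nsq_def sum_nonneg_eq_0_iff)

lemma orthonormal_nsq: "orthonormal S T u \<Longrightarrow> t \<in> T \<Longrightarrow> nsq S (u t) = 1"
  unfolding orthonormal_def by (metis inner_on_self of_real_eq_1_iff)

lemma inner_on_orthonormal_comb:
  assumes "orthonormal S T u" "finite T" "t \<in> T"
  shows "inner_on S (u t) (\<lambda>a. \<Sum>s\<in>T. c s * u s a) = c t"
proof -
  have "inner_on S (u t) (\<lambda>a. \<Sum>s\<in>T. c s * u s a) = (\<Sum>s\<in>T. c s * (if t = s then 1 else 0))"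
    using assms by (auto simp: inner_on_sum_right orthonormal_def intro!: sum.cong)
  also have "\<dots> = c t" using assms by (simp add: if_distrib sum.delta cong: if_cong)
  finally show ?thesis .
qed

lemma nsq_orthonormal_comb:
  assumes "orthonormal S T u" "finite T"
  shows "nsq S (\<lambda>a. \<Sum>s\<in>T. c s * u s a) = (\<Sum>s\<in>T. (cmod (c s))\<^sup>2)"
proof -
  have "complex_of_real (nsq S (\<lambda>a. \<Sum>s\<in>T. c s * u s a))
     = (\<Sum>s\<in>T. cnj (c s) * inner_on S (u s) (\<lambda>a. \<Sum>s\<in>T. c s * u s a))"
    by (simp add: inner_on_self[symmetric] inner_on_sum_left)
  also have "\<dots> = (\<Sum>s\<in>T. cnj (c s) * c s)"
    using assms by (intro sum.cong) (auto simp: inner_on_orthonormal_comb)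
  also have "\<dots> = of_real (\<Sum>s\<in>T. (cmod (c s))\<^sup>2)"
    by (simp add: complex_norm_square mult.commute del: of_real_power)
  finally show ?thesis using of_real_eq_iff by blast
qed

lemma nsq_residual:
  assumes "orthonormal S T u" "finite T"
  shows "nsq S (\<lambda>a. v a - (\<Sum>t\<in>T. inner_on S (u t) v * u t a))
      = nsq S v - (\<Sum>t\<in>T. (cmod (inner_on S (u t) v))\<^sup>2)"
proof -
  have "inner_on S (\<lambda>a. \<Sum>t\<in>T. inner_on S (u t) v * u t a) v
      = (\<Sum>t\<in>T. of_real ((cmod (inner_on S (u t) v))\<^sup>2))"
    unfolding inner_on_sum_left complex_norm_square by (simp add: mult.commute)
  then have "Re (inner_on S (\<lambda>a. \<Sum>t\<in>T. inner_on S (u t) v * u t a) v)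
      = (\<Sum>t\<in>T. (cmod (inner_on S (u t) v))\<^sup>2)" by simp
  then show ?thesis
    by (simp add: nsq_diff nsq_orthonormal_comb[OF assms])
qed

lemma bessel:
  assumes "orthonormal S T u" "finite T"
  shows "(\<Sum>t\<in>T. (cmod (inner_on S (u t) v))\<^sup>2) \<le> nsq S v"
  using nsq_residual[OF assms, of v]
    nsq_nonneg[of S "\<lambda>a. v a - (\<Sum>t\<in>T. inner_on S (u t) v * u t a)"] by linarith

lemma inner_on_basis_vec:
  "finite S \<Longrightarrow> a \<in> S \<Longrightarrow> inner_on S v (basis_vec a) = cnj (v a)"
  by (simp add: inner_on_def basis_vec_def if_distrib[of "\<lambda>x. _ * x"] cong: if_cong)

text \<open>The sum is the trace of the projection onto the complement of the span. It supplies the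
  dimension counting: the value 0 for \<open>card T = card S\<close> means that the family is a
  basis, a positive value for \<open>card T < card S\<close> that some vector lies outside its
  span.\<close>

lemma sum_nsq_residual_basis:
  assumes "orthonormal S T u" "finite T" "finite S"
  shows "(\<Sum>a\<in>S. nsq S (\<lambda>x. basis_vec a x - (\<Sum>t\<in>T. inner_on S (u t) (basis_vec a) * u t x)))
      = real (card S) - real (card T)"
proof -
  have "(\<Sum>a\<in>S. \<Sum>t\<in>T. (cmod (inner_on S (u t) (basis_vec a)))\<^sup>2) = (\<Sum>a\<in>S. \<Sum>t\<in>T. (cmod (u t a))\<^sup>2)"
    using assms by (intro sum.cong) (auto simp: inner_on_basis_vec)
  also have "\<dots> = (\<Sum>t\<in>T. nsq S (u t))" unfolding nsq_def by (rule sum.swap)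
  also have "\<dots> = real (card T)" using assms by (simp add: orthonormal_nsq)
  finally have 1: "(\<Sum>a\<in>S. \<Sum>t\<in>T. (cmod (inner_on S (u t) (basis_vec a)))\<^sup>2) = real (card T)" .
  have 2: "nsq S (basis_vec a) = 1" if "a \<in> S" for a
  proof -
    have "nsq S (basis_vec a) = (\<Sum>b\<in>S. if b = a then 1 else 0)"
      unfolding nsq_def basis_vec_def by (rule sum.cong) auto
    then show ?thesis using that assms by simp
  qed
  show ?thesis using 1 2 by (simp add: nsq_residual[OF assms(1,2)] sum_subtractf)
qed

text \<open>For equal cardinalities the residuals of the standard basis vectors have total squared
  norm 0, so each of them vanishes; the expansion of \<open>basis_vec a'\<close>, read at
  \<open>a\<close>, is the resolution of the identity.\<close>

lemma orthonormal_complete: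
  assumes on: "orthonormal S T u" and fin: "finite T" "finite S" and card: "card T = card S"
    and a: "a \<in> S" "a' \<in> S"
  shows "(\<Sum>t\<in>T. u t a * cnj (u t a')) = (if a = a' then 1 else 0)"
proof -
  have "(\<Sum>a\<in>S. nsq S (\<lambda>x. basis_vec a x - (\<Sum>t\<in>T. inner_on S (u t) (basis_vec a) * u t x))) = 0"
    using sum_nsq_residual_basis[OF on fin] card by simp
  then have "nsq S (\<lambda>x. basis_vec a' x - (\<Sum>t\<in>T. inner_on S (u t) (basis_vec a') * u t x)) = 0"
    using fin a by (subst (asm) sum_nonneg_eq_0_iff) auto
  then have "basis_vec a' a = (\<Sum>t\<in>T. inner_on S (u t) (basis_vec a') * u t a)"
    using fin a by (simp add: nsq_eq_0_iff)
  then have "basis_vec a' a = (\<Sum>t\<in>T. u t a * cnj (u t a'))"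
    using fin a by (simp add: inner_on_basis_vec mult.commute)
  then show ?thesis by (simp add: basis_vec_def)
qed

lemma orthonormal_expand:
  assumes on: "orthonormal S T u" and fin: "finite T" "finite S" and card: "card T = card S"
    and a: "a \<in> S"
  shows "(\<Sum>t\<in>T. inner_on S (u t) v * u t a) = v a"
proof -
  have "(\<Sum>t\<in>T. inner_on S (u t) v * u t a) = (\<Sum>t\<in>T. \<Sum>b\<in>S. v b * (u t a * cnj (u t b)))"
    by (simp add: inner_on_def sum_distrib_left sum_distrib_right mult_ac)
  also have "\<dots> = (\<Sum>b\<in>S. v b * (\<Sum>t\<in>T. u t a * cnj (u t b)))"
    by (subst sum.swap) (simp add: sum_distrib_left)
  also have "\<dots> = (\<Sum>b\<in>S. v b * (if a = b then 1 else 0))"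
    using assms by (intro sum.cong) (simp_all add: orthonormal_complete)
  also have "\<dots> = v a" using fin a by (simp add: if_distrib cong: if_cong)
  finally show ?thesis .
qed

lemma parseval:
  assumes on: "orthonormal S T u" and fin: "finite T" "finite S" and card: "card T = card S"
  shows "(\<Sum>t\<in>T. (cmod (inner_on S (u t) v))\<^sup>2) = nsq S v"
proof -
  have "nsq S v = nsq S (\<lambda>a. \<Sum>t\<in>T. inner_on S (u t) v * u t a)"
    using assms by (intro nsq_cong) (simp add: orthonormal_expand)
  then show ?thesis using nsq_orthonormal_comb[OF on fin(1)] by simp
qed

section \<open>Hermitian operators and their eigenbases\<close>

definition hermitian_on :: "'a set \<Rightarrow> 'a op \<Rightarrow> bool" where
  "hermitian_on S A \<longleftrightarrow> (\<forall>a\<in>S. \<forall>b\<in>S. A a b = cnj (A b a))"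

lemma psd_hermitian: "psd S A \<Longrightarrow> hermitian_on S A"
  unfolding psd_def hermitian_on_def by blast

lemma inner_on_op_apply:
  "inner_on S v (op_apply S A w) = (\<Sum>a\<in>S. \<Sum>b\<in>S. cnj (v a) * A a b * w b)"
  unfolding inner_on_def op_apply_def
  by (rule sum.cong) (simp_all add: sum_distrib_left mult.assoc)

lemma inner_on_op_apply_left:
  "inner_on S (op_apply S A v) w = (\<Sum>a\<in>S. \<Sum>b\<in>S. cnj (A a b) * cnj (v b) * w a)"
  unfolding inner_on_def op_apply_def
  by (rule sum.cong) (simp_all add: sum_distrib_right cong: sum.cong)

lemma hermitian_inner_swap:
  assumes "hermitian_on S A"
  shows "inner_on S v (op_apply S A w) = inner_on S (op_apply S A v) w"
proof -
  have "inner_on S v (op_apply S A w) = (\<Sum>b\<in>S. \<Sum>a\<in>S. cnj (v a) * A a b * w b)"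
    unfolding inner_on_op_apply by (rule sum.swap)
  also have "\<dots> = (\<Sum>b\<in>S. \<Sum>a\<in>S. cnj (A b a) * cnj (v a) * w b)"
  proof (intro sum.cong refl)
    fix b a assume "b \<in> S" "a \<in> S"
    then have *: "A a b = cnj (A b a)" using assms unfolding hermitian_on_def by blast
    show "cnj (v a) * A a b * w b = cnj (A b a) * cnj (v a) * w b" by (subst *) simp
  qed
  finally show ?thesis by (simp only: inner_on_op_apply_left)
qed

lemma op_apply_diff: "op_apply S A (\<lambda>a. v a - w a) = (\<lambda>a. op_apply S A v a - op_apply S A w a)"
  by (auto simp: op_apply_def algebra_simps sum_subtractf)

lemma op_apply_scale: "op_apply S A (\<lambda>a. k * v a) = (\<lambda>a. k * op_apply S A v a)"
  by (auto simp: op_apply_def algebra_simps sum_distrib_left)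

lemma op_apply_cong: "(\<And>a. a \<in> S \<Longrightarrow> v a = w a) \<Longrightarrow> op_apply S A v = op_apply S A w"
  by (auto simp: op_apply_def)

text \<open>Forcing \<open>v a = 0\<close> off \<open>S\<close> places the vectors in a product of
  closed discs and singletons, compact by Tychonoff; the norm and orthogonality conditions are
  closed because each of them involves finitely many coordinates.\<close>

lemma compact_unit_sphere_perp:
  assumes "finite S"
  shows "compact {v :: 'a \<Rightarrow> complex. (\<forall>a. a \<notin> S \<longrightarrow> v a = 0) \<and> nsq S v = 1 \<and>
           (\<forall>t\<in>T. inner_on S (u t) v = 0)}" (is "compact ?C")
proof -
  let ?K = "PiE UNIV (\<lambda>a. if a \<in> S then cball (0::complex) 1 else {0})"
  have "compactin (product_topology (\<lambda>i. euclidean) UNIV) ?K"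
    unfolding compactin_PiE by simp
  then have K: "compact ?K" by (simp only: euclidean_product_topology compactin_euclidean_iff)
  have C: "?C = ?K \<inter> ((\<lambda>v. nsq S v) -` {1} \<inter> (\<Inter>t\<in>T. (\<lambda>v. inner_on S (u t) v) -` {0}))" (is "_ = ?K \<inter> ?R")
  proof -
    have "cmod (v a) \<le> 1" if "nsq S v = 1" "a \<in> S" for v a
    proof -
      have "(cmod (v a))\<^sup>2 \<le> nsq S v"
        unfolding nsq_def using assms that by (intro member_le_sum) auto
      then show ?thesis using that by (simp add: power_le_one_iff abs_square_le_1)
    qed
    then show ?thesis by (auto simp: PiE_iff split: if_splits)
  qed
  have "closed ?R"
    unfolding nsq_def inner_on_def
    by (intro closed_Int closed_INT ballI closed_vimage closed_singleton)
       (intro continuous_intros continuous_on_product_coordinates)+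
  then show ?thesis using K C by (simp add: compact_Int_closed)
qed

text \<open>A maximiser of the Rayleigh quotient on the orthogonal complement of an invariant
  subspace is an eigenvector.\<close>
lemma exists_next_eigenvector:
  assumes fin: "finite S" "finite T" and herm: "hermitian_on S A"
    and on: "orthonormal S T u" and card: "card T < card S"
    and eig: "\<And>t a. t \<in> T \<Longrightarrow> a \<in> S \<Longrightarrow> op_apply S A (u t) a = of_real (l t) * u t a"
  shows "\<exists>v m. nsq S v = 1 \<and> (\<forall>t\<in>T. inner_on S (u t) v = 0) \<and>
           (\<forall>a\<in>S. op_apply S A v a = of_real m * v a)"
proof -
  let ?C = "{v. (\<forall>a. a \<notin> S \<longrightarrow> v a = 0) \<and> nsq S v = 1 \<and> (\<forall>t\<in>T. inner_on S (u t) v = 0)}"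
  let ?f = "\<lambda>v. Re (inner_on S v (op_apply S A v))"
  let ?perp = "\<lambda>v. \<forall>t\<in>T. inner_on S (u t) v = 0"
  have normalize: "\<exists>v\<in>?C. \<forall>a\<in>S. w a = of_real (sqrt (nsq S w)) * v a" if "?perp w" "nsq S w > 0" for w
  proof
    let ?v = "\<lambda>a. if a \<in> S then of_real (1 / sqrt (nsq S w)) * w a else 0"
    have "nsq S ?v = nsq S (\<lambda>a. of_real (1 / sqrt (nsq S w)) * w a)" by (intro nsq_cong) simp
    also have "\<dots> = (cmod (of_real (1 / sqrt (nsq S w))))\<^sup>2 * nsq S w" by (rule nsq_scale)
    also have "\<dots> = 1" using that(2) by (simp add: norm_divide power_divide)
    finally have 1: "nsq S ?v = 1" .
    have "inner_on S (u t) ?v = of_real (1 / sqrt (nsq S w)) * inner_on S (u t) w" for t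
      unfolding inner_on_scale_right[symmetric] by (intro inner_on_cong) auto
    then show "?v \<in> ?C" using 1 that(1) by simp
    show "\<forall>a\<in>S. w a = of_real (sqrt (nsq S w)) * ?v a" using that(2) by simp
  qed
  have ne: "?C \<noteq> {}"
  proof -
    have "(\<Sum>a\<in>S. nsq S (\<lambda>x. basis_vec a x - (\<Sum>t\<in>T. inner_on S (u t) (basis_vec a) * u t x))) > 0"
      using sum_nsq_residual_basis[OF on fin(2,1)] card by simp
    then obtain a where "nsq S (\<lambda>x. basis_vec a x - (\<Sum>t\<in>T. inner_on S (u t) (basis_vec a) * u t x)) > 0"
      by (meson not_less sum_nonpos)
    moreover have "?perp (\<lambda>x. basis_vec a x - (\<Sum>t\<in>T. inner_on S (u t) (basis_vec a) * u t x))"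
      by (simp add: inner_on_diff_right inner_on_orthonormal_comb[OF on fin(2)])
    ultimately show ?thesis using normalize by blast
  qed
  have cont: "continuous_on ?C ?f"
  proof -
    have coord: "continuous_on X (\<lambda>v. v a :: complex)" for X :: "('a \<Rightarrow> complex) set" and a
      by (rule continuous_on_subset[OF continuous_on_product_coordinates]) simp
    show ?thesis unfolding inner_on_op_apply by (intro continuous_intros coord)
  qed
  have "\<exists>v\<in>?C. \<forall>y\<in>?C. ?f y \<le> ?f v"
    by (rule continuous_attains_sup[OF compact_unit_sphere_perp[OF fin(1)] ne cont])
  then obtain v where v: "v \<in> ?C" and vmax: "\<forall>y\<in>?C. ?f y \<le> ?f v" by (rule bexE)
  define m where "m = ?f v"
  have bound: "?f w \<le> m * nsq S w" if "?perp w" for w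
  proof (cases "nsq S w = 0")
    case True
    then have "inner_on S w (op_apply S A w) = 0"
      using fin by (simp add: nsq_eq_0_iff inner_on_def)
    then show ?thesis using True by simp
  next
    case False
    then have pos: "nsq S w > 0" by (simp add: order_less_le)
    with normalize[OF that] obtain y where y: "y \<in> ?C"
      and wy: "\<And>a. a \<in> S \<Longrightarrow> w a = of_real (sqrt (nsq S w)) * y a" by blast
    have "inner_on S w (op_apply S A w) = inner_on S (\<lambda>a. of_real (sqrt (nsq S w)) * y a)
             (op_apply S A (\<lambda>a. of_real (sqrt (nsq S w)) * y a))"
      using wy by (intro inner_on_cong) (auto intro: op_apply_cong[THEN fun_cong])
    also have "\<dots> = of_real (nsq S w) * inner_on S y (op_apply S A y)"
      using pos by (simp add: op_apply_scale inner_on_scale_left inner_on_scale_right mult.assoc[symmetric]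
          of_real_mult[symmetric] del: of_real_mult)
    finally have "?f w = nsq S w * ?f y" by simp
    moreover have "?f y \<le> m" using vmax y m_def by blast
    ultimately show ?thesis using pos by (simp add: mult.commute)
  qed
  \<comment> \<open>\<open>r\<close> is the defect in the eigenvalue equation. It lies in the
    complement again, because \<open>A\<close> maps the span of the \<open>u t\<close> into
    itself.\<close>
  define r where "r = (\<lambda>a. of_real m * v a - op_apply S A v a)"
  have perp_r: "?perp r"
  proof
    fix t assume t: "t \<in> T"
    have "inner_on S (u t) (op_apply S A v) = inner_on S (op_apply S A (u t)) v"
      by (rule hermitian_inner_swap[OF herm])
    also have "\<dots> = inner_on S (\<lambda>a. of_real (l t) * u t a) v"
      using eig t by (intro inner_on_cong) auto
    also have "\<dots> = 0" using v t by (simp add: inner_on_scale_left)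
    finally show "inner_on S (u t) r = 0"
      using v t by (simp add: r_def inner_on_diff_right inner_on_scale_right)
  qed
  \<comment> \<open>\<open>?g\<close> is nonnegative on the complement and vanishes at
    \<open>v\<close>, but in the direction \<open>- r\<close> its first-order term is
    \<open>- 2 * e * nsq S r\<close>; a nonzero \<open>r\<close> would make it negative.\<close>
  let ?g = "\<lambda>w. m * nsq S w - ?f w"
  have g_expand: "?g (\<lambda>a. v a - of_real e * r a) = - 2 * e * nsq S r + e\<^sup>2 * ?g r" for e :: real
  proof -
    have s1: "Re (inner_on S v (op_apply S A r)) = Re (inner_on S r (op_apply S A v))"
      by (metis hermitian_inner_swap[OF herm] cnj_inner_on cnj.sel(1))
    have "inner_on S r (op_apply S A v) = of_real m * inner_on S r v - inner_on S r r"
      by (subst (3) r_def) (simp add: inner_on_diff_right inner_on_scale_right)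
    then have s2: "Re (inner_on S r (op_apply S A v)) = m * Re (inner_on S r v) - nsq S r"
      by (simp add: inner_on_self)
    have f: "?f (\<lambda>a. v a - of_real e * r a)
        = ?f v - 2 * e * Re (inner_on S r (op_apply S A v)) + e\<^sup>2 * ?f r"
      using s1 by (simp add: op_apply_diff op_apply_scale inner_on_diff_left inner_on_diff_right
          inner_on_scale_left inner_on_scale_right algebra_simps power2_eq_square)
    have n: "nsq S (\<lambda>a. v a - of_real e * r a) = nsq S v - 2 * e * Re (inner_on S r v) + e\<^sup>2 * nsq S r"
      by (simp add: nsq_diff nsq_scale inner_on_scale_left)
    show ?thesis unfolding f n s2 using v by (simp add: m_def[symmetric] algebra_simps)
  qed
  have "nsq S r = 0"
  proof (rule ccontr)
    assume "nsq S r \<noteq> 0"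
    then have pos: "nsq S r > 0" by (simp add: order_less_le)
    have "?perp (\<lambda>a. v a - of_real e * r a)" for e
      using v perp_r by (simp add: inner_on_diff_right inner_on_scale_right)
    then have ge: "- 2 * e * nsq S r + e\<^sup>2 * ?g r \<ge> 0" for e :: real
      using bound[of "\<lambda>a. v a - of_real e * r a"] g_expand[of e] by fastforce
    have g0: "?g r \<ge> 0" using bound[OF perp_r] by simp
    \<comment> \<open>Small enough for the quadratic term to be at most half the linear one; the
      \<open>+ 1\<close> covers \<open>?g r = 0\<close>.\<close>
    define e where "e = nsq S r / (?g r + 1)"
    have e: "e > 0" using pos g0 by (simp add: e_def)
    have "e * ?g r \<le> nsq S r" using g0 pos by (simp add: e_def field_simps)
    then have "e * (e * ?g r) \<le> e * nsq S r" using e by simp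
    then have "- 2 * e * nsq S r + e\<^sup>2 * ?g r \<le> - (e * nsq S r)" by (simp add: power2_eq_square algebra_simps)
    moreover have "e * nsq S r > 0" using e pos by simp
    ultimately show False using ge[of e] by linarith
  qed
  then have "\<forall>a\<in>S. op_apply S A v a = of_real m * v a"
    using fin by (simp add: nsq_eq_0_iff r_def)
  then show ?thesis using v by blast
qed

lemma op_eq_of_eigenbasis:
  assumes fin: "finite S" and on: "orthonormal S S u"
    and eig: "\<And>t a. t \<in> S \<Longrightarrow> a \<in> S \<Longrightarrow> op_apply S A (u t) a = of_real (l t) * u t a"
    and a: "a \<in> S" "a' \<in> S"
  shows "A a a' = (\<Sum>b\<in>S. of_real (l b) * u b a * cnj (u b a'))"
proof -
  have "(\<Sum>b\<in>S. of_real (l b) * u b a * cnj (u b a')) = (\<Sum>b\<in>S. op_apply S A (u b) a * cnj (u b a'))"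
    using eig a by (intro sum.cong) auto
  also have "\<dots> = (\<Sum>b\<in>S. \<Sum>c\<in>S. A a c * (u b c * cnj (u b a')))"
    using a by (simp add: op_apply_def sum_distrib_right mult.assoc)
  also have "\<dots> = (\<Sum>c\<in>S. A a c * (\<Sum>b\<in>S. u b c * cnj (u b a')))"
    by (subst sum.swap) (simp add: sum_distrib_left)
  also have "\<dots> = (\<Sum>c\<in>S. A a c * (if c = a' then 1 else 0))"
    using a fin on by (intro sum.cong) (auto simp: orthonormal_complete)
  also have "\<dots> = A a a'" using fin a by (simp add: if_distrib cong: if_cong)
  finally show ?thesis by simp
qed

text \<open>The induction adds one eigenvector for each element of \<open>S\<close>, in any order,
  so that \<open>S\<close> itself indexes the eigenbasis, which is the form that
  \<open>spec_decomp\<close> asks for.\<close>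

theorem hermitian_eigenbasis:
  assumes fin: "finite S" and herm: "hermitian_on S A"
  shows "\<exists>u l. orthonormal S S u \<and>
    (\<forall>t\<in>S. \<forall>a\<in>S. op_apply S A (u t) a = of_real (l t) * u t a)"
proof -
  have "\<exists>u l. orthonormal S T u \<and> (\<forall>t\<in>T. \<forall>a\<in>S. op_apply S A (u t) a = of_real (l t :: real) * u t a)"
    if "finite T" "T \<subseteq> S" for T
    using that
  proof (induction T rule: finite_induct)
    case empty
    then show ?case by (simp add: orthonormal_def)
  next
    case (insert b T)
    then obtain u l where on: "orthonormal S T u"
      and eig: "\<And>t a. t \<in> T \<Longrightarrow> a \<in> S \<Longrightarrow> op_apply S A (u t) a = of_real (l t :: real) * u t a" by blast
    have "card T < card S"
      using insert fin by (intro psubset_card_mono) auto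
    from exists_next_eigenvector[OF fin insert(1) herm on this eig] obtain v m where
      v: "nsq S v = 1" "\<forall>t\<in>T. inner_on S (u t) v = 0" "\<forall>a\<in>S. op_apply S A v a = of_real m * v a" by blast
    have v': "\<forall>t\<in>T. inner_on S v (u t) = 0" using v(2) by (metis cnj_inner_on complex_cnj_zero)
    have nb: "t \<noteq> b" if "t \<in> T" for t using that insert by auto
    have "orthonormal S (insert b T) (u(b := v))"
      unfolding orthonormal_def using on v v' insert.hyps(2)
      by (auto simp: orthonormal_def inner_on_self[of S v])
    moreover have "\<forall>t\<in>insert b T. \<forall>a\<in>S.
        op_apply S A ((u(b := v)) t) a = of_real ((l(b := m)) t) * (u(b := v)) t a"
      using eig v nb by auto
    ultimately show ?case by blast
  qed
  then show ?thesis using fin by blast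
qed

section \<open>Spectral decompositions, positive square roots and the trace norm\<close>

lemma spec_decomp_eigen:
  assumes "spec_decomp S A u l" "finite S" "t \<in> S" "a \<in> S"
  shows "op_apply S A (u t) a = of_real (l t) * u t a"
proof -
  have "op_apply S A (u t) a = (\<Sum>c\<in>S. (\<Sum>b\<in>S. of_real (l b) * u b a * cnj (u b c)) * u t c)"
    using assms by (simp add: op_apply_def spec_decomp_def op_eq_def)
  also have "\<dots> = (\<Sum>b\<in>S. \<Sum>c\<in>S. of_real (l b) * u b a * (cnj (u b c) * u t c))"
    by (subst sum.swap) (simp add: sum_distrib_right mult.assoc)
  also have "\<dots> = (\<Sum>b\<in>S. of_real (l b) * u b a * inner_on S (u b) (u t))"
    by (simp add: inner_on_def sum_distrib_left)
  also have "\<dots> = (\<Sum>b\<in>S. of_real (l b) * u b a * (if b = t then 1 else 0))"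
    using assms by (intro sum.cong) (auto simp: spec_decomp_def)
  also have "\<dots> = of_real (l t) * u t a" using assms by (simp add: if_distrib cong: if_cong)
  finally show ?thesis .
qed

lemma spec_decomp_iff:
  assumes "finite S"
  shows "spec_decomp S A u l \<longleftrightarrow> orthonormal S S u \<and>
    (\<forall>t\<in>S. \<forall>a\<in>S. op_apply S A (u t) a = of_real (l t) * u t a)"
proof
  assume "spec_decomp S A u l"
  then show "orthonormal S S u \<and> (\<forall>t\<in>S. \<forall>a\<in>S. op_apply S A (u t) a = of_real (l t) * u t a)"
    using spec_decomp_eigen[OF _ assms] by (auto simp: spec_decomp_def orthonormal_def)
next
  assume *: "orthonormal S S u \<and> (\<forall>t\<in>S. \<forall>a\<in>S. op_apply S A (u t) a = of_real (l t) * u t a)"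
  then show "spec_decomp S A u l"
    using op_eq_of_eigenbasis[OF assms, of u A l]
    unfolding spec_decomp_def op_eq_def orthonormal_def by blast
qed

lemma spec_decomp_exists:
  assumes "finite S" "hermitian_on S A"
  obtains u l where "spec_decomp S A u l"
  using hermitian_eigenbasis[OF assms] spec_decomp_iff[OF assms(1)] by metis

lemma spec_decomp_value:
  assumes "spec_decomp S A u l" "finite S" "t \<in> S"
  shows "inner_on S (u t) (op_apply S A (u t)) = of_real (l t)"
proof -
  have "inner_on S (u t) (op_apply S A (u t)) = inner_on S (u t) (\<lambda>a. of_real (l t) * u t a)"
    using assms by (intro inner_on_cong) (auto simp: spec_decomp_eigen)
  then show ?thesis using assms by (simp add: inner_on_scale_right spec_decomp_def)
qed

lemma psd_eigenvalue_nonneg: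
  assumes "psd S A" "spec_decomp S A u l" "finite S" "t \<in> S"
  shows "l t \<ge> 0"
  using assms spec_decomp_value[OF assms(2-4)] by (metis psd_def Re_complex_of_real)

lemma op_apply_mult:
  assumes "a \<in> S"
  shows "op_apply S (op_mult S A B) v a = op_apply S A (op_apply S B v) a"
proof -
  have "op_apply S (op_mult S A B) v a = (\<Sum>c\<in>S. \<Sum>b\<in>S. A a b * (B b c * v c))"
    using assms by (simp add: op_apply_def op_mult_def sum_distrib_right mult.assoc)
  also have "\<dots> = (\<Sum>b\<in>S. \<Sum>c\<in>S. A a b * (B b c * v c))" by (rule sum.swap)
  also have "\<dots> = op_apply S A (op_apply S B v) a"
    using assms by (simp add: op_apply_def sum_distrib_left)
  finally show ?thesis .
qed

lemma op_eq_apply: "op_eq S A B \<Longrightarrow> op_apply S A v = op_apply S B v"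
  by (auto simp: op_eq_def op_apply_def)

text \<open>\<open>y = B v - k v\<close> satisfies \<open>B y = - k y\<close>, which positivity of
  \<open>B\<close> rules out for \<open>k > 0\<close> unless \<open>y = 0\<close>; for
  \<open>k = 0\<close> the squared norm of \<open>B v\<close> is \<open><v, B B v> = 0\<close>. So a
  positive root is determined by an eigenbasis of \<open>M\<close>.\<close>

lemma psd_sqrt_eigen:
  assumes fin: "finite S" and B: "psd S B" and sq: "op_eq S (op_mult S B B) M"
    and eig: "\<And>a. a \<in> S \<Longrightarrow> op_apply S M v a = of_real (k\<^sup>2) * v a" and k: "k \<ge> 0"
    and a: "a \<in> S"
  shows "op_apply S B v a = of_real k * v a"
proof -
  have BB: "op_apply S B (op_apply S B v) a = of_real (k\<^sup>2) * v a" if "a \<in> S" for a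
    using op_apply_mult[OF that, of B B v] op_eq_apply[OF sq] eig[OF that] by metis
  have herm: "hermitian_on S B" using B by (rule psd_hermitian)
  define y where "y = (\<lambda>a. op_apply S B v a - of_real k * v a)"
  have "nsq S y = 0"
  proof (cases "k = 0")
    case True
    have "inner_on S (op_apply S B v) (op_apply S B v) = inner_on S v (op_apply S B (op_apply S B v))"
      by (rule hermitian_inner_swap[OF herm, symmetric])
    also have "\<dots> = inner_on S v (\<lambda>a. 0)" using BB True by (intro inner_on_cong) auto
    also have "\<dots> = 0" by (simp add: inner_on_def)
    finally show ?thesis using True by (simp add: inner_on_self y_def)
  next
    case False
    have "op_apply S B y a = - of_real k * y a" if "a \<in> S" for a
      unfolding y_def using that
      by (simp add: op_apply_diff op_apply_scale BB power2_eq_square algebra_simps)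
    then have "inner_on S y (op_apply S B y) = inner_on S y (\<lambda>a. - of_real k * y a)"
      by (intro inner_on_cong) auto
    also have "\<dots> = of_real (- (k * nsq S y))"
      using inner_on_scale_right[of S y "- of_real k" y] by (simp add: inner_on_self)
    finally have "k * nsq S y \<le> 0" using B unfolding psd_def
      by (metis Re_complex_of_real neg_0_le_iff_le)
    moreover have "k > 0" using False k by simp
    ultimately show ?thesis using nsq_nonneg[of S y] by (simp add: mult_le_0_iff)
  qed
  then show ?thesis using fin a by (simp add: nsq_eq_0_iff y_def)
qed

lemma quadratic_form_spectral:
  "inner_on S v (op_apply S (\<lambda>a a'. \<Sum>b\<in>I. of_real (l b) * u b a * cnj (u b a')) v)
    = of_real (\<Sum>b\<in>I. l b * (cmod (inner_on S (u b) v))\<^sup>2)"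
proof -
  have "inner_on S v (op_apply S (\<lambda>a a'. \<Sum>b\<in>I. of_real (l b) * u b a * cnj (u b a')) v)
     = inner_on S v (\<lambda>a. \<Sum>b\<in>I. (of_real (l b) * inner_on S (u b) v) * u b a)"
  proof (intro inner_on_cong)
    fix a assume "a \<in> S"
    then have "op_apply S (\<lambda>a a'. \<Sum>b\<in>I. of_real (l b) * u b a * cnj (u b a')) v a
      = (\<Sum>c\<in>S. \<Sum>b\<in>I. of_real (l b) * u b a * (cnj (u b c) * v c))"
      by (simp add: op_apply_def sum_distrib_right mult.assoc)
    also have "\<dots> = (\<Sum>b\<in>I. \<Sum>c\<in>S. of_real (l b) * u b a * (cnj (u b c) * v c))" by (rule sum.swap)
    also have "\<dots> = (\<Sum>b\<in>I. (of_real (l b) * inner_on S (u b) v) * u b a)"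
      by (simp add: inner_on_def sum_distrib_left sum_distrib_right mult_ac)
    finally show "op_apply S (\<lambda>a a'. \<Sum>b\<in>I. of_real (l b) * u b a * cnj (u b a')) v a
      = (\<Sum>b\<in>I. (of_real (l b) * inner_on S (u b) v) * u b a)" .
  qed simp
  also have "\<dots> = (\<Sum>b\<in>I. of_real (l b) * (inner_on S (u b) v * inner_on S v (u b)))"
    unfolding inner_on_sum_right by (simp add: mult.assoc)
  also have "\<dots> = of_real (\<Sum>b\<in>I. l b * (cmod (inner_on S (u b) v))\<^sup>2)"
    by (simp add: complex_norm_square cnj_inner_on del: of_real_power)
  finally show ?thesis .
qed

text \<open>\<open>psd_sqrt\<close> is a definite description, so the modulus of \<open>X\<close> is
  built from an eigenbasis and then shown to be the only root: any other root has the same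
  eigenvectors and eigenvalues by \<open>psd_sqrt_eigen\<close>.\<close>

lemma trace_norm_spectral:
  assumes fin: "finite S" and dec: "spec_decomp S X u l"
  shows "trace_norm S X = (\<Sum>b\<in>S. \<bar>l b\<bar>)"
proof -
  have on: "orthonormal S S u"
    and eig: "\<And>t a. t \<in> S \<Longrightarrow> a \<in> S \<Longrightarrow> op_apply S X (u t) a = of_real (l t) * u t a"
    using dec[unfolded spec_decomp_iff[OF fin]] by blast+
  let ?M = "op_mult S (op_adj X) X"
  let ?Q = "\<lambda>a a'. \<Sum>b\<in>S. of_real \<bar>l b\<bar> * u b a * cnj (u b a')"
  \<comment> \<open>Set to zero off \<open>S\<close>, as \<open>supported\<close> demands; without
    this the root would not be unique as a function on the whole type.\<close>
  define B where "B = (\<lambda>a a'. if a \<in> S \<and> a' \<in> S then ?Q a a' else 0)"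
  have adj: "op_apply S (op_adj X) v = op_apply S X v" for v
  proof -
    have "op_eq S (op_adj X) X"
      using dec by (auto simp: op_eq_def spec_decomp_def op_adj_def mult_ac intro!: sum.cong)
    then show ?thesis by (rule op_eq_apply)
  qed
  have M: "op_apply S ?M (u t) a = of_real ((\<bar>l t\<bar>)\<^sup>2) * u t a" if "t \<in> S" "a \<in> S" for t a
  proof -
    have "op_apply S ?M (u t) a = op_apply S X (op_apply S X (u t)) a"
      using that by (simp add: op_apply_mult adj)
    also have "op_apply S X (op_apply S X (u t)) = op_apply S X (\<lambda>a. of_real (l t) * u t a)"
      using eig that by (intro op_apply_cong) auto
    finally show ?thesis using eig that by (simp add: op_apply_scale power2_eq_square)
  qed
  have BQ: "op_eq S B ?Q" by (simp add: op_eq_def B_def)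
  then have decB: "spec_decomp S B u (\<lambda>b. \<bar>l b\<bar>)"
    using on by (simp add: spec_decomp_def orthonormal_def)
  have eigB: "\<And>t a. t \<in> S \<Longrightarrow> a \<in> S \<Longrightarrow> op_apply S B (u t) a = of_real \<bar>l t\<bar> * u t a"
    using decB[unfolded spec_decomp_iff[OF fin]] by blast
  have psdB: "psd S B"
    unfolding psd_def op_eq_apply[OF BQ] quadratic_form_spectral
    by (auto simp: B_def mult_ac sum_nonneg)
  have supB: "supported S B" by (auto simp: supported_def B_def)
  have sqB: "op_eq S (op_mult S B B) ?M"
  proof -
    have BB: "op_apply S (op_mult S B B) (u t) a = of_real ((\<bar>l t\<bar>)\<^sup>2) * u t a" if "t \<in> S" "a \<in> S" for t a
    proof -
      have "op_apply S B (op_apply S B (u t)) = op_apply S B (\<lambda>a. of_real \<bar>l t\<bar> * u t a)"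
        using eigB that by (intro op_apply_cong) auto
      then show ?thesis using eigB that by (simp add: op_apply_mult op_apply_scale power2_eq_square flip: of_real_mult)
    qed
    show ?thesis
      unfolding op_eq_def
      using op_eq_of_eigenbasis[OF fin on BB] op_eq_of_eigenbasis[OF fin on M] by simp
  qed
  have uniq: "B' = B" if "supported S B' \<and> psd S B' \<and> op_eq S (op_mult S B' B') ?M" for B'
  proof -
    have e: "op_apply S B' (u t) a = of_real \<bar>l t\<bar> * u t a" if "t \<in> S" "a \<in> S" for t a
      using psd_sqrt_eigen[OF fin, of B' ?M "u t" "\<bar>l t\<bar>"] M that
        \<open>supported S B' \<and> psd S B' \<and> op_eq S (op_mult S B' B') ?M\<close> by auto
    have "B' a a' = B a a'" if "a \<in> S" "a' \<in> S" for a a'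
      using op_eq_of_eigenbasis[OF fin on e that] that by (simp add: B_def)
    moreover have "B' a a' = B a a'" if "a \<notin> S \<or> a' \<notin> S" for a a'
      using that \<open>supported S B' \<and> _\<close> by (auto simp: supported_def B_def)
    ultimately show ?thesis by blast
  qed
  have "psd_sqrt S ?M = B"
    unfolding psd_sqrt_def
    by (rule the_equality) (use psdB supB sqB in blast, erule uniq)
  then have "trace_norm S X = Re (\<Sum>a\<in>S. B a a)"
    by (simp only: trace_norm_def op_trace_def)
  also have "(\<Sum>a\<in>S. B a a) = (\<Sum>a\<in>S. \<Sum>b\<in>S. of_real \<bar>l b\<bar> * (u b a * cnj (u b a)))"
    by (rule sum.cong) (simp_all add: B_def mult.assoc)
  also have "(\<Sum>a\<in>S. \<Sum>b\<in>S. of_real \<bar>l b\<bar> * (u b a * cnj (u b a)))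
      = (\<Sum>b\<in>S. of_real \<bar>l b\<bar> * inner_on S (u b) (u b))"
    unfolding inner_on_def sum_distrib_left by (subst sum.swap) (simp add: mult.commute)
  also have "\<dots> = (\<Sum>b\<in>S. of_real \<bar>l b\<bar>)"
    using on by (intro sum.cong) (simp_all add: orthonormal_def)
  finally show ?thesis by simp
qed

text \<open>In an eigenbasis of \<open>X\<close> the absolute diagonal entries sum to the trace
  norm, so a bound valid in every orthonormal basis applies there.\<close>

lemma trace_norm_le:
  assumes fin: "finite S" and herm: "hermitian_on S X"
    and bound: "\<And>u. orthonormal S S u \<Longrightarrow>
      (\<Sum>b\<in>S. \<bar>Re (inner_on S (u b) (op_apply S X (u b)))\<bar>) \<le> B"
  shows "trace_norm S X \<le> B"
proof -
  obtain u l where dec: "spec_decomp S X u l" using spec_decomp_exists[OF fin herm] .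
  then have "orthonormal S S u" using fin spec_decomp_iff by blast
  from bound[OF this] show ?thesis
    using dec fin by (simp add: trace_norm_spectral spec_decomp_value)
qed

subsection \<open>Weighted sums of rank-one operators\<close>

text \<open>The operator with terms \<open>c i |y i><y i|\<close>. The vectors may be neither
  orthogonal nor normalised, so truncated and partially traced states are covered; the operator
  order between two such sums becomes an inequality between weighted squared inner products.\<close>

definition gram :: "'i set \<Rightarrow> ('i \<Rightarrow> real) \<Rightarrow> ('i \<Rightarrow> 'a \<Rightarrow> complex) \<Rightarrow> 'a op" where
  "gram I c y = (\<lambda>p p'. \<Sum>i\<in>I. of_real (c i) * y i p * cnj (y i p'))"

lemma gram_quadratic:
  "inner_on S v (op_apply S (gram I c y) v) = of_real (\<Sum>i\<in>I. c i * (cmod (inner_on S (y i) v))\<^sup>2)"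
  unfolding gram_def by (rule quadratic_form_spectral)

lemma gram_hermitian: "gram I c y p p' = cnj (gram I c y p' p)"
  by (simp add: gram_def mult_ac)

lemma psd_gram: "(\<And>i. i \<in> I \<Longrightarrow> c i \<ge> 0) \<Longrightarrow> psd S (gram I c y)"
  unfolding psd_def gram_quadratic
  by (auto intro!: sum_nonneg gram_hermitian)

lemma op_apply_op_diff:
  "op_apply S (\<lambda>p p'. A p p' - B p p') v = (\<lambda>a. op_apply S A v a - op_apply S B v a)"
  by (auto simp: op_apply_def algebra_simps sum_subtractf)

lemma gram_diff_quadratic:
  "inner_on S v (op_apply S (\<lambda>p p'. gram I c y p p' - gram J d z p p') v)
    = of_real ((\<Sum>i\<in>I. c i * (cmod (inner_on S (y i) v))\<^sup>2) - (\<Sum>j\<in>J. d j * (cmod (inner_on S (z j) v))\<^sup>2))"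
  by (simp only: op_apply_op_diff inner_on_diff_right gram_quadratic of_real_diff)

lemma psd_gram_diff:
  assumes "\<And>v. (\<Sum>j\<in>J. d j * (cmod (inner_on S (z j) v))\<^sup>2) \<le> (\<Sum>i\<in>I. c i * (cmod (inner_on S (y i) v))\<^sup>2)"
  shows "psd S (\<lambda>p p'. gram I c y p p' - gram J d z p p')"
  unfolding psd_def gram_diff_quadratic
proof (intro conjI ballI allI)
  fix a b
  show "gram I c y a b - gram J d z a b = cnj (gram I c y b a - gram J d z b a)"
    using gram_hermitian[of I c y a b] gram_hermitian[of J d z a b] by simp
qed (use assms in auto)

lemma psd_cong:
  assumes "op_eq S A B"
  shows "psd S A \<longleftrightarrow> psd S B"
  using assms unfolding psd_def op_eq_apply[OF assms] op_eq_def by auto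

lemma op_trace_gram:
  "op_trace S (gram I c y) = of_real (\<Sum>i\<in>I. c i * nsq S (y i))"
proof -
  have "op_trace S (gram I c y) = (\<Sum>a\<in>S. \<Sum>i\<in>I. of_real (c i * (cmod (y i a))\<^sup>2))"
    unfolding op_trace_def gram_def of_real_mult complex_norm_square by (simp only: mult.assoc)
  also have "\<dots> = (\<Sum>i\<in>I. \<Sum>a\<in>S. of_real (c i * (cmod (y i a))\<^sup>2))" by (rule sum.swap)
  finally show ?thesis by (simp add: nsq_def sum_distrib_left)
qed

lemma abs_norm_square_diff_le:
  "\<bar>(cmod \<alpha>)\<^sup>2 - (cmod \<beta>)\<^sup>2\<bar> \<le> cmod (\<alpha> - \<beta>) * (cmod \<alpha> + cmod \<beta>)"
proof -
  have "\<bar>(cmod \<alpha>)\<^sup>2 - (cmod \<beta>)\<^sup>2\<bar> = \<bar>cmod \<alpha> - cmod \<beta>\<bar> * (cmod \<alpha> + cmod \<beta>)"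
    by (simp add: power2_eq_square square_diff_square_factored abs_mult mult.commute)
  also have "\<dots> \<le> cmod (\<alpha> - \<beta>) * (cmod \<alpha> + cmod \<beta>)"
    by (intro mult_right_mono norm_triangle_ineq3) simp
  finally show ?thesis .
qed

text \<open>The vectors change while the weights stay. A diagonal entry changes by a weighted sum of
  differences of squared moduli, each at most
  \<open>|\<alpha> - \<beta>| (|\<alpha>| + |\<beta>|)\<close>. Cauchy-Schwarz over the pairs of a
  basis vector and a summand separates the two factors, and Bessel's inequality sums each of them
  over the basis.\<close>

lemma trace_norm_gram_diff:
  assumes fin: "finite S" "finite I" and c: "\<And>i. i \<in> I \<Longrightarrow> c i \<ge> 0"
    and X: "op_eq S X (\<lambda>p p'. gram I c y p p' - gram I c z p p')"
  shows "trace_norm S X \<le> sqrt (\<Sum>i\<in>I. c i * nsq S (\<lambda>a. y i a - z i a))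
           * sqrt (\<Sum>i\<in>I. c i * (2 * nsq S (y i) + 2 * nsq S (z i)))"
proof (rule trace_norm_le[OF fin(1)])
  show "hermitian_on S X"
    unfolding hermitian_on_def
  proof (intro ballI)
    fix a b assume "a \<in> S" "b \<in> S"
    then have "X a b = gram I c y a b - gram I c z a b" "X b a = gram I c y b a - gram I c z b a"
      using X unfolding op_eq_def by blast+
    then show "X a b = cnj (X b a)"
      using gram_hermitian[of I c y a b] gram_hermitian[of I c z a b] by simp
  qed
next
  fix u assume on: "orthonormal S S u"
  let ?\<alpha> = "\<lambda>b i. inner_on S (y i) (u b)" and ?\<beta> = "\<lambda>b i. inner_on S (z i) (u b)"
  let ?f = "\<lambda>(b, i). sqrt (c i) * cmod (?\<alpha> b i - ?\<beta> b i)"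
    and ?g = "\<lambda>(b, i). sqrt (c i) * (cmod (?\<alpha> b i) + cmod (?\<beta> b i))"
  have swap_sum: "(\<Sum>p\<in>S \<times> I. case p of (b, i) \<Rightarrow> c i * h b i) = (\<Sum>i\<in>I. c i * (\<Sum>b\<in>S. h b i))"
    for h :: "'a \<Rightarrow> 'b \<Rightarrow> real"
  proof -
    have "(\<Sum>p\<in>S \<times> I. case p of (b, i) \<Rightarrow> c i * h b i) = (\<Sum>b\<in>S. \<Sum>i\<in>I. c i * h b i)"
      by (rule sum.cartesian_product[symmetric])
    also have "\<dots> = (\<Sum>i\<in>I. \<Sum>b\<in>S. c i * h b i)" by (rule sum.swap)
    finally show ?thesis by (simp add: sum_distrib_left)
  qed
  have bes: "(\<Sum>b\<in>S. (cmod (inner_on S w (u b)))\<^sup>2) \<le> nsq S w" for w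
    using bessel[OF on fin(1), of w] by (simp add: cmod_inner_on_commute)
  have "(\<Sum>b\<in>S. \<bar>Re (inner_on S (u b) (op_apply S X (u b)))\<bar>)
      = (\<Sum>b\<in>S. \<bar>\<Sum>i\<in>I. c i * ((cmod (?\<alpha> b i))\<^sup>2 - (cmod (?\<beta> b i))\<^sup>2)\<bar>)"
    unfolding op_eq_apply[OF X] gram_diff_quadratic Re_complex_of_real
    by (simp add: sum_subtractf right_diff_distrib)
  also have "\<dots> \<le> (\<Sum>b\<in>S. \<Sum>i\<in>I. ?f (b, i) * ?g (b, i))"
  proof (rule sum_mono)
    fix b
    have "\<bar>\<Sum>i\<in>I. c i * ((cmod (?\<alpha> b i))\<^sup>2 - (cmod (?\<beta> b i))\<^sup>2)\<bar>
        \<le> (\<Sum>i\<in>I. \<bar>c i * ((cmod (?\<alpha> b i))\<^sup>2 - (cmod (?\<beta> b i))\<^sup>2)\<bar>)" by (rule sum_abs)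
    also have "\<dots> \<le> (\<Sum>i\<in>I. ?f (b, i) * ?g (b, i))"
    proof (rule sum_mono)
      fix i assume i: "i \<in> I"
      have "\<bar>c i * ((cmod (?\<alpha> b i))\<^sup>2 - (cmod (?\<beta> b i))\<^sup>2)\<bar> = c i * \<bar>(cmod (?\<alpha> b i))\<^sup>2 - (cmod (?\<beta> b i))\<^sup>2\<bar>"
        using c[OF i] by (simp add: abs_mult)
      also have "\<dots> \<le> c i * (cmod (?\<alpha> b i - ?\<beta> b i) * (cmod (?\<alpha> b i) + cmod (?\<beta> b i)))"
        using c[OF i] abs_norm_square_diff_le by (intro mult_left_mono)
      \<comment> \<open>The weight is divided evenly between the two Cauchy-Schwarz factors.\<close>
      also have "\<dots> = (sqrt (c i) * sqrt (c i)) * (cmod (?\<alpha> b i - ?\<beta> b i) * (cmod (?\<alpha> b i) + cmod (?\<beta> b i)))"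
        using c[OF i] by simp
      also have "\<dots> = ?f (b, i) * ?g (b, i)" by (simp only: prod.case mult_ac)
      finally show "\<bar>c i * ((cmod (?\<alpha> b i))\<^sup>2 - (cmod (?\<beta> b i))\<^sup>2)\<bar> \<le> ?f (b, i) * ?g (b, i)" .
    qed
    finally show "\<bar>\<Sum>i\<in>I. c i * ((cmod (?\<alpha> b i))\<^sup>2 - (cmod (?\<beta> b i))\<^sup>2)\<bar> \<le> (\<Sum>i\<in>I. ?f (b, i) * ?g (b, i))" .
  qed
  also have "\<dots> = (\<Sum>p\<in>S \<times> I. ?f p * ?g p)"
    unfolding sum.cartesian_product by (rule sum.cong) auto
  also have "\<dots> \<le> sqrt ((\<Sum>p\<in>S \<times> I. (?f p)\<^sup>2) * (\<Sum>p\<in>S \<times> I. (?g p)\<^sup>2))"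
    by (rule real_le_rsqrt) (rule Cauchy_Schwarz_ineq_sum)
  also have "\<dots> = sqrt (\<Sum>p\<in>S \<times> I. (?f p)\<^sup>2) * sqrt (\<Sum>p\<in>S \<times> I. (?g p)\<^sup>2)"
    by (rule real_sqrt_mult)
  also have "\<dots> \<le> sqrt (\<Sum>i\<in>I. c i * nsq S (\<lambda>a. y i a - z i a))
           * sqrt (\<Sum>i\<in>I. c i * (2 * nsq S (y i) + 2 * nsq S (z i)))"
  proof (intro mult_mono real_sqrt_le_mono)
    have "(\<Sum>p\<in>S \<times> I. (?f p)\<^sup>2) = (\<Sum>p\<in>S \<times> I. case p of (b, i) \<Rightarrow> c i * (cmod (?\<alpha> b i - ?\<beta> b i))\<^sup>2)"
      using c by (intro sum.cong) (auto simp: power_mult_distrib)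
    also have "\<dots> = (\<Sum>i\<in>I. c i * (\<Sum>b\<in>S. (cmod (inner_on S (\<lambda>a. y i a - z i a) (u b)))\<^sup>2))"
      unfolding swap_sum inner_on_diff_left ..
    also have "\<dots> \<le> (\<Sum>i\<in>I. c i * nsq S (\<lambda>a. y i a - z i a))"
      using c bes by (intro sum_mono mult_left_mono) auto
    finally show "(\<Sum>p\<in>S \<times> I. (?f p)\<^sup>2) \<le> (\<Sum>i\<in>I. c i * nsq S (\<lambda>a. y i a - z i a))" .
  next
    have "(\<Sum>p\<in>S \<times> I. (?g p)\<^sup>2) = (\<Sum>p\<in>S \<times> I. case p of (b, i) \<Rightarrow> c i * (cmod (?\<alpha> b i) + cmod (?\<beta> b i))\<^sup>2)"
      using c by (intro sum.cong) (auto simp: power_mult_distrib)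
    also have "\<dots> = (\<Sum>i\<in>I. c i * (\<Sum>b\<in>S. (cmod (?\<alpha> b i) + cmod (?\<beta> b i))\<^sup>2))"
      by (rule swap_sum)
    also have "\<dots> \<le> (\<Sum>i\<in>I. c i * (\<Sum>b\<in>S. 2 * (cmod (?\<alpha> b i))\<^sup>2 + 2 * (cmod (?\<beta> b i))\<^sup>2))"
    proof (intro sum_mono mult_left_mono c)
      fix i b
      show "(cmod (?\<alpha> b i) + cmod (?\<beta> b i))\<^sup>2 \<le> 2 * (cmod (?\<alpha> b i))\<^sup>2 + 2 * (cmod (?\<beta> b i))\<^sup>2"
        using sum_squares_bound[of "cmod (?\<alpha> b i)" "cmod (?\<beta> b i)"] by (simp add: power2_sum)
    qed
    also have "\<dots> \<le> (\<Sum>i\<in>I. c i * (2 * nsq S (y i) + 2 * nsq S (z i)))"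
    proof (intro sum_mono mult_left_mono c)
      fix i
      show "(\<Sum>b\<in>S. 2 * (cmod (?\<alpha> b i))\<^sup>2 + 2 * (cmod (?\<beta> b i))\<^sup>2) \<le> 2 * nsq S (y i) + 2 * nsq S (z i)"
        unfolding sum.distrib sum_distrib_left[symmetric] using bes[of "y i"] bes[of "z i"] by linarith
    qed
    finally show "(\<Sum>p\<in>S \<times> I. (?g p)\<^sup>2) \<le> (\<Sum>i\<in>I. c i * (2 * nsq S (y i) + 2 * nsq S (z i)))" .
  qed (auto intro!: sum_nonneg mult_nonneg_nonneg c)
  finally show "(\<Sum>b\<in>S. \<bar>Re (inner_on S (u b) (op_apply S X (u b)))\<bar>)
      \<le> sqrt (\<Sum>i\<in>I. c i * nsq S (\<lambda>a. y i a - z i a))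
           * sqrt (\<Sum>i\<in>I. c i * (2 * nsq S (y i) + 2 * nsq S (z i)))" .
qed

section \<open>Product bases indexed by lists\<close>

lemma finite_lists_len: "finite A \<Longrightarrow> finite (lists_len n A)"
  unfolding lists_len_def using finite_lists_length_eq[of A n] by (simp add: conj_commute)

lemma lists_len_nth: "xs \<in> lists_len n A \<Longrightarrow> i < n \<Longrightarrow> xs ! i \<in> A"
  unfolding lists_len_def by (auto dest: nth_mem)

lemma lists_len_Suc: "lists_len (Suc n) A = (\<lambda>(x, xs). x # xs) ` (A \<times> lists_len n A)"
  by (auto simp: lists_len_def length_Suc_conv image_iff)

text \<open>Distributivity. As the factors may depend on the position, it factorises inner products,
  exponential moments, channel outputs and partial traces of tensor products alike.\<close>

lemma sum_prod_lists:
  fixes f :: "nat \<Rightarrow> 'a \<Rightarrow> 'b::comm_semiring_1"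
  shows "(\<Sum>xs\<in>lists_len n A. \<Prod>i<n. f i (xs ! i)) = (\<Prod>i<n. \<Sum>a\<in>A. f i a)"
proof (induction n arbitrary: f)
  case 0
  have "lists_len 0 A = {[]}" by (auto simp: lists_len_def)
  then show ?case by simp
next
  case (Suc n)
  have inj: "inj_on (\<lambda>(x, xs). x # xs) (A \<times> lists_len n A)" by (auto simp: inj_on_def)
  have "(\<Sum>xs\<in>lists_len (Suc n) A. \<Prod>i<Suc n. f i (xs ! i))
      = (\<Sum>(x, xs)\<in>A \<times> lists_len n A. f 0 x * (\<Prod>i<n. f (Suc i) (xs ! i)))"
    unfolding lists_len_Suc sum.reindex[OF inj]
    by (intro sum.cong) (auto simp: prod.lessThan_Suc_shift simp del: prod.lessThan_Suc)
  also have "\<dots> = (\<Sum>x\<in>A. \<Sum>xs\<in>lists_len n A. f 0 x * (\<Prod>i<n. f (Suc i) (xs ! i)))"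
    by (rule sum.cartesian_product[symmetric])
  also have "\<dots> = (\<Sum>x\<in>A. f 0 x) * (\<Sum>xs\<in>lists_len n A. \<Prod>i<n. f (Suc i) (xs ! i))"
    by (simp add: sum_product)
  also have "\<dots> = (\<Prod>i<Suc n. \<Sum>a\<in>A. f i a)"
    unfolding Suc.IH[of "\<lambda>i. f (Suc i)"] prod.lessThan_Suc_shift ..
  finally show ?case .
qed

text \<open>The family \<open>u i\<close> varies with the position: inside a block one position
  carries the eigenbasis of \<open>\<rho>1\<close> and the others that of \<open>\<rho>0\<close>,
  and among blocks it is the basis belonging to the pulse position \<open>xs ! i\<close>.\<close>

definition tensor_vec :: "nat \<Rightarrow> (nat \<Rightarrow> 'b \<Rightarrow> 'a \<Rightarrow> complex) \<Rightarrow> 'b list \<Rightarrow> 'a list \<Rightarrow> complex" where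
  "tensor_vec n u as = (\<lambda>gs. \<Prod>i<n. u i (as ! i) (gs ! i))"

lemma inner_on_tensor_vec:
  "inner_on (lists_len n G) (tensor_vec n u as) (tensor_vec n v bs)
    = (\<Prod>i<n. inner_on G (u i (as ! i)) (v i (bs ! i)))"
proof -
  have "inner_on (lists_len n G) (tensor_vec n u as) (tensor_vec n v bs)
      = (\<Sum>gs\<in>lists_len n G. \<Prod>i<n. cnj (u i (as ! i) (gs ! i)) * v i (bs ! i) (gs ! i))"
    by (simp add: inner_on_def tensor_vec_def prod.distrib)
  also have "\<dots> = (\<Prod>i<n. \<Sum>g\<in>G. cnj (u i (as ! i) g) * v i (bs ! i) g)"
    by (rule sum_prod_lists)
  finally show ?thesis by (simp only: inner_on_def)
qed

lemma orthonormal_tensor_vec: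
  assumes "\<And>i. i < n \<Longrightarrow> orthonormal G B (u i)"
  shows "orthonormal (lists_len n G) (lists_len n B) (tensor_vec n u)"
  unfolding orthonormal_def
proof (intro ballI)
  fix as bs assume as: "as \<in> lists_len n B" and bs: "bs \<in> lists_len n B"
  have "inner_on (lists_len n G) (tensor_vec n u as) (tensor_vec n u bs)
      = (\<Prod>i<n. if as ! i = bs ! i then 1 else 0)"
    unfolding inner_on_tensor_vec using assms lists_len_nth[OF as] lists_len_nth[OF bs]
    by (intro prod.cong) (auto simp: orthonormal_def)
  also have "\<dots> = (if as = bs then 1 else 0)"
  proof (cases "as = bs")
    case False
    then obtain i where "i < n" "as ! i \<noteq> bs ! i"
      using as bs by (auto simp: lists_len_def list_eq_iff_nth_eq)
    then show ?thesis using False by (auto intro!: prod_zero)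
  qed simp
  finally show "inner_on (lists_len n G) (tensor_vec n u as) (tensor_vec n u bs) = (if as = bs then 1 else 0)" .
qed

text \<open>A classical-quantum operator with blocks \<open>gram I (c x) (y x)\<close>, written as a
  single \<open>gram\<close> whose vectors live in one block each. The results on
  \<open>gram\<close> then apply to the whole state.\<close>

definition cq_gram :: "'x set \<Rightarrow> 'i set \<Rightarrow> ('x \<Rightarrow> 'i \<Rightarrow> real) \<Rightarrow> ('x \<Rightarrow> 'i \<Rightarrow> 'e \<Rightarrow> complex) \<Rightarrow> ('x \<times> 'e) op" where
  "cq_gram X I c y = gram (X \<times> I) (\<lambda>(x, i). c x i) (\<lambda>(x, i) (x', e). if x = x' then y x i e else 0)"

lemma cq_gram_apply:
  assumes "finite X" "x \<in> X"
  shows "cq_gram X I c y (x, e) (x', e') = (if x = x' then gram I (c x) (y x) e e' else 0)"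
proof -
  have "cq_gram X I c y (x, e) (x', e') = (\<Sum>x0\<in>X. if x0 = x then
      (if x = x' then gram I (c x) (y x) e e' else 0) else 0)"
    unfolding cq_gram_def gram_def sum.cartesian_product'
    by (rule sum.cong) (auto intro!: sum.neutral)
  then show ?thesis using assms by simp
qed

lemma inner_on_block:
  assumes "finite X" "x \<in> X"
  shows "inner_on (X \<times> E) (\<lambda>(x', e). if x = x' then y e else 0) g = inner_on E y (\<lambda>e. g (x, e))"
proof -
  have "inner_on (X \<times> E) (\<lambda>(x', e). if x = x' then y e else 0) g
      = (\<Sum>x'\<in>X. if x' = x then inner_on E y (\<lambda>e. g (x, e)) else 0)"
    unfolding inner_on_def sum.cartesian_product'
    by (rule sum.cong) (auto intro!: sum.neutral)
  then show ?thesis using assms by simp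
qed

lemma nsq_block:
  assumes "finite X" "x \<in> X"
  shows "nsq (X \<times> E) (\<lambda>(x', e). if x = x' then y e else 0) = nsq E y"
proof -
  have "nsq (X \<times> E) (\<lambda>(x', e). if x = x' then y e else 0) = (\<Sum>x'\<in>X. if x' = x then nsq E y else 0)"
    unfolding nsq_def sum.cartesian_product' by (rule sum.cong) (auto intro!: sum.neutral)
  then show ?thesis using assms by simp
qed

lemma sum_block_quadratic:
  assumes "finite X"
  shows "(\<Sum>p\<in>X \<times> I. (case p of (x, i) \<Rightarrow> c x i) *
      (cmod (inner_on (X \<times> E) ((\<lambda>(x, i) (x', e). if x = x' then y x i e else 0) p) g))\<^sup>2)
    = (\<Sum>x\<in>X. \<Sum>i\<in>I. c x i * (cmod (inner_on E (y x i) (\<lambda>e. g (x, e))))\<^sup>2)"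
  unfolding sum.cartesian_product'
  by (intro sum.cong refl) (simp add: inner_on_block assms)

lemma hmin_rel_lower:
  assumes "l > 0" "psd (SA \<times> SB) (\<lambda>p p'. of_real l * op_tensor ident \<sigma> p p' - \<rho> p p')"
  shows "hmin_rel SA SB \<rho> \<sigma> \<ge> ereal (- log 2 l)"
proof -
  define L where "L = {lam::real. 0 \<le> lam \<and> psd (SA \<times> SB) (\<lambda>p p'. of_real lam * op_tensor ident \<sigma> p p' - \<rho> p p')}"
  have l: "l \<in> L" using assms by (simp add: L_def)
  then have le: "Inf L \<le> l" by (intro cInf_lower bdd_belowI[of _ 0]) (auto simp: L_def)
  have ge: "Inf L \<ge> 0" using l by (intro cInf_greatest) (auto simp: L_def)
  show ?thesis
  proof (cases "Inf L = 0")
    case True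
    then show ?thesis using l by (auto simp: hmin_rel_def L_def[symmetric])
  next
    case False
    then have "log 2 (Inf L) \<le> log 2 l" using ge le assms(1) by simp
    then show ?thesis using False l by (auto simp: hmin_rel_def L_def[symmetric])
  qed
qed

text \<open>The normalised sum of the \<open>d j |z j><z j|\<close> is the competing state on
  \<open>E\<close>. With the identity on the classical register, the operator inequality splits into
  one inequality of quadratic forms per block, which is \<open>le\<close>.\<close>

lemma hmin_cond_cq_gram:
  assumes fin: "finite X" "finite E"
    and d: "\<And>j. j \<in> J \<Longrightarrow> d j \<ge> 0" "(\<Sum>j\<in>J. d j * nsq E (z j)) = 1"
    and l: "l > 0"
    and le: "\<And>x f. x \<in> X \<Longrightarrow> (\<Sum>i\<in>I. c x i * (cmod (inner_on E (y x i) f))\<^sup>2)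
              \<le> l * (\<Sum>j\<in>J. d j * (cmod (inner_on E (z j) f))\<^sup>2)"
    and \<rho>: "op_eq (X \<times> E) \<rho> (cq_gram X I c y)"
  shows "hmin_cond X E \<rho> \<ge> ereal (- log 2 l)"
proof -
  define \<sigma> where "\<sigma> = (\<lambda>e e'. if e \<in> E \<and> e' \<in> E then gram J d z e e' else 0)"
  have eq: "op_eq E \<sigma> (gram J d z)" by (simp add: op_eq_def \<sigma>_def)
  have "psd E \<sigma>" using psd_cong[OF eq] psd_gram[where I=J and c=d and S=E and y=z] d by blast
  moreover have "supported E \<sigma>" by (auto simp: supported_def \<sigma>_def)
  moreover have "op_trace E \<sigma> = op_trace E (gram J d z)" by (simp add: op_trace_def \<sigma>_def)
  ultimately have "density E \<sigma>" by (simp add: density_def op_trace_gram d)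
  have "op_eq (X \<times> E) (\<lambda>p p'. of_real l * op_tensor ident \<sigma> p p' - \<rho> p p')
      (\<lambda>p p'. cq_gram X J (\<lambda>x j. l * d j) (\<lambda>x. z) p p' - cq_gram X I c y p p')"
    unfolding op_eq_def
  proof (intro ballI)
    fix p p' assume p: "p \<in> X \<times> E" "p' \<in> X \<times> E"
    obtain x e x' e' where [simp]: "p = (x, e)" "p' = (x', e')" by fastforce
    have "of_real l * op_tensor ident \<sigma> p p' = cq_gram X J (\<lambda>x j. l * d j) (\<lambda>x. z) p p'"
      using p fin by (simp add: op_tensor_def ident_def cq_gram_apply \<sigma>_def gram_def sum_distrib_left mult.assoc)
    moreover have "\<rho> p p' = cq_gram X I c y p p'" using \<rho> p unfolding op_eq_def by blast
    ultimately show "of_real l * op_tensor ident \<sigma> p p' - \<rho> p p'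
      = cq_gram X J (\<lambda>x j. l * d j) (\<lambda>x. z) p p' - cq_gram X I c y p p'" by simp
  qed
  moreover have "psd (X \<times> E) (\<lambda>p p'. cq_gram X J (\<lambda>x j. l * d j) (\<lambda>x. z) p p' - cq_gram X I c y p p')"
    unfolding cq_gram_def
  proof (rule psd_gram_diff)
    fix g :: "'a \<times> 'b \<Rightarrow> complex"
    show "(\<Sum>p\<in>X \<times> I. (case p of (x, i) \<Rightarrow> c x i) *
          (cmod (inner_on (X \<times> E) ((\<lambda>(x, i) (x', e). if x = x' then y x i e else 0) p) g))\<^sup>2)
      \<le> (\<Sum>p\<in>X \<times> J. (case p of (x, j) \<Rightarrow> l * d j) *
          (cmod (inner_on (X \<times> E) ((\<lambda>(x, j) (x', e). if x = x' then z j e else 0) p) g))\<^sup>2)"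
      unfolding sum_block_quadratic[OF fin(1), where c=c and I=I and E=E and y=y and g=g]
        sum_block_quadratic[OF fin(1), where c="\<lambda>x j. l * d j" and I=J and E=E and y="\<lambda>x. z" and g=g]
      using le by (intro sum_mono) (simp add: sum_distrib_left mult.assoc)
  qed
  ultimately have "hmin_rel X E \<rho> \<sigma> \<ge> ereal (- log 2 l)"
    using hmin_rel_lower[OF l] psd_cong by blast
  then show ?thesis
    unfolding hmin_cond_def using \<open>density E \<sigma>\<close> by (intro SUP_upper2[of \<sigma>]) auto
qed

section \<open>Geometric sums over dyadic levels\<close>

lemma sum_powi_two_le:
  fixes J :: "int set"
  assumes "finite J"
  shows "(\<And>j. j \<in> J \<Longrightarrow> j \<le> m) \<Longrightarrow> (\<Sum>j\<in>J. 2 powr real_of_int j) \<le> 2 powr (real_of_int m + 1)"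
  using assms
proof (induction J arbitrary: m rule: finite_linorder_max_induct)
  case (insert b A)
  have "(\<Sum>j\<in>A. 2 powr real_of_int j) \<le> 2 powr (real_of_int (b - 1) + 1)"
    using insert.hyps by (intro insert.IH) force
  moreover have "b \<notin> A" using insert.hyps by auto
  ultimately have "(\<Sum>j\<in>insert b A. 2 powr real_of_int j) \<le> 2 powr real_of_int b + 2 powr real_of_int b"
    using insert.hyps by simp
  also have "\<dots> = 2 powr (real_of_int b + 1)" by (simp add: powr_add)
  also have "\<dots> \<le> 2 powr (real_of_int m + 1)" using insert.prems by simp
  finally show ?case .
qed simp

text \<open>Distinct powers of two sum to at most twice the largest of them; this is the factor lost
  when layers with different thresholds are added.\<close>

lemma sum_dyadic_le:
  fixes J :: "int set"
  assumes "finite J" "\<And>j. j \<in> J \<Longrightarrow> 2 powr real_of_int j \<le> r" "r \<ge> 0"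
  shows "(\<Sum>j\<in>J. 2 powr real_of_int j) \<le> 2 * r"
proof (cases "J = {}")
  case False
  then have "Max J \<in> J" using assms by simp
  have "(\<Sum>j\<in>J. 2 powr real_of_int j) \<le> 2 powr (real_of_int (Max J) + 1)"
    using assms by (intro sum_powi_two_le) auto
  also have "\<dots> = 2 * 2 powr real_of_int (Max J)" by (simp add: powr_add)
  also have "\<dots> \<le> 2 * r" using assms(2)[OF \<open>Max J \<in> J\<close>] by simp
  finally show ?thesis .
qed (use assms in simp)

definition dyadic :: "real \<Rightarrow> int" where "dyadic p = \<lceil>log 2 p\<rceil>"

lemma dyadic_bounds:
  assumes "p > 0"
  shows "p \<le> 2 powr real_of_int (dyadic p)" "2 powr real_of_int (dyadic p) < 2 * p"
proof -
  have "p = 2 powr log 2 p" using assms by simp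
  also have "\<dots> \<le> 2 powr real_of_int (dyadic p)" unfolding dyadic_def by (intro powr_mono) auto
  finally show "p \<le> 2 powr real_of_int (dyadic p)" .
  have "2 powr real_of_int (dyadic p) < 2 powr (log 2 p + 1)"
    unfolding dyadic_def by (intro powr_less_mono) linarith+
  also have "\<dots> = 2 * p" using assms by (simp add: powr_add)
  finally show "2 powr real_of_int (dyadic p) < 2 * p" .
qed

subsection \<open>A one-shot bound\<close>

text \<open>For orthonormal \<open>W\<close> this is the projection onto the span of the
  \<open>W b\<close> with \<open>b\<close> in \<open>B\<close>. As an action on single vectors it
  allows \<open>B\<close> to depend on the eigenvector that is cut.\<close>

definition truncation :: "'g set \<Rightarrow> ('b \<Rightarrow> 'g \<Rightarrow> complex) \<Rightarrow> 'b set \<Rightarrow> ('g \<Rightarrow> complex) \<Rightarrow> 'g \<Rightarrow> complex" where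
  "truncation G W B v = (\<lambda>g. \<Sum>b\<in>B. inner_on G (W b) v * W b g)"

lemma inner_truncation_swap:
  "inner_on G (truncation G W B v) f = inner_on G v (truncation G W B f)"
  unfolding truncation_def inner_on_sum_left inner_on_sum_right cnj_inner_on by (simp add: mult.commute)

lemma nsq_truncation:
  assumes "orthonormal G B W" "finite B"
  shows "nsq G (truncation G W B v) = (\<Sum>b\<in>B. (cmod (inner_on G (W b) v))\<^sup>2)"
  unfolding truncation_def by (rule nsq_orthonormal_comb[OF assms])

lemma orthonormal_subset: "orthonormal S T u \<Longrightarrow> T' \<subseteq> T \<Longrightarrow> orthonormal S T' u"
  unfolding orthonormal_def by blast

lemma nsq_truncation_residual:
  assumes on: "orthonormal G G W" and fin: "finite G" and B: "B \<subseteq> G"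
  shows "nsq G (\<lambda>g. truncation G W B v g - v g) = (\<Sum>b\<in>G - B. (cmod (inner_on G (W b) v))\<^sup>2)"
proof -
  have "nsq G (\<lambda>g. truncation G W B v g - v g) = nsq G (truncation G W (G - B) v)"
    unfolding nsq_def
  proof (intro sum.cong refl)
    fix g assume "g \<in> G"
    then have "v g = (\<Sum>b\<in>G. inner_on G (W b) v * W b g)"
      using orthonormal_expand[OF on fin fin refl, of g v] by simp
    also have "\<dots> = truncation G W (G - B) v g + truncation G W B v g"
      unfolding truncation_def by (rule sum.subset_diff[OF B fin])
    finally have "truncation G W B v g - v g = - truncation G W (G - B) v g" by simp
    then show "(cmod (truncation G W B v g - v g))\<^sup>2 = (cmod (truncation G W (G - B) v g))\<^sup>2"
      by simp
  qed
  then show ?thesis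
    using nsq_truncation[OF orthonormal_subset[OF on, of "G - B"]] fin by simp
qed

text \<open>Rounding the eigenvalues up to powers of two groups the truncations into layers with a common
  threshold, and the layers add up geometrically.\<close>
lemma truncated_spectral_le:
  assumes fin: "finite G" and onV: "orthonormal G G V" and onW: "orthonormal G G W"
    and p: "\<And>a. a \<in> G \<Longrightarrow> p a \<ge> 0" and q: "\<And>b. b \<in> G \<Longrightarrow> q b \<ge> 0" and \<theta>: "\<theta> \<ge> 0"
  shows "(\<Sum>a\<in>G. p a * (cmod (inner_on G
             (truncation G W {b \<in> G. 2 powr dyadic (p a) \<le> \<theta> * q b} (V a)) f))\<^sup>2)
      \<le> 2 * \<theta> * (\<Sum>b\<in>G. q b * (cmod (inner_on G (W b) f))\<^sup>2)"
proof -
  define B where "B = (\<lambda>j::int. {b \<in> G. 2 powr j \<le> \<theta> * q b})"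
  define G' where "G' = {a \<in> G. p a > 0}"
  define J where "J = (\<lambda>a. dyadic (p a)) ` G'"
  let ?h = "\<lambda>a. (cmod (inner_on G (V a) (truncation G W (B (dyadic (p a))) f)))\<^sup>2"
  have finG': "finite G'" "finite J" using fin by (auto simp: G'_def J_def)
  have "(\<Sum>a\<in>G. p a * (cmod (inner_on G (truncation G W (B (dyadic (p a))) (V a)) f))\<^sup>2)
      = (\<Sum>a\<in>G. p a * ?h a)" by (simp only: inner_truncation_swap)
  \<comment> \<open>Zero weights are dropped first: \<open>dyadic\<close> rounds positive numbers,
    and by \<open>log 2 0 = 0\<close> a zero weight would be rounded to 1.\<close>
  also have "\<dots> = (\<Sum>a\<in>G'. p a * ?h a)"
    using p fin unfolding G'_def by (intro sum.mono_neutral_right) (auto simp: order_less_le)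
  also have "\<dots> \<le> (\<Sum>a\<in>G'. 2 powr dyadic (p a) * ?h a)"
    using dyadic_bounds(1) by (intro sum_mono mult_right_mono) (auto simp: G'_def)
  also have "\<dots> = (\<Sum>j\<in>J. \<Sum>a\<in>{a \<in> G'. dyadic (p a) = j}. 2 powr dyadic (p a) * ?h a)"
    unfolding J_def by (rule sum.image_gen[OF finG'(1)])
  also have "\<dots> \<le> (\<Sum>j\<in>J. 2 powr j * (\<Sum>b\<in>B j. (cmod (inner_on G (W b) f))\<^sup>2))"
  proof (rule sum_mono)
    fix j
    have "(\<Sum>a\<in>{a \<in> G'. dyadic (p a) = j}. 2 powr dyadic (p a) * ?h a)
        = 2 powr j * (\<Sum>a\<in>{a \<in> G'. dyadic (p a) = j}. (cmod (inner_on G (V a) (truncation G W (B j) f)))\<^sup>2)"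
      by (simp add: sum_distrib_left)
    \<comment> \<open>Within a layer all eigenvectors are cut by the same projection, which has been
      moved over to \<open>f\<close>; so Bessel's inequality for \<open>V\<close> applies to the
      whole layer.\<close>
    also have "\<dots> \<le> 2 powr j * nsq G (truncation G W (B j) f)"
      using orthonormal_subset[OF onV, of "{a \<in> G'. dyadic (p a) = j}"] finG'
      by (intro mult_left_mono bessel) (auto simp: G'_def intro: finite_subset[OF _ fin])
    also have "nsq G (truncation G W (B j) f) = (\<Sum>b\<in>B j. (cmod (inner_on G (W b) f))\<^sup>2)"
      using orthonormal_subset[OF onW, of "B j"] fin by (intro nsq_truncation) (auto simp: B_def)
    finally show "(\<Sum>a\<in>{a \<in> G'. dyadic (p a) = j}. 2 powr dyadic (p a) * ?h a)
        \<le> 2 powr j * (\<Sum>b\<in>B j. (cmod (inner_on G (W b) f))\<^sup>2)" .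
  qed
  also have "\<dots> = (\<Sum>j\<in>J. \<Sum>b\<in>G. if 2 powr j \<le> \<theta> * q b then 2 powr j * (cmod (inner_on G (W b) f))\<^sup>2 else 0)"
    using fin by (auto simp: B_def sum_distrib_left sum.inter_filter intro!: sum.cong)
  also have "\<dots> = (\<Sum>b\<in>G. \<Sum>j\<in>J. if 2 powr j \<le> \<theta> * q b then 2 powr j * (cmod (inner_on G (W b) f))\<^sup>2 else 0)"
    by (rule sum.swap)
  also have "\<dots> = (\<Sum>b\<in>G. (\<Sum>j\<in>{j \<in> J. 2 powr j \<le> \<theta> * q b}. 2 powr j) * (cmod (inner_on G (W b) f))\<^sup>2)"
    using finG' by (auto simp: sum_distrib_right sum.inter_filter intro!: sum.cong)
  \<comment> \<open>For a fixed \<open>b\<close> the layers that keep it are those with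
    \<open>2 powr j \<le> \<theta> * q b\<close>, which is a geometric sum.\<close>
  also have "\<dots> \<le> (\<Sum>b\<in>G. (2 * (\<theta> * q b)) * (cmod (inner_on G (W b) f))\<^sup>2)"
    using finG' q \<theta> by (intro sum_mono mult_right_mono sum_dyadic_le) auto
  also have "\<dots> = 2 * \<theta> * (\<Sum>b\<in>G. q b * (cmod (inner_on G (W b) f))\<^sup>2)"
    by (simp add: sum_distrib_left mult_ac)
  finally show ?thesis by (simp only: B_def)
qed

section \<open>Isometry followed by partial trace, acting on vectors\<close>

definition push :: "'g set \<Rightarrow> ('k \<times> 'e \<Rightarrow> 'g \<Rightarrow> complex) \<Rightarrow> ('g \<Rightarrow> complex) \<Rightarrow> 'k \<Rightarrow> 'e \<Rightarrow> complex" where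
  "push G T v \<kappa> = (\<lambda>e. \<Sum>g\<in>G. v g * T (\<kappa>, e) g)"

text \<open>\<open>push G T v \<kappa>\<close> is the \<open>\<kappa>\<close> component of
  \<open>T v\<close>, over which the partial trace sums. Moving \<open>T\<close> to the other
  argument turns a test vector on \<open>E\<close> into one on \<open>G\<close>, so inequalities of
  quadratic forms on \<open>G\<close> carry over to \<open>E\<close>.\<close>

lemma inner_push:
  "inner_on E (push G T v \<kappa>) f = inner_on G v (\<lambda>g. inner_on E (\<lambda>e. T (\<kappa>, e) g) f)"
  unfolding push_def inner_on_sum_left by (simp add: inner_on_def)

lemma push_diff: "push G T (\<lambda>g. v g - w g) \<kappa> e = push G T v \<kappa> e - push G T w \<kappa> e"
  by (simp add: push_def left_diff_distrib sum_subtractf)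

lemma nsq_push:
  assumes "isometry G (K \<times> E) T" "finite G"
  shows "(\<Sum>\<kappa>\<in>K. nsq E (push G T v \<kappa>)) = nsq G v"
proof -
  have on: "orthonormal (K \<times> E) G (\<lambda>g w. T w g)"
    using assms(1) by (simp add: orthonormal_def isometry_def inner_on_def)
  have "(\<Sum>\<kappa>\<in>K. nsq E (push G T v \<kappa>)) = nsq (K \<times> E) (\<lambda>w. \<Sum>g\<in>G. v g * T w g)"
    by (simp add: nsq_def push_def sum.cartesian_product')
  also have "\<dots> = nsq G v"
    unfolding nsq_orthonormal_comb[OF on assms(2)] by (simp add: nsq_def)
  finally show ?thesis .
qed

text \<open>Block \<open>x\<close> is the sum of the \<open>P x a |V x a><V x a|\<close>, sent
  through \<open>T\<close> with \<open>K\<close> traced out; the pairs \<open>(\<kappa>, a)\<close>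
  index its rank-one terms.\<close>

definition pushed_state :: "'x set \<Rightarrow> 'k set \<Rightarrow> 'g set \<Rightarrow> ('k \<times> 'e \<Rightarrow> 'g \<Rightarrow> complex)
    \<Rightarrow> ('x \<Rightarrow> 'g \<Rightarrow> real) \<Rightarrow> ('x \<Rightarrow> 'g \<Rightarrow> 'g \<Rightarrow> complex) \<Rightarrow> ('x \<times> 'e) op" where
  "pushed_state X K G T P V = cq_gram X (K \<times> G) (\<lambda>x (\<kappa>, a). P x a) (\<lambda>x (\<kappa>, a). push G T (V x a) \<kappa>)"

lemma sum_nsq_pushed:
  assumes "finite X" "isometry G (K \<times> E) T" "finite G"
  shows "(\<Sum>p\<in>X \<times> (K \<times> G). (\<lambda>(x, i). case i of (\<kappa>, a) \<Rightarrow> P x a) p *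
      nsq (X \<times> E) ((\<lambda>(x, i) (x', e). if x = x' then (case i of (\<kappa>, a) \<Rightarrow> push G T (V x a) \<kappa>) e else 0) p))
    = (\<Sum>x\<in>X. \<Sum>a\<in>G. P x a * nsq G (V x a))"
proof -
  have "(\<Sum>\<kappa>\<in>K. \<Sum>a\<in>G. P x a * nsq E (push G T (V x a) \<kappa>)) = (\<Sum>a\<in>G. P x a * nsq G (V x a))" for x
    by (subst sum.swap) (simp add: nsq_push[OF assms(2,3)] flip: sum_distrib_left)
  then show ?thesis
    unfolding sum.cartesian_product' by (simp add: nsq_block assms(1))
qed

text \<open>Both states have the same weights and differ in their vectors. In
  \<open>trace_norm_gram_diff\<close> the first root is then at most \<open>\<epsilon> / 2\<close>,
  and the second at most \<open>sqrt 4\<close> since both traces are at most 1; this is the origin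
  of \<open>\<epsilon>\<^sup>2 / 4\<close>.\<close>

lemma pushed_state_in_smooth_ball:
  assumes fin: "finite X" "finite K" "finite E" "finite G"
    and iso: "isometry G (K \<times> E) T"
    and V: "\<And>x a. x \<in> X \<Longrightarrow> a \<in> G \<Longrightarrow> nsq G (V x a) = 1"
    and V': "\<And>x a. x \<in> X \<Longrightarrow> a \<in> G \<Longrightarrow> nsq G (V' x a) \<le> 1"
    and P: "\<And>x a. x \<in> X \<Longrightarrow> a \<in> G \<Longrightarrow> P x a \<ge> 0" "(\<Sum>x\<in>X. \<Sum>a\<in>G. P x a) = 1"
    and \<rho>: "op_eq (X \<times> E) \<rho> (pushed_state X K G T P V)"
    and dist: "(\<Sum>x\<in>X. \<Sum>a\<in>G. P x a * nsq G (\<lambda>g. V' x a g - V x a g)) \<le> \<epsilon>\<^sup>2 / 4" and \<epsilon>: "\<epsilon> > 0"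
  shows "(\<lambda>p p'. if p \<in> X \<times> E \<and> p' \<in> X \<times> E then pushed_state X K G T P V' p p' else 0)
      \<in> smooth_ball (X \<times> E) \<epsilon> \<rho>" (is "?\<rho>' \<in> _")
proof -
  let ?I = "X \<times> (K \<times> G)" and ?c = "\<lambda>(x, i). case i of (\<kappa>, a) \<Rightarrow> P x a"
  let ?y = "\<lambda>V (x, i) (x', e). if x = x' then (case i of (\<kappa>, a) \<Rightarrow> push G T (V x a) \<kappa>) e else 0"
  have gram: "pushed_state X K G T P V = gram ?I ?c (?y V)" for V
    by (simp add: pushed_state_def cq_gram_def)
  have c: "?c p \<ge> 0" if "p \<in> ?I" for p using that P by auto
  have eq': "op_eq (X \<times> E) ?\<rho>' (gram ?I ?c (?y V'))" by (auto simp: op_eq_def gram)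
  have "op_trace (X \<times> E) \<rho> = op_trace (X \<times> E) (gram ?I ?c (?y V))"
    using \<rho> unfolding op_trace_def op_eq_def gram by (intro sum.cong) auto
  also have "\<dots> = of_real (\<Sum>x\<in>X. \<Sum>a\<in>G. P x a * nsq G (V x a))"
    unfolding op_trace_gram sum_nsq_pushed[OF fin(1) iso fin(4)] ..
  also have "(\<Sum>x\<in>X. \<Sum>a\<in>G. P x a * nsq G (V x a)) = 1" using V P by simp
  finally have tr: "Re (op_trace (X \<times> E) \<rho>) = 1" by simp
  have "trace_norm (X \<times> E) (\<lambda>p p'. ?\<rho>' p p' - \<rho> p p')
      \<le> sqrt (\<Sum>p\<in>?I. ?c p * nsq (X \<times> E) (\<lambda>w. ?y V' p w - ?y V p w))
        * sqrt (\<Sum>p\<in>?I. ?c p * (2 * nsq (X \<times> E) (?y V' p) + 2 * nsq (X \<times> E) (?y V p)))"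
    using fin c eq' \<rho> unfolding gram
    by (intro trace_norm_gram_diff) (auto simp: op_eq_def)
  also have "\<dots> \<le> sqrt (\<epsilon>\<^sup>2 / 4) * sqrt 4"
  proof (intro mult_mono real_sqrt_le_mono)
    have "(\<lambda>w. ?y V' p w - ?y V p w) = ?y (\<lambda>x a g. V' x a g - V x a g) p" for p
      by (auto simp: fun_eq_iff push_diff split: prod.split)
    then have "(\<Sum>p\<in>?I. ?c p * nsq (X \<times> E) (\<lambda>w. ?y V' p w - ?y V p w))
        = (\<Sum>p\<in>?I. ?c p * nsq (X \<times> E) (?y (\<lambda>x a g. V' x a g - V x a g) p))" by simp
    then show "(\<Sum>p\<in>?I. ?c p * nsq (X \<times> E) (\<lambda>w. ?y V' p w - ?y V p w)) \<le> \<epsilon>\<^sup>2 / 4"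
      unfolding sum_nsq_pushed[OF fin(1) iso fin(4)] using dist by simp
    have "(\<Sum>p\<in>?I. ?c p * (2 * nsq (X \<times> E) (?y V' p) + 2 * nsq (X \<times> E) (?y V p)))
        = 2 * (\<Sum>p\<in>?I. ?c p * nsq (X \<times> E) (?y V' p)) + 2 * (\<Sum>p\<in>?I. ?c p * nsq (X \<times> E) (?y V p))"
      unfolding distrib_left sum.distrib sum_distrib_left by (simp only: mult.left_commute)
    also have "\<dots> = 2 * (\<Sum>x\<in>X. \<Sum>a\<in>G. P x a * nsq G (V' x a)) + 2 * (\<Sum>x\<in>X. \<Sum>a\<in>G. P x a * nsq G (V x a))"
      unfolding sum_nsq_pushed[OF fin(1) iso fin(4)] ..
    also have "\<dots> \<le> 2 * (\<Sum>x\<in>X. \<Sum>a\<in>G. P x a * 1) + 2 * (\<Sum>x\<in>X. \<Sum>a\<in>G. P x a * 1)"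
      using V V' P by (intro add_mono mult_left_mono sum_mono) auto
    finally show "(\<Sum>p\<in>?I. ?c p * (2 * nsq (X \<times> E) (?y V' p) + 2 * nsq (X \<times> E) (?y V p))) \<le> 4"
      using P(2) by simp
  next
    show "0 \<le> sqrt (\<Sum>p\<in>?I. ?c p * (2 * nsq (X \<times> E) (?y V' p) + 2 * nsq (X \<times> E) (?y V p)))"
      using c by (intro real_sqrt_ge_zero sum_nonneg mult_nonneg_nonneg) auto
  qed simp
  also have "\<dots> = \<epsilon>" using \<epsilon> by (simp add: real_sqrt_divide)
  finally have "trace_norm (X \<times> E) (\<lambda>p p'. ?\<rho>' p p' - \<rho> p p') \<le> \<epsilon>" .
  moreover have "psd (X \<times> E) ?\<rho>'" using psd_cong[OF eq'] psd_gram[of ?I ?c] c by blast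
  moreover have "supported (X \<times> E) ?\<rho>'" by (auto simp: supported_def)
  ultimately show ?thesis by (simp add: smooth_ball_def tr)
qed

text \<open>Each block of a classical-quantum state is dominated by the marginal.\<close>
lemma smooth_hmin_nonneg:
  assumes fin: "finite X" "finite K" "finite E" "finite G"
    and iso: "isometry G (K \<times> E) T"
    and on: "\<And>x. x \<in> X \<Longrightarrow> orthonormal G G (V x)"
    and P: "\<And>x a. x \<in> X \<Longrightarrow> a \<in> G \<Longrightarrow> P x a \<ge> 0" "(\<Sum>x\<in>X. \<Sum>a\<in>G. P x a) = 1"
    and \<rho>: "op_eq (X \<times> E) \<rho> (pushed_state X K G T P V)"
    and \<epsilon>: "\<epsilon> > 0"
  shows "smooth_hmin \<epsilon> X E \<rho> \<ge> 0"
proof -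
  \<comment> \<open>\<open>\<rho>\<close> is known on the carrier alone, while
    \<open>smooth_ball\<close> asks for \<open>supported\<close>; hence a copy that is zero
    outside.\<close>
  define \<rho>' where "\<rho>' = (\<lambda>p p'. if p \<in> X \<times> E \<and> p' \<in> X \<times> E then pushed_state X K G T P V p p' else 0)"
  have nV: "nsq G (V x a) = 1" if "x \<in> X" "a \<in> G" for x a by (rule orthonormal_nsq[OF on[OF that(1)] that(2)])
  have "\<rho>' \<in> smooth_ball (X \<times> E) \<epsilon> \<rho>"
    unfolding \<rho>'_def
    by (rule pushed_state_in_smooth_ball[OF fin iso, where V = V])
       (use nV P \<rho> \<epsilon> in \<open>auto simp: nsq_def\<close>)
  moreover have "hmin_cond X E \<rho>' \<ge> ereal (- log 2 1)"
  proof (rule hmin_cond_cq_gram[OF fin(1,3), where J = "X \<times> (K \<times> G)" and d = "\<lambda>(x, \<kappa>, a). P x a"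
        and z = "\<lambda>(x, \<kappa>, a). push G T (V x a) \<kappa>" and c = "\<lambda>x (\<kappa>, a). P x a"
        and y = "\<lambda>x (\<kappa>, a). push G T (V x a) \<kappa>" and I = "K \<times> G"])
    let ?d = "\<lambda>(x, \<kappa>, a). P x a" and ?z = "\<lambda>(x, \<kappa>, a). push G T (V x a) \<kappa>"
    have "(\<Sum>j\<in>X \<times> K \<times> G. ?d j * nsq E (?z j)) = (\<Sum>x\<in>X. \<Sum>a\<in>G. P x a * (\<Sum>\<kappa>\<in>K. nsq E (push G T (V x a) \<kappa>)))"
      unfolding sum.cartesian_product' sum_distrib_left by (subst (2) sum.swap) simp
    also have "\<dots> = 1" using P nV by (simp add: nsq_push[OF iso fin(4)])
    finally show "(\<Sum>j\<in>X \<times> K \<times> G. ?d j * nsq E (?z j)) = 1" .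
    show "(\<Sum>i\<in>K \<times> G. (case i of (\<kappa>, a) \<Rightarrow> P x a) *
          (cmod (inner_on E (case i of (\<kappa>, a) \<Rightarrow> push G T (V x a) \<kappa>) f))\<^sup>2)
        \<le> 1 * (\<Sum>j\<in>X \<times> K \<times> G. ?d j * (cmod (inner_on E (?z j) f))\<^sup>2)" if "x \<in> X" for x f
    proof -
      have "(\<Sum>i\<in>K \<times> G. (case i of (\<kappa>, a) \<Rightarrow> P x a) *
            (cmod (inner_on E (case i of (\<kappa>, a) \<Rightarrow> push G T (V x a) \<kappa>) f))\<^sup>2)
          = (\<Sum>i\<in>K \<times> G. ?d (x, i) * (cmod (inner_on E (?z (x, i)) f))\<^sup>2)"
        by simp
      also have "\<dots> \<le> (\<Sum>x\<in>X. \<Sum>i\<in>K \<times> G. ?d (x, i) * (cmod (inner_on E (?z (x, i)) f))\<^sup>2)"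
        using that fin P by (intro member_le_sum sum_nonneg) auto
      finally show ?thesis by (simp add: sum.cartesian_product'[of _ X])
    qed
    show "op_eq (X \<times> E) \<rho>' (cq_gram X (K \<times> G) (\<lambda>x (\<kappa>, a). P x a) (\<lambda>x (\<kappa>, a). push G T (V x a) \<kappa>))"
      by (simp add: op_eq_def \<rho>'_def pushed_state_def)
  qed (use P in auto)
  ultimately show ?thesis
    unfolding smooth_hmin_def by (intro SUP_upper2[of \<rho>']) (auto simp: zero_ereal_def)
qed

text \<open>An eigenvector of weight \<open>P x a\<close> keeps the components \<open>W b\<close>
  for which \<open>\<theta> * Q b\<close> reaches the rounded weight. By
  \<open>truncated_spectral_le\<close> the result lies below \<open>2 * \<theta>\<close> times the
  state with eigenvalues \<open>Q\<close>. Rounding less than doubles a weight, so the lost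
  components satisfy \<open>\<theta> * Q b < 2 * P x a\<close>, and \<open>tail\<close> bounds their
  weighted squared norm.\<close>

theorem smooth_hmin_one_shot:
  assumes fin: "finite X" "finite K" "finite E" "finite G"
    and iso: "isometry G (K \<times> E) T"
    and onV: "\<And>x. x \<in> X \<Longrightarrow> orthonormal G G (V x)" and onW: "orthonormal G G W"
    and P: "\<And>x a. x \<in> X \<Longrightarrow> a \<in> G \<Longrightarrow> P x a \<ge> 0" "(\<Sum>x\<in>X. \<Sum>a\<in>G. P x a) = 1"
    and Q: "\<And>b. b \<in> G \<Longrightarrow> Q b \<ge> 0" "(\<Sum>b\<in>G. Q b) = 1"
    and \<rho>: "op_eq (X \<times> E) \<rho> (pushed_state X K G T P V)"
    and \<epsilon>: "\<epsilon> > 0" and \<theta>: "\<theta> > 0"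
    and tail: "(\<Sum>x\<in>X. \<Sum>a\<in>G. \<Sum>b\<in>G. if \<theta> * Q b < 2 * P x a
        then P x a * (cmod (inner_on G (W b) (V x a)))\<^sup>2 else 0) \<le> \<epsilon>\<^sup>2 / 4"
  shows "smooth_hmin \<epsilon> X E \<rho> \<ge> ereal (- log 2 (2 * \<theta>))"
proof -
  define B where "B = (\<lambda>x a. {b \<in> G. 2 powr dyadic (P x a) \<le> \<theta> * Q b})"
  define V' where "V' = (\<lambda>x a. truncation G W (B x a) (V x a))"
  let ?c = "\<lambda>x (\<kappa>, a). P x a" and ?y = "\<lambda>V x (\<kappa>, a). push G T (V x a) \<kappa>"
  define \<rho>' where "\<rho>' = (\<lambda>p p'. if p \<in> X \<times> E \<and> p' \<in> X \<times> E then pushed_state X K G T P V' p p' else 0)"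
  have \<rho>'_eq: "op_eq (X \<times> E) \<rho>' (pushed_state X K G T P V')" by (simp add: op_eq_def \<rho>'_def)
  have BG: "B x a \<subseteq> G" for x a by (auto simp: B_def)
  have finB: "finite (B x a)" for x a using fin(4) BG by (rule finite_subset[rotated])
  have nV: "nsq G (V x a) = 1" if "x \<in> X" "a \<in> G" for x a by (rule orthonormal_nsq[OF onV[OF that(1)] that(2)])
  have nV': "nsq G (V' x a) \<le> 1" if "x \<in> X" "a \<in> G" for x a
  proof -
    have on: "orthonormal G (B x a) W" by (rule orthonormal_subset[OF onW BG])
    have "nsq G (V' x a) \<le> nsq G (V x a)"
      unfolding V'_def nsq_truncation[OF on finB] by (rule bessel[OF on finB])
    then show ?thesis using nV[OF that] by simp
  qed
  have nd: "nsq G (\<lambda>g. V' x a g - V x a g) = (\<Sum>b\<in>G - B x a. (cmod (inner_on G (W b) (V x a)))\<^sup>2)" for x a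
    unfolding V'_def by (rule nsq_truncation_residual[OF onW fin(4) BG])
  have bound: "hmin_cond X E \<rho>' \<ge> ereal (- log 2 (2 * \<theta>))"
  proof (rule hmin_cond_cq_gram[OF fin(1,3), where J = "K \<times> G" and d = "\<lambda>(\<kappa>, b). Q b"
        and z = "\<lambda>(\<kappa>, b). push G T (W b) \<kappa>" and c = ?c and y = "?y V'" and I = "K \<times> G"])
    show "(\<Sum>j\<in>K \<times> G. (case j of (\<kappa>, b) \<Rightarrow> Q b) * nsq E (case j of (\<kappa>, b) \<Rightarrow> push G T (W b) \<kappa>)) = 1"
    proof -
      have "(\<Sum>j\<in>K \<times> G. (case j of (\<kappa>, b) \<Rightarrow> Q b) * nsq E (case j of (\<kappa>, b) \<Rightarrow> push G T (W b) \<kappa>))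
          = (\<Sum>b\<in>G. Q b * (\<Sum>\<kappa>\<in>K. nsq E (push G T (W b) \<kappa>)))"
        unfolding sum.cartesian_product' sum_distrib_left by (subst sum.swap) simp
      also have "\<dots> = 1" using Q orthonormal_nsq[OF onW] by (simp add: nsq_push[OF iso fin(4)])
      finally show ?thesis .
    qed
    show "(\<Sum>i\<in>K \<times> G. ?c x i * (cmod (inner_on E (?y V' x i) f))\<^sup>2)
        \<le> 2 * \<theta> * (\<Sum>j\<in>K \<times> G. (case j of (\<kappa>, b) \<Rightarrow> Q b) *
             (cmod (inner_on E (case j of (\<kappa>, b) \<Rightarrow> push G T (W b) \<kappa>) f))\<^sup>2)"
      if "x \<in> X" for x f
    proof -
      \<comment> \<open>Tracing out \<open>K\<close> leaves one test vector on \<open>G\<close> for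
        each \<open>\<kappa>\<close>, and the truncation estimate is applied to each of
        them.\<close>
      let ?f = "\<lambda>\<kappa> g. inner_on E (\<lambda>e. T (\<kappa>, e) g) f"
      have "(\<Sum>i\<in>K \<times> G. ?c x i * (cmod (inner_on E (?y V' x i) f))\<^sup>2)
          = (\<Sum>\<kappa>\<in>K. \<Sum>a\<in>G. P x a * (cmod (inner_on G (V' x a) (?f \<kappa>)))\<^sup>2)"
        unfolding sum.cartesian_product' by (simp add: inner_push)
      also have "\<dots> \<le> (\<Sum>\<kappa>\<in>K. 2 * \<theta> * (\<Sum>b\<in>G. Q b * (cmod (inner_on G (W b) (?f \<kappa>)))\<^sup>2))"
        unfolding V'_def B_def using P Q that \<theta>
        by (intro sum_mono truncated_spectral_le[OF fin(4) onV onW]) auto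
      also have "\<dots> = 2 * \<theta> * (\<Sum>j\<in>K \<times> G. (case j of (\<kappa>, b) \<Rightarrow> Q b) *
             (cmod (inner_on E (case j of (\<kappa>, b) \<Rightarrow> push G T (W b) \<kappa>) f))\<^sup>2)"
        unfolding sum.cartesian_product' by (simp add: inner_push sum_distrib_left)
      finally show ?thesis .
    qed
    show "op_eq (X \<times> E) \<rho>' (cq_gram X (K \<times> G) ?c (?y V'))"
      using \<rho>'_eq unfolding pushed_state_def .
  qed (use Q \<theta> in auto)
  have "\<rho>' \<in> smooth_ball (X \<times> E) \<epsilon> \<rho>"
    unfolding \<rho>'_def
  proof (rule pushed_state_in_smooth_ball[OF fin iso nV nV' P \<rho> _ \<epsilon>])
    have "(\<Sum>x\<in>X. \<Sum>a\<in>G. P x a * nsq G (\<lambda>g. V' x a g - V x a g))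
        \<le> (\<Sum>x\<in>X. \<Sum>a\<in>G. \<Sum>b\<in>G. if \<theta> * Q b < 2 * P x a
            then P x a * (cmod (inner_on G (W b) (V x a)))\<^sup>2 else 0)"
    proof (intro sum_mono)
      fix x a assume x: "x \<in> X" and a: "a \<in> G"
      show "P x a * nsq G (\<lambda>g. V' x a g - V x a g)
        \<le> (\<Sum>b\<in>G. if \<theta> * Q b < 2 * P x a then P x a * (cmod (inner_on G (W b) (V x a)))\<^sup>2 else 0)"
      proof (cases "P x a = 0")
        case False
        then have pos: "P x a > 0" using P(1)[OF x a] by simp
        have sub: "G - B x a \<subseteq> {b \<in> G. \<theta> * Q b < 2 * P x a}"
          using dyadic_bounds(2)[OF pos] by (auto simp: B_def)
        have "P x a * nsq G (\<lambda>g. V' x a g - V x a g)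
            \<le> P x a * (\<Sum>b\<in>{b \<in> G. \<theta> * Q b < 2 * P x a}. (cmod (inner_on G (W b) (V x a)))\<^sup>2)"
          unfolding nd using pos fin(4) sub by (intro mult_left_mono sum_mono2) auto
        then show ?thesis using fin(4)
          by (simp add: sum_distrib_left sum.inter_filter if_distrib[of "\<lambda>y. P x a * y"] cong: if_cong)
      qed (auto intro!: sum_nonneg)
    qed
    then show "(\<Sum>x\<in>X. \<Sum>a\<in>G. P x a * nsq G (\<lambda>g. V' x a g - V x a g)) \<le> \<epsilon>\<^sup>2 / 4"
      using tail by linarith
  qed
  then show ?thesis
    unfolding smooth_hmin_def using bound by (intro SUP_upper2[of \<rho>']) auto
qed

subsection \<open>Cumulant bound\<close>

text \<open>The quadratic on the right times the lower bound \<open>1 + y + y\<^sup>2 / 2\<close> of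
  \<open>exp y\<close> is \<open>1 + y ^ 4 / 4\<close>, hence at least 1.\<close>

lemma exp_upper_quadratic:
  fixes y :: real
  assumes "y \<ge> 0"
  shows "exp (- y) \<le> 1 - y + y\<^sup>2 / 2"
proof -
  have "1 + y + y\<^sup>2 / 2 \<le> exp y" using assms by (rule exp_lower_Taylor_quadratic)
  moreover have "1 - y + y\<^sup>2 / 2 \<ge> 0"
    using zero_le_power2[of "1 - y"] by (simp add: power2_eq_square algebra_simps)
  ultimately have "(1 - y + y\<^sup>2 / 2) * (1 + y + y\<^sup>2 / 2) \<le> (1 - y + y\<^sup>2 / 2) * exp y"
    by (rule mult_left_mono)
  moreover have "(1 - y + y\<^sup>2 / 2) * (1 + y + y\<^sup>2 / 2) = 1 + y ^ 4 / 4"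
    by (simp add: power2_eq_square power4_eq_xxxx field_simps)
  moreover have "y ^ 4 / 4 \<ge> 0" by simp
  ultimately have "1 \<le> (1 - y + y\<^sup>2 / 2) * exp y" by linarith
  then have "1 * exp (- y) \<le> (1 - y + y\<^sup>2 / 2) * exp y * exp (- y)" by (rule mult_right_mono) simp
  also have "\<dots> = 1 - y + y\<^sup>2 / 2" by (simp add: mult.assoc exp_minus)
  finally show ?thesis by simp
qed

text \<open>For \<open>u < 2\<close> this is the Pade bound
  \<open>exp u \<le> (2 + u) / (2 - u)\<close>. Up to a factor \<open>x\<close> the same expression
  is the numerator of the derivative in \<open>exp_remainder_quotient_mono\<close>.\<close>

lemma exp_pade_ge:
  fixes u :: real
  assumes "u \<ge> 0"
  shows "(u - 2) * exp u + u + 2 \<ge> 0"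
proof -
  have "(\<lambda>u::real. (u - 2) * exp u + u + 2) 0 \<le> (\<lambda>u. (u - 2) * exp u + u + 2) u"
  proof (rule DERIV_nonneg_imp_nondecreasing[OF assms])
    fix x :: real assume "0 \<le> x" "x \<le> u"
    have "((\<lambda>u. (u - 2) * exp u + u + 2) has_real_derivative ((x - 1) * exp x + 1)) (at x)"
      by (auto intro!: derivative_eq_intros simp: algebra_simps)
    moreover have "(x - 1) * exp x + 1 \<ge> 0"
    proof -
      have "1 - x \<le> exp (- x)" using exp_ge_add_one_self[of "- x"] by simp
      then have "(1 - x) * exp x \<le> exp (- x) * exp x" by (rule mult_right_mono) simp
      then show ?thesis by (simp add: exp_minus algebra_simps)
    qed
    ultimately show "\<exists>y. ((\<lambda>u. (u - 2) * exp u + u + 2) has_real_derivative y) (at x) \<and> 0 \<le> y" by blast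
  qed
  then show ?thesis by simp
qed

lemma exp_remainder_quotient_mono:
  fixes a b :: real
  assumes "0 < a" "a \<le> b"
  shows "(exp a - 1 - a) / a\<^sup>2 \<le> (exp b - 1 - b) / b\<^sup>2"
proof (rule DERIV_nonneg_imp_nondecreasing[OF assms(2), of "\<lambda>u. (exp u - 1 - u) / u\<^sup>2"])
  fix x assume x: "a \<le> x" "x \<le> b"
  then have pos: "x > 0" using assms by simp
  have n: "((\<lambda>u. exp u - 1 - u) has_real_derivative (exp x - 1)) (at x)"
    by (auto intro!: derivative_eq_intros)
  have d: "((\<lambda>u. u\<^sup>2) has_real_derivative (2 * x)) (at x)"
    by (auto intro!: derivative_eq_intros)
  have "((\<lambda>u. (exp u - 1 - u) / u\<^sup>2) has_real_derivative
      ((exp x - 1) * x\<^sup>2 - (exp x - 1 - x) * (2 * x)) / (x\<^sup>2 * x\<^sup>2)) (at x)"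
    using pos by (intro DERIV_divide[OF n d]) simp
  moreover have "(exp x - 1) * x\<^sup>2 - (exp x - 1 - x) * (2 * x) = x * ((x - 2) * exp x + x + 2)"
    by (simp add: power2_eq_square algebra_simps)
  moreover have "x * ((x - 2) * exp x + x + 2) \<ge> 0"
    using exp_pade_ge[of x] pos by (intro mult_nonneg_nonneg) auto
  then have "x * ((x - 2) * exp x + x + 2) / (x\<^sup>2 * x\<^sup>2) \<ge> 0" by (intro divide_nonneg_nonneg) auto
  ultimately show "\<exists>y. ((\<lambda>u. (exp u - 1 - u) / u\<^sup>2) has_real_derivative y) (at x) \<and> 0 \<le> y"
    by (intro exI[of _ "((exp x - 1) * x\<^sup>2 - (exp x - 1 - x) * (2 * x)) / (x\<^sup>2 * x\<^sup>2)"]) simp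
qed

text \<open>The remainder divided by \<open>(s * v)\<^sup>2\<close> increases with \<open>s\<close>,
  so \<open>s = 1 / 2\<close> is the worst case. That leaves an inequality in
  \<open>x = exp (v / 2)\<close> alone, since the Pade bound estimates \<open>v / 2\<close> by a
  rational function of \<open>x\<close>.\<close>

lemma exp_remainder_le:
  fixes s v :: real
  assumes s: "0 \<le> s" "s \<le> 1 / 2" and v: "v \<ge> 0"
  shows "exp (s * v) - 1 - s * v \<le> s\<^sup>2 * exp v / 2"
proof (cases "s * v = 0")
  case False
  then have pos: "s > 0" "v > 0" using s v by auto
  define y where "y = v / 2"
  have y: "y > 0" using pos by (simp add: y_def)
  have "(exp (s * v) - 1 - s * v) / (s * v)\<^sup>2 \<le> (exp y - 1 - y) / y\<^sup>2"
    using pos s by (intro exp_remainder_quotient_mono) (auto simp: y_def)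
  then have "exp (s * v) - 1 - s * v \<le> (exp y - 1 - y) / y\<^sup>2 * (s * v)\<^sup>2"
    using pos by (simp add: pos_divide_le_eq)
  also have "\<dots> = s\<^sup>2 * (4 * (exp y - 1 - y))"
    using y by (simp add: y_def power_mult_distrib power_divide)
  also have "\<dots> \<le> s\<^sup>2 * (exp v / 2)"
  proof (intro mult_left_mono)
    define x where "x = exp y"
    have x: "x \<ge> 1" using y by (simp add: x_def)
    have k: "2 * (x - 1) \<le> y * (x + 1)" using exp_pade_ge[of y] y by (simp add: x_def algebra_simps)
    have "8 * (x - 1 - y) * (x + 1) \<le> 8 * (x - 1) * (x + 1) - 16 * (x - 1)"
      using k by (simp add: algebra_simps)
    \<comment> \<open>The left side is \<open>8 * (x - 1)\<^sup>2\<close>; the square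
      \<open>(x - 3)\<^sup>2\<close> makes the gap to \<open>x\<^sup>2 * (x + 1)\<close> visibly
      nonnegative for \<open>x \<ge> 1\<close>.\<close>
    also have "\<dots> = x\<^sup>2 * (x + 1) - ((x - 1) * (x - 3)\<^sup>2 + x + 1)" by algebra
    also have "\<dots> \<le> x\<^sup>2 * (x + 1)"
    proof -
      have "(x - 1) * (x - 3)\<^sup>2 \<ge> 0" using x by (intro mult_nonneg_nonneg) auto
      then show ?thesis using x by linarith
    qed
    finally have "8 * (x - 1 - y) \<le> x\<^sup>2" using x by (simp add: mult_le_cancel_right)
    moreover have "exp v = x\<^sup>2" using exp_double[of y] by (simp add: x_def y_def)
    ultimately show "4 * (exp y - 1 - y) \<le> exp v / 2" by (simp add: x_def)
  qed simp
  finally show ?thesis by simp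
qed auto

text \<open>Both sides agree to first order at \<open>w = r\<close>. The exponential carries the
  small factor \<open>exp (- r)\<close>, so a second moment is bounded by roughly
  \<open>r\<^sup>2\<close> when what is known is the moment of \<open>exp w\<close>.\<close>

lemma square_le_tangent_exp:
  fixes r w :: real
  assumes r: "r \<ge> 2" and w: "w \<ge> 0"
  shows "w\<^sup>2 \<le> r\<^sup>2 - 2 * r + 2 * r * exp (w - r)"
proof (cases "w \<ge> r")
  case True
  define d where "d = w - r"
  have "1 + d + d\<^sup>2 / 2 \<le> exp d" using True by (intro exp_lower_Taylor_quadratic) (simp add: d_def)
  then have "2 * r * (1 + d + d\<^sup>2 / 2) \<le> 2 * r * exp d" using r by (intro mult_left_mono) auto
  moreover have "2 * r * (1 + d + d\<^sup>2 / 2) = 2 * r + 2 * r * d + r * d\<^sup>2" by algebra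
  moreover have "r * d\<^sup>2 \<ge> 1 * d\<^sup>2" using r by (intro mult_right_mono) auto
  moreover have "w\<^sup>2 = r\<^sup>2 + 2 * r * d + d\<^sup>2" unfolding d_def by algebra
  ultimately show ?thesis unfolding d_def by linarith
next
  case False
  define m where "m = r - w"
  have m: "0 < m" "m \<le> r" using False w by (auto simp: m_def)
  have ge0: "exp (- m) - 1 + m \<ge> 0" using exp_ge_add_one_self[of "- m"] by simp
  have "m\<^sup>2 \<le> 2 * r * (exp (- m) - 1 + m)"
  \<comment> \<open>Up to 2 it is enough to square \<open>1 - m / 2 \<le> exp (- (m / 2))\<close>,
    whose left side is nonnegative there; beyond 2 the linear term alone suffices, by
    \<open>m \<le> r\<close>.\<close>
  proof (cases "m \<le> 2")
    case True
    have "1 - m / 2 \<le> exp (- (m / 2))" using exp_ge_add_one_self[of "- (m / 2)"] by simp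
    then have "(1 - m / 2)\<^sup>2 \<le> (exp (- (m / 2)))\<^sup>2" using True by (intro power_mono) auto
    also have "(exp (- (m / 2)))\<^sup>2 = exp (- m)" using exp_double[of "- (m / 2)"] by simp
    finally have "m\<^sup>2 \<le> 4 * (exp (- m) - 1 + m)" by (simp add: power2_eq_square algebra_simps)
    also have "\<dots> \<le> 2 * r * (exp (- m) - 1 + m)" using r ge0 by (intro mult_right_mono) auto
    finally show ?thesis .
  next
    case False
    have "m\<^sup>2 \<le> 2 * m * (m - 1)" using False m by (simp add: power2_eq_square algebra_simps)
    also have "\<dots> \<le> 2 * r * (m - 1)" using m False by (intro mult_right_mono) auto
    also have "\<dots> \<le> 2 * r * (exp (- m) - 1 + m)" using r by (intro mult_left_mono) auto
    finally show ?thesis .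
  qed
  moreover have "w\<^sup>2 = r\<^sup>2 - 2 * r * m + m\<^sup>2" unfolding m_def by algebra
  moreover have "2 * r * (exp (- m) - 1 + m) = 2 * r * exp (- m) - 2 * r + 2 * r * m" by algebra
  moreover have "w - r = - m" by (simp add: m_def)
  ultimately show ?thesis by simp
qed

text \<open>For \<open>w \<ge> 0\<close> the second-order term is \<open>w\<^sup>2\<close>, replaced
  by its exponential majorant; for \<open>w < 0\<close> it is governed by \<open>exp (- w)\<close>.
  Both bounds are nonnegative, so their sum serves for either sign.\<close>

lemma exp_second_order_le:
  fixes s w r :: real
  assumes s: "0 \<le> s" "s \<le> 1 / 2" and r: "r \<ge> 2"
  shows "exp (- s * w) \<le> 1 - s * w + s\<^sup>2 * ((r\<^sup>2 - 2 * r + 2 * r * exp (w - r)) / 2 + exp (- w) / 2)"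
proof (cases "w \<ge> 0")
  case True
  have "exp (- s * w) \<le> 1 - s * w + (s * w)\<^sup>2 / 2"
    using exp_upper_quadratic[of "s * w"] s True by simp
  also have "(s * w)\<^sup>2 / 2 = s\<^sup>2 * (w\<^sup>2 / 2)" by (simp add: power_mult_distrib)
  also have "\<dots> \<le> s\<^sup>2 * ((r\<^sup>2 - 2 * r + 2 * r * exp (w - r)) / 2 + exp (- w) / 2)"
  proof (intro mult_left_mono)
    show "w\<^sup>2 / 2 \<le> (r\<^sup>2 - 2 * r + 2 * r * exp (w - r)) / 2 + exp (- w) / 2"
      unfolding add_divide_distrib[symmetric]
      by (intro divide_right_mono order_trans[OF square_le_tangent_exp[OF r True]]) auto
  qed simp
  finally show ?thesis by simp
next
  case False
  have "exp (- s * w) - 1 + s * w \<le> s\<^sup>2 * (exp (- w) / 2)"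
    using exp_remainder_le[OF s, of "- w"] False by simp
  also have "\<dots> \<le> s\<^sup>2 * ((r\<^sup>2 - 2 * r + 2 * r * exp (w - r)) / 2 + exp (- w) / 2)"
  proof (intro mult_left_mono)
    have "r\<^sup>2 - 2 * r = r * (r - 2)" by algebra
    then have "r\<^sup>2 - 2 * r \<ge> 0" using r by simp
    moreover have "2 * r * exp (w - r) \<ge> 0" using r by simp
    ultimately have "r\<^sup>2 - 2 * r + 2 * r * exp (w - r) \<ge> 0" by (rule add_nonneg_nonneg)
    then show "exp (- w) / 2 \<le> (r\<^sup>2 - 2 * r + 2 * r * exp (w - r)) / 2 + exp (- w) / 2" by simp
  qed simp
  finally show ?thesis by linarith
qed

text \<open>The two exponential moments control the quadratic term of the cumulant generating function.\<close>
lemma exp_moment_le: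
  fixes m w :: "'i \<Rightarrow> real"
  assumes fin: "finite I" and m: "\<And>i. i \<in> I \<Longrightarrow> m i \<ge> 0" "sum m I = 1"
    and up: "(\<Sum>i\<in>I. m i * exp (w i)) \<le> exp l" and dn: "(\<Sum>i\<in>I. m i * exp (- w i)) \<le> 1"
    and mean: "h \<le> (\<Sum>i\<in>I. m i * w i)"
    and l: "l \<ge> ln 2" and s: "0 \<le> s" "s \<le> 1 / 2"
  shows "(\<Sum>i\<in>I. m i * exp (- s * w i)) \<le> exp (- s * h + s\<^sup>2 * ((l + ln 2)\<^sup>2 / (2 * ln 2)))"
proof -
  define a where "a = ln (2::real)"
  have a1: "a \<ge> 2 / 3" using ln2_ge_two_thirds by (simp add: a_def)
  have a2: "a \<le> 25 / 36" using ln2_le_25_over_36 by (simp add: a_def)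
  \<comment> \<open>The shift makes \<open>r \<ge> 2\<close>, because
    \<open>ln 2 \<ge> 2 / 3\<close>, and leaves \<open>exp (- r) * exp l = exp (- 4 / 3)\<close>, a
    constant of at most \<open>9 / 32\<close>.\<close>
  define r where "r = l + 4 / 3"
  have r: "r \<ge> 2" using l a1 by (simp add: r_def a_def)
  have e43: "exp (- 4 / 3 :: real) \<le> 9 / 32"
  proof -
    have "17 / 9 \<le> exp (2 / 3 :: real)"
      using exp_lower_Taylor_quadratic[of "2 / 3 :: real"] by (simp add: power2_eq_square)
    then have "(17 / 9)\<^sup>2 \<le> (exp (2 / 3 :: real))\<^sup>2" by (rule power_mono) simp
    also have "(exp (2 / 3 :: real))\<^sup>2 = exp (4 / 3)" using exp_double[of "2 / 3 :: real"] by simp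
    finally have "32 / 9 \<le> exp (4 / 3 :: real)" by (simp add: power2_eq_square)
    then have "inverse (exp (4 / 3 :: real)) \<le> inverse (32 / 9)" by (rule le_imp_inverse_le) simp
    then show ?thesis by (simp add: exp_minus)
  qed
  have pointwise: "m i * exp (- s * w i) \<le> m i - s * (m i * w i)
      + s\<^sup>2 * ((r\<^sup>2 - 2 * r) / 2 * m i + r * exp (- r) * (m i * exp (w i)) + (m i * exp (- w i)) / 2)"
    if "i \<in> I" for i
  proof -
    have "exp (w i - r) = exp (- r) * exp (w i)" by (simp flip: exp_add)
    then have "m i * exp (- s * w i) \<le> m i * (1 - s * w i + s\<^sup>2 * ((r\<^sup>2 - 2 * r + 2 * r * (exp (- r) * exp (w i))) / 2 + exp (- w i) / 2))"
      using exp_second_order_le[OF s r, of "w i"] m(1)[OF that] by (intro mult_left_mono) auto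
    then show ?thesis by (simp add: algebra_simps add_divide_distrib diff_divide_distrib)
  qed
  have "(\<Sum>i\<in>I. m i * exp (- s * w i)) \<le> (\<Sum>i\<in>I. m i - s * (m i * w i)
      + s\<^sup>2 * ((r\<^sup>2 - 2 * r) / 2 * m i + r * exp (- r) * (m i * exp (w i)) + (m i * exp (- w i)) / 2))"
    by (intro sum_mono pointwise)
  also have "\<dots> = sum m I - s * (\<Sum>i\<in>I. m i * w i) + s\<^sup>2 * ((r\<^sup>2 - 2 * r) / 2 * sum m I
      + r * exp (- r) * (\<Sum>i\<in>I. m i * exp (w i)) + (\<Sum>i\<in>I. m i * exp (- w i)) / 2)"
    by (simp only: sum.distrib sum_subtractf flip: sum_distrib_left sum_divide_distrib)
  also have "\<dots> \<le> 1 - s * h + s\<^sup>2 * ((r\<^sup>2 - 2 * r) / 2 + r * (9 / 32) + 1 / 2)"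
  proof -
    have "r * exp (- r) * (\<Sum>i\<in>I. m i * exp (w i)) \<le> r * exp (- r) * exp l"
      using up r by (intro mult_left_mono) auto
    also have "\<dots> = r * exp (- 4 / 3)" by (simp add: r_def mult.assoc flip: exp_add)
    also have "\<dots> \<le> r * (9 / 32)" using e43 r by (intro mult_left_mono) auto
    finally have "(r\<^sup>2 - 2 * r) / 2 * sum m I + r * exp (- r) * (\<Sum>i\<in>I. m i * exp (w i)) + (\<Sum>i\<in>I. m i * exp (- w i)) / 2
        \<le> (r\<^sup>2 - 2 * r) / 2 + r * (9 / 32) + 1 / 2" using dn m(2) by simp
    then have "s\<^sup>2 * ((r\<^sup>2 - 2 * r) / 2 * sum m I + r * exp (- r) * (\<Sum>i\<in>I. m i * exp (w i)) + (\<Sum>i\<in>I. m i * exp (- w i)) / 2)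
        \<le> s\<^sup>2 * ((r\<^sup>2 - 2 * r) / 2 + r * (9 / 32) + 1 / 2)" by (rule mult_left_mono) simp
    moreover have "s * h \<le> s * (\<Sum>i\<in>I. m i * w i)" using mean s by (intro mult_left_mono) auto
    ultimately show ?thesis using m(2) by linarith
  qed
  \<comment> \<open>Quadratics in \<open>l\<close> are compared: \<open>1 / 2\<close> against
    \<open>1 / (2 * a) \<ge> 18 / 25\<close>, then \<open>59 / 96\<close> against 1. The target has
    this form because it equals \<open>ln 2 * (L + 1)\<^sup>2 / 2\<close> for
    \<open>l = L * ln 2\<close>.\<close>
  also have "\<dots> \<le> 1 - s * h + s\<^sup>2 * ((l + a)\<^sup>2 / (2 * a))"
  proof (intro add_left_mono mult_left_mono)
    have la: "l \<ge> a" using l by (simp add: a_def)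
    have "(l + a)\<^sup>2 / (2 * a) = l\<^sup>2 / (2 * a) + l + a / 2"
      using a1 by (simp add: field_simps power2_eq_square)
    moreover have "l\<^sup>2 / (2 * a) \<ge> l\<^sup>2 * (18 / 25)"
    proof -
      have "l\<^sup>2 * (18 / 25) * (2 * a) \<le> l\<^sup>2 * (18 / 25) * (25 / 18)" using a2 by (intro mult_left_mono) auto
      then show ?thesis using a1 by (simp add: pos_le_divide_eq)
    qed
    moreover have "l\<^sup>2 \<ge> 4 / 9" using power_mono[of "2/3" l 2] la a1 by (simp add: power_divide)
    moreover have "(r\<^sup>2 - 2 * r) / 2 + r * (9 / 32) + 1 / 2 = l\<^sup>2 / 2 + l * (59 / 96) + (8 / 9 - 4 / 3 + 3 / 8 + 1 / 2)"
      by (simp add: r_def power2_eq_square field_simps)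
    ultimately show "(r\<^sup>2 - 2 * r) / 2 + r * (9 / 32) + 1 / 2 \<le> (l + a)\<^sup>2 / (2 * a)"
      using la a1 by linarith
  qed simp
  also have "\<dots> \<le> exp (- s * h + s\<^sup>2 * ((l + a)\<^sup>2 / (2 * a)))"
    using exp_ge_add_one_self[of "- s * h + s\<^sup>2 * ((l + a)\<^sup>2 / (2 * a))"] by linarith
  finally show ?thesis by (simp add: a_def)
qed

subsection \<open>Asymptotic equipartition\<close>

lemma sum_prod_lists3:
  fixes g :: "'a \<Rightarrow> 'b \<Rightarrow> 'c \<Rightarrow> real"
  shows "(\<Sum>xs\<in>lists_len n X. \<Sum>as\<in>lists_len n A. \<Sum>bs\<in>lists_len n B. \<Prod>i<n. g (xs ! i) (as ! i) (bs ! i))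
    = (\<Sum>x\<in>X. \<Sum>a\<in>A. \<Sum>b\<in>B. g x a b) ^ n"
proof -
  have "(\<Sum>xs\<in>lists_len n X. \<Sum>as\<in>lists_len n A. \<Sum>bs\<in>lists_len n B. \<Prod>i<n. g (xs ! i) (as ! i) (bs ! i))
      = (\<Sum>xs\<in>lists_len n X. \<Sum>as\<in>lists_len n A. \<Prod>i<n. \<Sum>b\<in>B. g (xs ! i) (as ! i) b)"
    by (intro sum.cong refl sum_prod_lists)
  also have "\<dots> = (\<Sum>xs\<in>lists_len n X. \<Prod>i<n. \<Sum>a\<in>A. \<Sum>b\<in>B. g (xs ! i) a b)"
    by (intro sum.cong refl sum_prod_lists)
  also have "\<dots> = (\<Prod>i<n. \<Sum>x\<in>X. \<Sum>a\<in>A. \<Sum>b\<in>B. g x a b)" by (rule sum_prod_lists)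
  finally show ?thesis by simp
qed

text \<open>Chernoff's bound: where the condition holds, the ratio of
  \<open>2 * (\<Prod>i<n. p (xs ! i) (as ! i))\<close> to
  \<open>\<theta> * (\<Prod>i<n. q (bs ! i))\<close> exceeds 1, so its power \<open>s\<close> is at
  least 1, and powers of products factorise. By \<open>pos\<close> no division by 0, with its
  default value 0, occurs where the weight is positive.\<close>

lemma product_tail_le:
  fixes p :: "'x \<Rightarrow> 'a \<Rightarrow> real" and q :: "'b \<Rightarrow> real" and c :: "'x \<Rightarrow> 'a \<Rightarrow> 'b \<Rightarrow> real"
  assumes p: "\<And>x a. x \<in> X \<Longrightarrow> a \<in> A \<Longrightarrow> p x a \<ge> 0"
    and q: "\<And>b. b \<in> B \<Longrightarrow> q b \<ge> 0"
    and c: "\<And>x a b. x \<in> X \<Longrightarrow> a \<in> A \<Longrightarrow> b \<in> B \<Longrightarrow> c x a b \<ge> 0"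
    and pos: "\<And>x a b. x \<in> X \<Longrightarrow> a \<in> A \<Longrightarrow> b \<in> B \<Longrightarrow> p x a > 0 \<Longrightarrow> c x a b > 0 \<Longrightarrow> q b > 0"
    and \<theta>: "\<theta> > 0" and s: "s \<ge> 0"
  shows "(\<Sum>xs\<in>lists_len n X. \<Sum>as\<in>lists_len n A. \<Sum>bs\<in>lists_len n B.
      if \<theta> * (\<Prod>i<n. q (bs ! i)) < 2 * (\<Prod>i<n. p (xs ! i) (as ! i))
      then (\<Prod>i<n. p (xs ! i) (as ! i)) * (\<Prod>i<n. c (xs ! i) (as ! i) (bs ! i)) else 0)
    \<le> (2 / \<theta>) powr s * (\<Sum>x\<in>X. \<Sum>a\<in>A. \<Sum>b\<in>B. p x a * c x a b * (p x a / q b) powr s) ^ n"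
proof -
  let ?g = "\<lambda>x a b. p x a * c x a b * (p x a / q b) powr s"
  have "(\<Sum>xs\<in>lists_len n X. \<Sum>as\<in>lists_len n A. \<Sum>bs\<in>lists_len n B.
      if \<theta> * (\<Prod>i<n. q (bs ! i)) < 2 * (\<Prod>i<n. p (xs ! i) (as ! i))
      then (\<Prod>i<n. p (xs ! i) (as ! i)) * (\<Prod>i<n. c (xs ! i) (as ! i) (bs ! i)) else 0)
    \<le> (\<Sum>xs\<in>lists_len n X. \<Sum>as\<in>lists_len n A. \<Sum>bs\<in>lists_len n B.
        (2 / \<theta>) powr s * (\<Prod>i<n. ?g (xs ! i) (as ! i) (bs ! i)))"
  proof (intro sum_mono)
    fix xs as bs assume xs: "xs \<in> lists_len n X" and as: "as \<in> lists_len n A" and bs: "bs \<in> lists_len n B"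
    have mem: "xs ! i \<in> X" "as ! i \<in> A" "bs ! i \<in> B" if "i < n" for i
      using xs as bs that by (auto intro: lists_len_nth)
    define pp where "pp = (\<lambda>i. p (xs ! i) (as ! i))"
    define qq where "qq = (\<lambda>i. q (bs ! i))"
    define cc where "cc = (\<lambda>i. c (xs ! i) (as ! i) (bs ! i))"
    have nn: "pp i \<ge> 0" "qq i \<ge> 0" "cc i \<ge> 0" if "i < n" for i
      using mem[OF that] p q c by (auto simp: pp_def qq_def cc_def)
    have pos': "qq i > 0" if "i < n" "pp i > 0" "cc i > 0" for i
      using mem[OF that(1)] pos that by (auto simp: pp_def qq_def cc_def)
    have rhs0: "(2 / \<theta>) powr s * (\<Prod>i<n. pp i * cc i * (pp i / qq i) powr s) \<ge> 0"
      using nn by (intro mult_nonneg_nonneg prod_nonneg) auto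
    have "(if \<theta> * (\<Prod>i<n. qq i) < 2 * (\<Prod>i<n. pp i) then (\<Prod>i<n. pp i) * (\<Prod>i<n. cc i) else 0)
        \<le> (2 / \<theta>) powr s * (\<Prod>i<n. pp i * cc i * (pp i / qq i) powr s)"
    proof (cases "\<theta> * (\<Prod>i<n. qq i) < 2 * (\<Prod>i<n. pp i) \<and> (\<Prod>i<n. pp i) * (\<Prod>i<n. cc i) \<noteq> 0")
      case True
      then have "pp i \<noteq> 0" "cc i \<noteq> 0" if "i < n" for i using that by (auto simp: prod_zero_iff)
      then have pc: "pp i > 0" "cc i > 0" if "i < n" for i using nn that by (auto simp: order_less_le)
      then have qp: "qq i > 0" if "i < n" for i using pos' that by blast
      have Q: "(\<Prod>i<n. qq i) > 0" and P: "(\<Prod>i<n. pp i) > 0" and C: "(\<Prod>i<n. cc i) > 0"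
        using pc qp by (auto intro!: prod_pos)
      have "1 \<le> (2 * (\<Prod>i<n. pp i) / (\<theta> * (\<Prod>i<n. qq i))) powr s"
        using True Q \<theta> s by (intro ge_one_powr_ge_zero) (auto simp: le_divide_eq)
      also have "2 * (\<Prod>i<n. pp i) / (\<theta> * (\<Prod>i<n. qq i)) = (2 / \<theta>) * (\<Prod>i<n. pp i / qq i)"
        by (simp add: prod_dividef)
      also have "\<dots> powr s = (2 / \<theta>) powr s * (\<Prod>i<n. (pp i / qq i) powr s)"
        using \<theta> pc qp by (subst powr_mult) (auto intro!: prod_nonneg simp: prod_powr_distrib less_imp_le)
      finally have "(\<Prod>i<n. pp i) * (\<Prod>i<n. cc i) * 1
          \<le> (\<Prod>i<n. pp i) * (\<Prod>i<n. cc i) * ((2 / \<theta>) powr s * (\<Prod>i<n. (pp i / qq i) powr s))"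
        using P C by (intro mult_left_mono) auto
      then show ?thesis using True by (simp add: prod.distrib mult_ac)
    next
      case False
      then have "(if \<theta> * (\<Prod>i<n. qq i) < 2 * (\<Prod>i<n. pp i) then (\<Prod>i<n. pp i) * (\<Prod>i<n. cc i) else 0) = 0"
        by presburger
      then show ?thesis using rhs0 by simp
    qed
    then show "(if \<theta> * (\<Prod>i<n. q (bs ! i)) < 2 * (\<Prod>i<n. p (xs ! i) (as ! i))
        then (\<Prod>i<n. p (xs ! i) (as ! i)) * (\<Prod>i<n. c (xs ! i) (as ! i) (bs ! i)) else 0)
      \<le> (2 / \<theta>) powr s * (\<Prod>i<n. ?g (xs ! i) (as ! i) (bs ! i))"
      by (simp only: pp_def qq_def cc_def)
  qed
  also have "\<dots> = (2 / \<theta>) powr s * (\<Sum>xs\<in>lists_len n X. \<Sum>as\<in>lists_len n A. \<Sum>bs\<in>lists_len n B.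
      \<Prod>i<n. ?g (xs ! i) (as ! i) (bs ! i))"
    by (simp only: sum_distrib_left)
  also have "\<dots> = (2 / \<theta>) powr s * (\<Sum>x\<in>X. \<Sum>a\<in>A. \<Sum>b\<in>B. ?g x a b) ^ n"
    by (simp only: sum_prod_lists3[where g = ?g])
  finally show ?thesis .
qed

text \<open>The outputs are regrouped into a list for \<open>K\<close> and a list for
  \<open>E\<close>, so that the whole first register can be traced out at once.\<close>

definition tensor_iso :: "nat \<Rightarrow> ('k \<times> 'e \<Rightarrow> 'g \<Rightarrow> complex) \<Rightarrow> 'k list \<times> 'e list \<Rightarrow> 'g list \<Rightarrow> complex" where
  "tensor_iso n T = (\<lambda>(\<kappa>s, es) gs. \<Prod>i<n. T (\<kappa>s ! i, es ! i) (gs ! i))"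

lemma isometry_tensor_iso:
  assumes "isometry G (K \<times> E) T"
  shows "isometry (lists_len n G) (lists_len n K \<times> lists_len n E) (tensor_iso n T)"
  unfolding isometry_def
proof (intro ballI)
  fix as bs assume as: "as \<in> lists_len n G" and bs: "bs \<in> lists_len n G"
  have "(\<Sum>w\<in>lists_len n K \<times> lists_len n E. cnj (tensor_iso n T w as) * tensor_iso n T w bs)
      = (\<Sum>\<kappa>s\<in>lists_len n K. \<Sum>es\<in>lists_len n E.
          \<Prod>i<n. cnj (T (\<kappa>s ! i, es ! i) (as ! i)) * T (\<kappa>s ! i, es ! i) (bs ! i))"
    by (simp add: sum.cartesian_product' tensor_iso_def prod.distrib)
  also have "\<dots> = (\<Sum>\<kappa>s\<in>lists_len n K. \<Prod>i<n. \<Sum>e\<in>E. cnj (T (\<kappa>s ! i, e) (as ! i)) * T (\<kappa>s ! i, e) (bs ! i))"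
    by (intro sum.cong refl sum_prod_lists)
  also have "\<dots> = (\<Prod>i<n. \<Sum>\<kappa>\<in>K. \<Sum>e\<in>E. cnj (T (\<kappa>, e) (as ! i)) * T (\<kappa>, e) (bs ! i))"
    by (rule sum_prod_lists)
  also have "\<dots> = (\<Prod>i<n. if as ! i = bs ! i then 1 else 0)"
  proof (rule prod.cong[OF refl])
    fix i assume "i \<in> {..<n}"
    then have "as ! i \<in> G" "bs ! i \<in> G" using as bs lists_len_nth by auto
    then have "(\<Sum>w\<in>K \<times> E. cnj (T w (as ! i)) * T w (bs ! i)) = (if as ! i = bs ! i then 1 else 0)"
      using assms unfolding isometry_def by blast
    then show "(\<Sum>\<kappa>\<in>K. \<Sum>e\<in>E. cnj (T (\<kappa>, e) (as ! i)) * T (\<kappa>, e) (bs ! i)) = (if as ! i = bs ! i then 1 else 0)"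
      by (simp only: sum.cartesian_product')
  qed
  also have "\<dots> = (if as = bs then 1 else 0)"
  proof (cases "as = bs")
    case False
    then obtain i where "i < n" "as ! i \<noteq> bs ! i"
      using as bs by (auto simp: lists_len_def list_eq_iff_nth_eq)
    then show ?thesis using False by (auto intro!: prod_zero)
  qed simp
  finally show "(\<Sum>w\<in>lists_len n K \<times> lists_len n E. cnj (tensor_iso n T w as) * tensor_iso n T w bs)
      = (if as = bs then 1 else 0)" .
qed

text \<open>An operator \<open>M\<close> above \<open>p |v><v|\<close> satisfies
  \<open>p <v| M^-1 |v> \<le> 1\<close>, with the inverse taken on the positive eigenvalues. It is
  the reason why the moment of \<open>exp (- w)\<close> in the equipartition theorem is at most
  1.\<close>

lemma truncated_collision_le:
  assumes fin: "finite G" and onW: "orthonormal G G W"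
    and p: "\<And>a. a \<in> G \<Longrightarrow> p a \<ge> (0::real)" and a: "a \<in> G"
    and dom: "\<And>f. (\<Sum>a\<in>G. p a * (cmod (inner_on G (V a) f))\<^sup>2)
        \<le> (\<Sum>b\<in>G. q b * (cmod (inner_on G (W b) f))\<^sup>2)"
  shows "(\<Sum>b\<in>G. if q b > 0 then p a * (p a * ((cmod (inner_on G (W b) (V a)))\<^sup>2 / q b)) else 0) \<le> p a"
proof -
  define c where "c = (\<lambda>b. (cmod (inner_on G (W b) (V a)))\<^sup>2)"
  have c0: "c b \<ge> 0" for b by (simp add: c_def)
  define G' where "G' = {b \<in> G. q b > 0}"
  have G': "G' \<subseteq> G" "finite G'" using fin by (auto simp: G'_def)
  have onG': "orthonormal G G' W" by (rule orthonormal_subset[OF onW G'(1)])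
  \<comment> \<open>The inverse of the dominating operator applied to \<open>V a\<close>: for this
    test vector \<open>dom\<close> yields \<open>p a * k\<^sup>2 \<le> k\<close>.\<close>
  define f where "f = (\<lambda>g. \<Sum>b\<in>G'. (inner_on G (W b) (V a) / of_real (q b)) * W b g)"
  define k where "k = (\<Sum>b\<in>G'. c b / q b)"
  have k0: "k \<ge> 0" unfolding k_def using c0 by (intro sum_nonneg) (auto simp: G'_def)
  have "inner_on G (V a) f = (\<Sum>b\<in>G'. of_real (c b / q b))"
    unfolding f_def inner_on_sum_right c_def
    by (intro sum.cong refl) (simp add: complex_norm_square cnj_inner_on del: of_real_power)
  then have Vf: "inner_on G (V a) f = of_real k" by (simp add: k_def)
  have Wf: "inner_on G (W b) f = (if b \<in> G' then inner_on G (W b) (V a) / of_real (q b) else 0)" if "b \<in> G" for b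
  proof (cases "b \<in> G'")
    case True
    then show ?thesis unfolding f_def inner_on_orthonormal_comb[OF onG' G'(2) True] by simp
  next
    case False
    have "inner_on G (W b) f = (\<Sum>b'\<in>G'. (inner_on G (W b') (V a) / of_real (q b')) * inner_on G (W b) (W b'))"
      unfolding f_def by (rule inner_on_sum_right)
    also have "\<dots> = 0" using onW that False G'(1) by (intro sum.neutral) (auto simp: orthonormal_def)
    finally show ?thesis using False by simp
  qed
  have "p a * k\<^sup>2 = p a * (cmod (inner_on G (V a) f))\<^sup>2" by (simp add: Vf)
  also have "\<dots> \<le> (\<Sum>a\<in>G. p a * (cmod (inner_on G (V a) f))\<^sup>2)"
    using a p fin by (intro member_le_sum[of a G "\<lambda>a. p a * (cmod (inner_on G (V a) f))\<^sup>2"]) auto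
  also have "\<dots> \<le> (\<Sum>b\<in>G. q b * (cmod (inner_on G (W b) f))\<^sup>2)" by (rule dom)
  also have "\<dots> = (\<Sum>b\<in>G'. q b * (cmod (inner_on G (W b) f))\<^sup>2)"
    using fin G' Wf by (intro sum.mono_neutral_right) auto
  also have "\<dots> = k"
    unfolding k_def using Wf G'
    by (intro sum.cong refl) (auto simp: G'_def c_def norm_divide power_divide power2_eq_square)
  finally have pk2: "p a * k\<^sup>2 \<le> k" .
  have pk: "p a * k \<le> 1"
  proof (cases "k = 0")
    case False
    then have "k > 0" using k0 by simp
    have "(p a * k) * k \<le> 1 * k" using pk2 by (simp add: power2_eq_square mult.assoc)
    then show ?thesis using \<open>k > 0\<close> by (simp only: mult_le_cancel_right)
  qed simp
  have "(\<Sum>b\<in>G. if q b > 0 then p a * (p a * (c b / q b)) else 0) = p a * (p a * k)"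
    unfolding k_def G'_def sum_distrib_left using fin by (rule sum.inter_filter[symmetric])
  also have "\<dots> \<le> p a * 1" using pk p[OF a] by (intro mult_left_mono)
  finally show ?thesis unfolding c_def by (simp only: mult_1_right)
qed

text \<open>\<open>s\<close> minimises
  \<open>- 2 * (L + 1) * t * s + s\<^sup>2 * (L + 1)\<^sup>2 / 2\<close>, with minimum
  \<open>- 2 * t\<^sup>2\<close>, and \<open>n\<close> times this is \<open>- 2 * k\<close>. The
  hypothesis on \<open>h\<close> turns the surplus \<open>(n - 1) * h\<close> into a deviation of
  \<open>(2 * L + 3) * t\<close> for each further block. The last \<open>t\<close> of each block is
  spent on the additive 2, since \<open>n * t \<ge> 2\<close> follows from
  \<open>n * t\<^sup>2 = k \<ge> 1\<close> and \<open>t \<le> 1 / 2\<close>.\<close>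

lemma aep_exponent_le:
  fixes L t h k :: real and n :: nat
  assumes L: "L \<ge> 1" and t: "0 < t" "t \<le> 1 / 2" and k: "real n * t\<^sup>2 = k" "k \<ge> 1" and n: "n \<ge> 1"
    and h: "(2 * L + 3) * t \<le> h"
  defines "s \<equiv> 2 * t / (L + 1)"
  shows "s * (h - (2 * L + 3) * t + 2) + real n * (- s * h + s\<^sup>2 * ((L + 1)\<^sup>2 / 2)) \<le> - 2 * k"
proof -
  have s0: "s \<ge> 0" using t L by (simp add: s_def)
  have "k = (real n * t) * t" using k by (simp add: power2_eq_square)
  also have "\<dots> \<le> (real n * t) * (1 / 2)" using t by (intro mult_left_mono) auto
  finally have "2 \<le> real n * t" using k by simp
  moreover have "(real n - 1) * ((2 * L + 3) * t) \<le> (real n - 1) * h"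
    using h n by (intro mult_left_mono) auto
  ultimately have "h - (2 * L + 3) * t + 2 - real n * h \<le> - (2 * (L + 1)) * (real n * t)"
    by (simp add: algebra_simps)
  then have "s * (h - (2 * L + 3) * t + 2 - real n * h) \<le> s * (- (2 * (L + 1)) * (real n * t))"
    using s0 by (intro mult_left_mono)
  also have "s * (- (2 * (L + 1)) * (real n * t)) = - (s * (L + 1)) * 2 * (real n * t)" by algebra
  also have "\<dots> = - 4 * (real n * t\<^sup>2)" using L by (simp add: s_def power2_eq_square)
  finally have 1: "s * (h - (2 * L + 3) * t + 2 - real n * h) \<le> - 4 * k" by (simp only: k)
  have "s\<^sup>2 * ((L + 1)\<^sup>2 / 2) = 2 * t\<^sup>2"
    using L by (simp add: s_def power_divide power_mult_distrib)
  then have 2: "real n * (s\<^sup>2 * ((L + 1)\<^sup>2 / 2)) = 2 * k" using k by simp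
  have "s * (h - (2 * L + 3) * t + 2) + real n * (- s * h + s\<^sup>2 * ((L + 1)\<^sup>2 / 2))
    = s * (h - (2 * L + 3) * t + 2 - real n * h) + real n * (s\<^sup>2 * ((L + 1)\<^sup>2 / 2))" by algebra
  then show ?thesis using 1 2 by linarith
qed

text \<open>The Nussbaum--Szkola weights \<open>p x a * c x a b\<close> reduce the asymptotic equipartition
  property for a pair of non-commuting operators to a classical large-deviation estimate.\<close>
theorem smooth_hmin_aep:
  fixes p :: "'x \<Rightarrow> 'g \<Rightarrow> real" and q :: "'g \<Rightarrow> real"
  assumes fin: "finite X" "finite K" "finite E" "finite G"
    and iso: "isometry G (K \<times> E) T"
    and onV: "\<And>x. x \<in> X \<Longrightarrow> orthonormal G G (V x)" and onW: "orthonormal G G W"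
    and p: "\<And>x a. x \<in> X \<Longrightarrow> a \<in> G \<Longrightarrow> p x a \<ge> 0" "(\<Sum>x\<in>X. \<Sum>a\<in>G. p x a) = 1"
    and q: "\<And>b. b \<in> G \<Longrightarrow> q b \<ge> 0" "(\<Sum>b\<in>G. q b) = 1"
    and dom: "\<And>x f. x \<in> X \<Longrightarrow> (\<Sum>a\<in>G. p x a * (cmod (inner_on G (V x a) f))\<^sup>2)
        \<le> (\<Sum>b\<in>G. q b * (cmod (inner_on G (W b) f))\<^sup>2)"
    and mean: "h \<le> (\<Sum>x\<in>X. \<Sum>a\<in>G. \<Sum>b\<in>G. p x a * (cmod (inner_on G (W b) (V x a)))\<^sup>2
        * (log 2 (q b) - log 2 (p x a)))"
    and \<rho>: "op_eq (lists_len n X \<times> lists_len n E) \<rho>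
        (pushed_state (lists_len n X) (lists_len n K) (lists_len n G) (tensor_iso n T)
          (\<lambda>xs as. \<Prod>i<n. p (xs ! i) (as ! i)) (\<lambda>xs. tensor_vec n (\<lambda>i. V (xs ! i))))"
    and \<epsilon>: "0 < \<epsilon>" "\<epsilon> < 1" and n: "n \<ge> 1"
  shows "smooth_hmin \<epsilon> (lists_len n X) (lists_len n E) \<rho>
    \<ge> ereal (h - (2 * log 2 (card X) + 3) * sqrt ((log 2 (1 / \<epsilon>) + 1) / n))"
proof -
  define c where "c = (\<lambda>x a b. (cmod (inner_on G (W b) (V x a)))\<^sup>2)"
  define m where "m = (\<lambda>(x, a, b). p x a * c x a b)"
  define w where "w = (\<lambda>(x, a, b). ln (q b) - ln (p x a))"
  define l where "l = ln (real (card X))"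
  let ?I = "X \<times> G \<times> G"
  have sum3: "(\<Sum>i\<in>?I. f i) = (\<Sum>x\<in>X. \<Sum>a\<in>G. \<Sum>b\<in>G. f (x, a, b))" for f :: "_ \<Rightarrow> real"
    by (simp add: sum.cartesian_product')
  have c0: "c x a b \<ge> 0" for x a b by (simp add: c_def)
  have X0: "X \<noteq> {}" using p(2) by auto
  have cX: "card X \<ge> 1" using X0 fin(1) by (simp add: card_gt_0_iff Suc_leI)
  have nW: "nsq G (W b) = 1" if "b \<in> G" for b by (rule orthonormal_nsq[OF onW that])
  have nV: "nsq G (V x a) = 1" if "x \<in> X" "a \<in> G" for x a by (rule orthonormal_nsq[OF onV[OF that(1)] that(2)])
  have sum_b: "(\<Sum>b\<in>G. c x a b) = 1" if "x \<in> X" "a \<in> G" for x a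
    unfolding c_def parseval[OF onW fin(4,4) refl] by (rule nV[OF that])
  have sum_a: "(\<Sum>a\<in>G. c x a b) = 1" if "x \<in> X" "b \<in> G" for x b
    using parseval[OF onV[OF that(1)] fin(4,4) refl, of "W b"] nW[OF that(2)]
    by (simp add: c_def cmod_inner_on_commute[of G "W b"])
  \<comment> \<open>This is \<open>dom\<close> tested on the eigenvector \<open>W b\<close>. It
    gives \<open>q b > 0\<close> wherever the weight \<open>m\<close> is positive, so no logarithm
    of 0 carries weight.\<close>
  have pc_le: "p x a * c x a b \<le> q b" if "x \<in> X" "a \<in> G" "b \<in> G" for x a b
  proof -
    have "p x a * c x a b \<le> (\<Sum>a\<in>G. p x a * (cmod (inner_on G (V x a) (W b)))\<^sup>2)"
      unfolding c_def cmod_inner_on_commute[of G "W b"]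
      using that p fin by (intro member_le_sum[of a G "\<lambda>a. p x a * (cmod (inner_on G (V x a) (W b)))\<^sup>2"]) auto
    also have "\<dots> \<le> (\<Sum>b'\<in>G. q b' * (cmod (inner_on G (W b') (W b)))\<^sup>2)" by (rule dom[OF that(1)])
    also have "\<dots> = (\<Sum>b'\<in>G. if b' = b then q b else 0)"
      using onW that by (intro sum.cong) (auto simp: orthonormal_def)
    also have "\<dots> = q b" using fin that by simp
    finally show ?thesis .
  qed
  have m0: "m i \<ge> 0" if "i \<in> ?I" for i using that p c0 by (auto simp: m_def)
  have pos: "p x a > 0" "q b > 0" if "x \<in> X" "a \<in> G" "b \<in> G" "m (x, a, b) \<noteq> 0" for x a b
  proof -
    show "p x a > 0" using that p(1)[of x a] by (auto simp: m_def order_less_le)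
    have "m (x, a, b) > 0" using that m0[of "(x, a, b)"] by auto
    then show "q b > 0" using pc_le[OF that(1-3)] by (simp add: m_def)
  qed
  have m1: "sum m ?I = 1"
    unfolding sum3 using sum_b p(2) by (simp add: m_def flip: sum_distrib_left)
  \<comment> \<open>Where \<open>m\<close> is nonzero, \<open>m * exp w\<close> is
    \<open>c x a b * q b\<close>; for each \<open>x\<close> the overlaps sum to 1 over
    \<open>a\<close>, which leaves \<open>card X\<close>.\<close>
  have up: "(\<Sum>i\<in>?I. m i * exp (w i)) \<le> exp l"
  proof -
    have "(\<Sum>i\<in>?I. m i * exp (w i)) \<le> (\<Sum>x\<in>X. \<Sum>a\<in>G. \<Sum>b\<in>G. c x a b * q b)"
      unfolding sum3
    proof (intro sum_mono)
      fix x a b assume mem: "x \<in> X" "a \<in> G" "b \<in> G"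
      show "m (x, a, b) * exp (w (x, a, b)) \<le> c x a b * q b"
      proof (cases "m (x, a, b) = 0")
        case False
        then show ?thesis using pos[OF mem] by (simp add: m_def w_def exp_diff)
      qed (use mem q c0 in auto)
    qed
    also have "\<dots> = (\<Sum>x\<in>X. \<Sum>b\<in>G. q b * (\<Sum>a\<in>G. c x a b))"
      unfolding sum_distrib_left by (subst (2) sum.swap) (simp add: mult.commute)
    also have "\<dots> = real (card X)" using sum_a q by simp
    also have "\<dots> = exp l" using cX by (simp add: l_def)
    finally show ?thesis .
  qed
  have dn: "(\<Sum>i\<in>?I. m i * exp (- w i)) \<le> 1"
  proof -
    have "(\<Sum>i\<in>?I. m i * exp (- w i)) \<le> (\<Sum>x\<in>X. \<Sum>a\<in>G. p x a)"
      unfolding sum3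
    proof (intro sum_mono)
      fix x a assume mem: "x \<in> X" "a \<in> G"
      have "(\<Sum>b\<in>G. m (x, a, b) * exp (- w (x, a, b)))
          \<le> (\<Sum>b\<in>G. if q b > 0 then p x a * (p x a * (c x a b / q b)) else 0)"
      proof (rule sum_mono)
        fix b assume b: "b \<in> G"
        show "m (x, a, b) * exp (- w (x, a, b)) \<le> (if q b > 0 then p x a * (p x a * (c x a b / q b)) else 0)"
        proof (cases "m (x, a, b) = 0")
          case False
          have "exp (- w (x, a, b)) = p x a / q b"
            using pos[OF mem b False] by (simp add: w_def exp_diff)
          then show ?thesis using pos[OF mem b False] by (simp add: m_def mult_ac)
        next
          case True
          then show ?thesis using p(1)[OF mem] c0 by simp
        qed
      qed
      also have "\<dots> \<le> p x a"
        unfolding c_def by (rule truncated_collision_le[OF fin(4) onW p(1)[OF mem(1)] mem(2) dom[OF mem(1)]])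
      finally show "(\<Sum>b\<in>G. m (x, a, b) * exp (- w (x, a, b))) \<le> p x a" .
    qed
    then show ?thesis using p(2) by simp
  qed
  have mean': "h * ln 2 \<le> (\<Sum>i\<in>?I. m i * w i)"
  proof -
    have "h * ln 2 \<le> (\<Sum>x\<in>X. \<Sum>a\<in>G. \<Sum>b\<in>G. p x a * c x a b * (log 2 (q b) - log 2 (p x a))) * ln 2"
      using mean by (intro mult_right_mono) (auto simp: c_def)
    also have "\<dots> = (\<Sum>i\<in>?I. m i * w i)"
      unfolding sum3 sum_distrib_right
      by (intro sum.cong refl) (simp add: m_def w_def log_def diff_divide_distrib[symmetric])
    finally show ?thesis .
  qed
  \<comment> \<open>Jensen's inequality, by the tangent of \<open>exp\<close> at 0 applied to
    \<open>w i - l\<close>. Later it forces \<open>card X \<ge> 2\<close> and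
    \<open>t \<le> 1 / 2\<close>.\<close>
  have hL: "h * ln 2 \<le> l"
  proof -
    have "(\<Sum>i\<in>?I. m i * w i) \<le> (\<Sum>i\<in>?I. m i * (l - 1) + exp (- l) * (m i * exp (w i)))"
    proof (rule sum_mono)
      fix i assume i: "i \<in> ?I"
      have "1 + (w i - l) \<le> exp (w i - l)" by (rule exp_ge_add_one_self)
      then have "m i * w i \<le> m i * (l - 1 + exp (w i - l))"
        using m0[OF i] by (intro mult_left_mono) linarith
      then show "m i * w i \<le> m i * (l - 1) + exp (- l) * (m i * exp (w i))"
        by (simp add: exp_diff exp_minus field_simps)
    qed
    also have "\<dots> = (l - 1) + exp (- l) * (\<Sum>i\<in>?I. m i * exp (w i))"
      using m1 by (simp add: sum.distrib flip: sum_distrib_left sum_distrib_right)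
    also have "\<dots> \<le> (l - 1) + exp (- l) * exp l" using up by simp
    finally show ?thesis using mean' by (simp flip: exp_add)
  qed
  define L where "L = log 2 (real (card X))"
  define t where "t = sqrt ((log 2 (1 / \<epsilon>) + 1) / n)"
  let ?G = "lists_len n G" and ?X = "lists_len n X" and ?K = "lists_len n K" and ?E = "lists_len n E"
  let ?P = "\<lambda>xs as. \<Prod>i<n. p (xs ! i) (as ! i)" and ?V = "\<lambda>xs. tensor_vec n (\<lambda>i. V (xs ! i))"
  have finL: "finite ?X" "finite ?K" "finite ?E" "finite ?G" using fin by (auto intro: finite_lists_len)
  have isoL: "isometry ?G (?K \<times> ?E) (tensor_iso n T)" by (rule isometry_tensor_iso[OF iso])
  have onVL: "orthonormal ?G ?G (?V xs)" if "xs \<in> ?X" for xs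
    using that by (intro orthonormal_tensor_vec onV) (rule lists_len_nth)
  have PL: "?P xs as \<ge> 0" if "xs \<in> ?X" "as \<in> ?G" for xs as
    using that by (intro prod_nonneg) (auto intro!: p lists_len_nth)
  have PL1: "(\<Sum>xs\<in>?X. \<Sum>as\<in>?G. ?P xs as) = 1"
  proof -
    have "(\<Sum>xs\<in>?X. \<Sum>as\<in>?G. ?P xs as) = (\<Sum>xs\<in>?X. \<Prod>i<n. \<Sum>a\<in>G. p (xs ! i) a)"
      by (intro sum.cong refl sum_prod_lists)
    also have "\<dots> = (\<Prod>i<n. \<Sum>x\<in>X. \<Sum>a\<in>G. p x a)" by (rule sum_prod_lists)
    finally show ?thesis by (simp add: p(2))
  qed
  have "smooth_hmin \<epsilon> ?X ?E \<rho> \<ge> ereal (h - (2 * L + 3) * t)"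
  \<comment> \<open>The claim contains \<open>h\<close> once for all \<open>n\<close> blocks. A
    nonpositive right side is covered by nonnegativity of the entropy; otherwise the remaining
    \<open>n - 1\<close> copies of \<open>h\<close> absorb the fluctuations.\<close>
  proof (cases "h \<le> (2 * L + 3) * t")
    case True
    then have "ereal (h - (2 * L + 3) * t) \<le> 0" by simp
    also have "0 \<le> smooth_hmin \<epsilon> ?X ?E \<rho>"
      by (rule smooth_hmin_nonneg[OF finL isoL onVL PL PL1 \<rho> \<epsilon>(1)])
    finally show ?thesis .
  next
    case False
    define R where "R = h - (2 * L + 3) * t"
    \<comment> \<open>Chosen so that the one-shot value \<open>- log 2 (2 * \<theta>)\<close> is
      \<open>R\<close>.\<close>
    define \<theta> where "\<theta> = 2 powr (- R - 1)"
    define k where "k = log 2 (1 / \<epsilon>) + 1"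
    have k1: "k \<ge> 1" using \<epsilon> by (simp add: k_def)
    have nt: "real n * t\<^sup>2 = k" using n k1 by (simp add: t_def k_def)
    have t0: "t > 0" using n k1 by (simp add: t_def k_def[symmetric])
    have lL: "l = L * ln 2" by (simp add: l_def L_def log_def)
    have hL': "h \<le> L" using hL unfolding lL by simp
    have L0: "L \<ge> 0" using cX by (simp add: L_def)
    \<comment> \<open>\<open>L = 0\<close> would give \<open>h \<le> 0\<close>, contrary to the
      case; so \<open>card X \<ge> 2\<close>, and \<open>l \<ge> ln 2\<close> as the moment bound
      requires.\<close>
    have "L \<noteq> 0" using False hL' t0 by auto
    then have "card X \<noteq> 1" by (auto simp: L_def)
    then have card2: "card X \<ge> 2" using cX by simp
    then have L1: "L \<ge> 1" by (simp add: L_def le_log_iff)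
    have t12: "t \<le> 1 / 2"
    proof (rule ccontr)
      assume "\<not> t \<le> 1 / 2"
      then have "(2 * L + 3) * t \<ge> (2 * L + 3) * (1 / 2)" using L0 by (intro mult_left_mono) auto
      then show False using False hL' by simp
    qed
    define s where "s = 2 * t / (L + 1)"
    have s0: "s \<ge> 0" using t0 L0 by (simp add: s_def)
    have s12: "s \<le> 1 / 2" using t12 L1 t0 by (simp add: s_def divide_le_eq)
    have "smooth_hmin \<epsilon> ?X ?E \<rho> \<ge> ereal (- log 2 (2 * \<theta>))"
    proof (rule smooth_hmin_one_shot[OF finL isoL onVL _ PL PL1 _ _ \<rho> \<epsilon>(1)])
      show "orthonormal ?G ?G (tensor_vec n (\<lambda>i. W))" by (intro orthonormal_tensor_vec onW)
      show "(\<Prod>i<n. q (bs ! i)) \<ge> 0" if "bs \<in> ?G" for bs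
        using that by (intro prod_nonneg) (auto intro!: q lists_len_nth)
      show "(\<Sum>bs\<in>?G. \<Prod>i<n. q (bs ! i)) = 1" by (simp add: sum_prod_lists[where n = n and f = "\<lambda>i. q"] q(2))
      show "\<theta> > 0" by (simp add: \<theta>_def)
      have inner: "(cmod (inner_on ?G (tensor_vec n (\<lambda>i. W) bs) (?V xs as)))\<^sup>2
          = (\<Prod>i<n. c (xs ! i) (as ! i) (bs ! i))" for xs as bs
        by (simp add: inner_on_tensor_vec c_def prod_norm[symmetric] prod_power_distrib)
      have "(\<Sum>xs\<in>?X. \<Sum>as\<in>?G. \<Sum>bs\<in>?G.
            if \<theta> * (\<Prod>i<n. q (bs ! i)) < 2 * ?P xs as
            then ?P xs as * (cmod (inner_on ?G (tensor_vec n (\<lambda>i. W) bs) (?V xs as)))\<^sup>2 else 0)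
          \<le> (2 / \<theta>) powr s * (\<Sum>x\<in>X. \<Sum>a\<in>G. \<Sum>b\<in>G. p x a * c x a b * (p x a / q b) powr s) ^ n"
        unfolding inner
      proof (rule product_tail_le)
        show "q b > 0" if "x \<in> X" "a \<in> G" "b \<in> G" "p x a > 0" "c x a b > 0" for x a b
          using pc_le[OF that(1-3)] mult_pos_pos[OF that(4,5)] by linarith
      qed (use p q c0 s0 in \<open>auto simp: \<theta>_def\<close>)
      also have "(\<Sum>x\<in>X. \<Sum>a\<in>G. \<Sum>b\<in>G. p x a * c x a b * (p x a / q b) powr s) = (\<Sum>i\<in>?I. m i * exp (- s * w i))"
        unfolding sum3
      proof (intro sum.cong refl)
        fix x a b assume mem: "x \<in> X" "a \<in> G" "b \<in> G"
        show "p x a * c x a b * (p x a / q b) powr s = m (x, a, b) * exp (- s * w (x, a, b))"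
        proof (cases "m (x, a, b) = 0")
          case False
          then show ?thesis using pos[OF mem False]
            by (simp add: m_def w_def powr_def ln_div algebra_simps)
        qed (simp add: m_def)
      qed
      also have "(2 / \<theta>) powr s * (\<Sum>i\<in>?I. m i * exp (- s * w i)) ^ n
          \<le> (2 / \<theta>) powr s * (exp (- s * (h * ln 2) + s\<^sup>2 * ((l + ln 2)\<^sup>2 / (2 * ln 2)))) ^ n"
      proof (intro mult_left_mono power_mono)
        show "(\<Sum>i\<in>?I. m i * exp (- s * w i)) \<le> exp (- s * (h * ln 2) + s\<^sup>2 * ((l + ln 2)\<^sup>2 / (2 * ln 2)))"
        proof (rule exp_moment_le[OF _ m0 m1 up dn mean' _ s0 s12])
          show "ln 2 \<le> l" using L1 unfolding lL by simp
        qed (use fin in auto)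
      qed (auto intro!: sum_nonneg mult_nonneg_nonneg m0)
      also have "\<dots> = 2 powr (s * (R + 2) + real n * (- s * h + s\<^sup>2 * ((L + 1)\<^sup>2 / 2)))"
      proof -
        have "- s * (h * ln 2) + s\<^sup>2 * ((l + ln 2)\<^sup>2 / (2 * ln 2)) = (- s * h + s\<^sup>2 * ((L + 1)\<^sup>2 / 2)) * ln 2"
          unfolding lL by (simp add: field_simps power2_eq_square)
        then have "exp (- s * (h * ln 2) + s\<^sup>2 * ((l + ln 2)\<^sup>2 / (2 * ln 2))) = 2 powr (- s * h + s\<^sup>2 * ((L + 1)\<^sup>2 / 2))"
          by (simp add: powr_def)
        then have 1: "exp (- s * (h * ln 2) + s\<^sup>2 * ((l + ln 2)\<^sup>2 / (2 * ln 2))) ^ n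
            = 2 powr (real n * (- s * h + s\<^sup>2 * ((L + 1)\<^sup>2 / 2)))"
          by (simp add: powr_power mult.commute)
        have "2 / \<theta> = 2 powr (R + 2)"
          by (simp add: \<theta>_def powr_add powr_diff powr_minus field_simps)
        then have 2: "(2 / \<theta>) powr s = 2 powr (s * (R + 2))" by (simp add: powr_powr mult.commute)
        show ?thesis unfolding 1 2 by (simp add: powr_add)
      qed
      also have "\<dots> \<le> 2 powr (- 2 * k)"
        unfolding R_def s_def
        using aep_exponent_le[OF L1 t0 t12 nt k1 n, of h] False by (intro powr_mono) auto
      \<comment> \<open>The \<open>+ 1\<close> in \<open>k\<close> supplies the factor
        \<open>1 / 4\<close>.\<close>
      also have "\<dots> = \<epsilon>\<^sup>2 / 4"
      proof -
        have a1: "2 powr (- k) = \<epsilon> / 2" using \<epsilon> by (simp add: k_def log_divide powr_diff)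
        have a2: "2 powr (- 2 * k) = (2 powr (- k))\<^sup>2" by (simp add: powr_power)
        show ?thesis unfolding a2 a1 by (simp add: power_divide)
      qed
      finally show "(\<Sum>xs\<in>?X. \<Sum>as\<in>?G. \<Sum>bs\<in>?G.
            if \<theta> * (\<Prod>i<n. q (bs ! i)) < 2 * ?P xs as
            then ?P xs as * (cmod (inner_on ?G (tensor_vec n (\<lambda>i. W) bs) (?V xs as)))\<^sup>2 else 0) \<le> \<epsilon>\<^sup>2 / 4" .
    qed
    moreover have "- log 2 (2 * \<theta>) = R"
    proof -
      have "2 * \<theta> = 2 powr (- R)" by (simp add: \<theta>_def powr_diff)
      then show ?thesis by simp
    qed
    ultimately show ?thesis by (simp add: R_def)
  qed
  then show ?thesis by (simp only: L_def t_def)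
qed

subsection \<open>Entropies and channels\<close>

text \<open>In applications \<open>k b c\<close> is the squared overlap of two eigenbases, hence
  doubly stochastic. Summing \<open>ln y \<le> y - 1\<close> at \<open>y = r c / q b\<close> with
  the weights \<open>q b * k b c\<close> proves Klein's inequality without assuming that the
  operators commute.\<close>

lemma klein_inequality:
  fixes q :: "'b \<Rightarrow> real" and r :: "'c \<Rightarrow> real" and k :: "'b \<Rightarrow> 'c \<Rightarrow> real"
  assumes q: "\<And>b. b \<in> B \<Longrightarrow> q b \<ge> 0" and r: "\<And>c. c \<in> C \<Longrightarrow> r c \<ge> 0"
    and k: "\<And>b c. b \<in> B \<Longrightarrow> c \<in> C \<Longrightarrow> k b c \<ge> 0"
    and rows: "\<And>b. b \<in> B \<Longrightarrow> (\<Sum>c\<in>C. k b c) = 1" and cols: "\<And>c. c \<in> C \<Longrightarrow> (\<Sum>b\<in>B. k b c) = 1"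
    and le: "sum r C \<le> sum q B"
    and supp: "\<And>b c. b \<in> B \<Longrightarrow> c \<in> C \<Longrightarrow> q b * k b c > 0 \<Longrightarrow> r c > 0"
  shows "(\<Sum>c\<in>C. (\<Sum>b\<in>B. q b * k b c) * log 2 (r c)) \<le> (\<Sum>b\<in>B. q b * log 2 (q b))"
proof -
  have "(\<Sum>b\<in>B. \<Sum>c\<in>C. q b * k b c * (ln (r c) - ln (q b))) \<le> (\<Sum>b\<in>B. \<Sum>c\<in>C. k b c * r c - q b * k b c)"
  proof (intro sum_mono)
    fix b c assume b: "b \<in> B" and c: "c \<in> C"
    show "q b * k b c * (ln (r c) - ln (q b)) \<le> k b c * r c - q b * k b c"
    proof (cases "q b * k b c > 0")
      case True
      then have pos: "q b > 0" "k b c > 0" "r c > 0"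
        using q[OF b] k[OF b c] supp[OF b c] by (auto simp: zero_less_mult_iff)
      have "ln (r c) - ln (q b) = ln (r c / q b)" using pos by (simp add: ln_div)
      also have "\<dots> \<le> r c / q b - 1" using pos by (intro ln_le_minus_one) simp
      finally have "q b * k b c * (ln (r c) - ln (q b)) \<le> q b * k b c * (r c / q b - 1)"
        using True by (intro mult_left_mono) auto
      also have "\<dots> = k b c * r c - q b * k b c" using pos by (simp add: field_simps)
      finally show ?thesis .
    next
      case False
      then have z: "q b * k b c = 0" using mult_nonneg_nonneg[OF q[OF b] k[OF b c]] by linarith
      show ?thesis unfolding z using k[OF b c] r[OF c] by simp
    qed
  qed
  also have "\<dots> = (\<Sum>c\<in>C. r c * (\<Sum>b\<in>B. k b c)) - (\<Sum>b\<in>B. q b * (\<Sum>c\<in>C. k b c))"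
    unfolding sum_subtractf sum_distrib_left by (subst (1) sum.swap) (simp add: mult.commute)
  also have "\<dots> \<le> 0" using rows cols le by simp
  finally have "(\<Sum>b\<in>B. \<Sum>c\<in>C. q b * k b c * ln (r c)) \<le> (\<Sum>b\<in>B. \<Sum>c\<in>C. q b * k b c * ln (q b))"
    by (simp add: right_diff_distrib sum_subtractf)
  moreover have "(\<Sum>b\<in>B. \<Sum>c\<in>C. q b * k b c * ln (q b)) = (\<Sum>b\<in>B. q b * ln (q b))"
  proof (rule sum.cong[OF refl])
    fix b assume "b \<in> B"
    have "(\<Sum>c\<in>C. q b * k b c * ln (q b)) = (q b * ln (q b)) * (\<Sum>c\<in>C. k b c)"
      unfolding sum_distrib_left by (simp add: mult_ac)
    then show "(\<Sum>c\<in>C. q b * k b c * ln (q b)) = q b * ln (q b)" using rows[OF \<open>b \<in> B\<close>] by simp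
  qed
  moreover have "(\<Sum>b\<in>B. \<Sum>c\<in>C. q b * k b c * ln (r c)) = (\<Sum>c\<in>C. (\<Sum>b\<in>B. q b * k b c) * ln (r c))"
    unfolding sum_distrib_right by (rule sum.swap)
  ultimately have "(\<Sum>c\<in>C. (\<Sum>b\<in>B. q b * k b c) * ln (r c)) \<le> (\<Sum>b\<in>B. q b * ln (q b))" by simp
  then have "(\<Sum>c\<in>C. (\<Sum>b\<in>B. q b * k b c) * ln (r c)) / ln 2 \<le> (\<Sum>b\<in>B. q b * ln (q b)) / ln 2"
    by (rule divide_right_mono) simp
  then show ?thesis by (simp add: log_def sum_divide_distrib)
qed

lemma sum_lists_marginal:
  fixes e g :: "nat \<Rightarrow> 'a \<Rightarrow> real"
  assumes "\<And>i. i < n \<Longrightarrow> (\<Sum>a\<in>A. e i a) = 1"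
  shows "(\<Sum>cs\<in>lists_len n A. (\<Prod>i<n. e i (cs ! i)) * (\<Sum>j<n. g j (cs ! j))) = (\<Sum>j<n. \<Sum>a\<in>A. e j a * g j a)"
proof -
  have "(\<Sum>cs\<in>lists_len n A. (\<Prod>i<n. e i (cs ! i)) * (\<Sum>j<n. g j (cs ! j)))
      = (\<Sum>j<n. \<Sum>cs\<in>lists_len n A. (\<Prod>i<n. e i (cs ! i)) * g j (cs ! j))"
    unfolding sum_distrib_left by (rule sum.swap)
  also have "\<dots> = (\<Sum>j<n. \<Sum>a\<in>A. e j a * g j a)"
  proof (rule sum.cong[OF refl])
    fix j assume "j \<in> {..<n}"
    then have j: "j < n" by simp
    have "(\<Sum>cs\<in>lists_len n A. (\<Prod>i<n. e i (cs ! i)) * g j (cs ! j))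
        = (\<Sum>cs\<in>lists_len n A. \<Prod>i<n. e i (cs ! i) * (if i = j then g i (cs ! i) else 1))"
      using j by (simp add: prod.distrib prod.delta)
    also have "\<dots> = (\<Prod>i<n. \<Sum>a\<in>A. e i a * (if i = j then g i a else 1))" by (rule sum_prod_lists)
    also have "\<dots> = (\<Prod>i<n. if i = j then \<Sum>a\<in>A. e j a * g j a else 1)"
      using assms by (intro prod.cong) auto
    also have "\<dots> = (\<Sum>a\<in>A. e j a * g j a)" using j by (simp add: prod.delta)
    finally show "(\<Sum>cs\<in>lists_len n A. (\<Prod>i<n. e i (cs ! i)) * g j (cs ! j)) = (\<Sum>a\<in>A. e j a * g j a)" .
  qed
  finally show ?thesis .
qed

text \<open>The logarithm of a product splits where all factors are positive, and
  \<open>supp\<close> makes the weight vanish elsewhere. What remains is the expectation of a sum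
  over independent positions.\<close>

lemma sum_lists_log_prod:
  fixes e r :: "nat \<Rightarrow> 'a \<Rightarrow> real"
  assumes e: "\<And>i. i < n \<Longrightarrow> (\<Sum>a\<in>A. e i a) = 1"
    and supp: "\<And>i a. i < n \<Longrightarrow> a \<in> A \<Longrightarrow> e i a \<noteq> 0 \<Longrightarrow> r i a > 0"
  shows "(\<Sum>cs\<in>lists_len n A. (\<Prod>i<n. e i (cs ! i)) * log 2 (\<Prod>i<n. r i (cs ! i)))
    = (\<Sum>j<n. \<Sum>a\<in>A. e j a * log 2 (r j a))"
proof -
  have "(\<Prod>i<n. e i (cs ! i)) * log 2 (\<Prod>i<n. r i (cs ! i))
      = (\<Prod>i<n. e i (cs ! i)) * (\<Sum>j<n. log 2 (r j (cs ! j)))" if cs: "cs \<in> lists_len n A" for cs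
  proof (cases "(\<Prod>i<n. e i (cs ! i)) = 0")
    case False
    then have "e i (cs ! i) \<noteq> 0" if "i < n" for i using that by (auto simp: prod_zero_iff)
    then have "r i (cs ! i) > 0" if "i < n" for i using that supp lists_len_nth[OF cs that] by blast
    then have "r i (cs ! i) \<noteq> 0" if "i \<in> {..<n}" for i using that by fastforce
    then have "ln (\<Prod>i<n. r i (cs ! i)) = (\<Sum>j<n. ln (r j (cs ! j)))" by (intro ln_prod) blast+
    then show ?thesis by (simp add: log_def sum_divide_distrib)
  qed simp
  then have "(\<Sum>cs\<in>lists_len n A. (\<Prod>i<n. e i (cs ! i)) * log 2 (\<Prod>i<n. r i (cs ! i)))
    = (\<Sum>cs\<in>lists_len n A. (\<Prod>i<n. e i (cs ! i)) * (\<Sum>j<n. log 2 (r j (cs ! j))))"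
    by (intro sum.cong) auto
  also have "\<dots> = (\<Sum>j<n. \<Sum>a\<in>A. e j a * log 2 (r j a))" by (rule sum_lists_marginal[OF e])
  finally show ?thesis .
qed

section \<open>Channels on product operators\<close>

lemma channel_sum:
  assumes "quantum_channel \<E>" "finite I"
  shows "\<E> (\<lambda>a b. \<Sum>i\<in>I. c i * A i a b) = (\<lambda>a b. \<Sum>i\<in>I. c i * \<E> (A i) a b)"
proof -
  have add: "\<E> (\<lambda>a b. A a b + B a b) = (\<lambda>a b. \<E> A a b + \<E> B a b)" for A B
    using assms(1) unfolding quantum_channel_def by blast
  have scale: "\<E> (\<lambda>a b. k * A a b) = (\<lambda>a b. k * \<E> A a b)" for k A
    using assms(1) unfolding quantum_channel_def by blast
  show ?thesis
    using assms(2)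
  proof (induction I rule: finite_induct)
    case empty
    show ?case using scale[of 0 "\<lambda>a b. 0"] by simp
  next
    case (insert x F)
    have "\<E> (\<lambda>a b. c x * A x a b + (\<Sum>i\<in>F. c i * A i a b))
        = (\<lambda>a b. c x * \<E> (A x) a b + (\<Sum>i\<in>F. c i * \<E> (A i) a b))"
      by (simp only: add scale insert.IH)
    then show ?case using insert.hyps by simp
  qed
qed

lemma channel_expand:
  assumes "quantum_channel \<E>"
  shows "\<E> A a b = (\<Sum>k\<in>UNIV. \<Sum>l\<in>UNIV. A k l * \<E> (ketbra (basis_vec k) (basis_vec l)) a b)"
proof -
  have A: "A = (\<lambda>a b. \<Sum>p\<in>UNIV. A (fst p) (snd p) * ketbra (basis_vec (fst p)) (basis_vec (snd p)) a b)"
  proof (intro ext)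
    fix a b
    have "(\<Sum>p\<in>UNIV. A (fst p) (snd p) * ketbra (basis_vec (fst p)) (basis_vec (snd p)) a b)
        = (\<Sum>p\<in>UNIV. if p = (a, b) then A a b else 0)"
      by (intro sum.cong) (auto simp: ketbra_def basis_vec_def)
    then show "A a b = (\<Sum>p\<in>UNIV. A (fst p) (snd p) * ketbra (basis_vec (fst p)) (basis_vec (snd p)) a b)"
      by simp
  qed
  have "\<E> A a b = (\<Sum>p\<in>UNIV. A (fst p) (snd p) * \<E> (ketbra (basis_vec (fst p)) (basis_vec (snd p))) a b)"
    by (subst A, subst channel_sum[OF assms]) simp_all
  then show ?thesis
    by (simp add: UNIV_Times_UNIV[symmetric] sum.cartesian_product' del: UNIV_Times_UNIV)
qed

text \<open>\<open>chan_pow\<close> is given on matrix units. Distributivity gathers the double sum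
  over lists into one double sum per position, and there \<open>channel_expand\<close> recognises
  the channel output.\<close>

lemma chan_pow_tensor_list:
  assumes "quantum_channel \<E>" "length As = m"
  shows "chan_pow m \<E> (tensor_list As) gs hs = (\<Prod>i<m. \<E> (As ! i) (gs ! i) (hs ! i))"
proof -
  let ?k = "\<lambda>i k l. (As ! i) k l * \<E> (ketbra (basis_vec k) (basis_vec l)) (gs ! i) (hs ! i)"
  have "chan_pow m \<E> (tensor_list As) gs hs
      = (\<Sum>ks\<in>lists_len m UNIV. \<Sum>ls\<in>lists_len m UNIV. \<Prod>i<m. ?k i (ks ! i) (ls ! i))"
    by (simp add: chan_pow_def tensor_list_def assms(2) prod.distrib)
  also have "\<dots> = (\<Sum>ks\<in>lists_len m UNIV. \<Prod>i<m. \<Sum>l\<in>UNIV. ?k i (ks ! i) l)"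
    by (intro sum.cong refl sum_prod_lists)
  also have "\<dots> = (\<Prod>i<m. \<Sum>k\<in>UNIV. \<Sum>l\<in>UNIV. ?k i k l)" by (rule sum_prod_lists)
  also have "\<dots> = (\<Prod>i<m. \<E> (As ! i) (gs ! i) (hs ! i))"
    by (intro prod.cong refl channel_expand[OF assms(1), symmetric])
  finally show ?thesis .
qed

lemma psd_proj: "psd S (proj v)"
proof -
  have "proj v = gram {()} (\<lambda>_. 1) (\<lambda>_. v)" by (simp add: proj_def ketbra_def gram_def)
  then show ?thesis using psd_gram[where I = "{()}" and c = "\<lambda>_. 1" and S = S and y = "\<lambda>_. v"] by simp
qed

text \<open>Complete positivity for an ancilla of dimension 1: \<open>?X\<close> is \<open>A\<close>
  with the trivial label 0 attached to each index.\<close>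

lemma channel_psd:
  assumes "quantum_channel \<E>" "psd UNIV A"
  shows "psd UNIV (\<E> A)"
proof -
  let ?S = "{..<1::nat} \<times> (UNIV :: 'a set)"
  let ?X = "\<lambda>(i::nat, a) (j::nat, b). A a b"
  have inner: "inner_on ?S v (op_apply ?S X v) = inner_on UNIV (\<lambda>b. v (0, b)) (op_apply UNIV B (\<lambda>b. v (0, b)))"
    if "\<And>a b. X (0, a) (0, b) = B a b" for X v and B :: "'a op"
    using that by (simp add: inner_on_op_apply sum.cartesian_product')
  have A: "A a b = cnj (A b a)" for a b using assms(2) unfolding psd_def by blast
  have "psd ?S ?X"
    unfolding psd_def
  proof (intro conjI ballI allI)
    fix p r assume "p \<in> ?S" "r \<in> ?S"
    then obtain a b where "p = (0, a)" "r = (0, b)" by auto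
    then show "?X p r = cnj (?X r p)" using A[of a b] by simp
  next
    fix v :: "nat \<times> 'a \<Rightarrow> complex"
    have *: "inner_on ?S v (op_apply ?S ?X v) = inner_on UNIV (\<lambda>b. v (0, b)) (op_apply UNIV A (\<lambda>b. v (0, b)))"
      by (rule inner) simp
    show "Im (inner_on ?S v (op_apply ?S ?X v)) = 0" "0 \<le> Re (inner_on ?S v (op_apply ?S ?X v))"
      unfolding * using assms(2) unfolding psd_def by blast+
  qed
  then have E: "psd ?S (id_tensor_chan 1 \<E> ?X)" using assms(1) unfolding quantum_channel_def by blast
  have entry: "id_tensor_chan 1 \<E> ?X (0, a) (0, b) = \<E> A a b" for a b by (simp add: id_tensor_chan_def)
  show ?thesis
    unfolding psd_def
  proof (intro conjI ballI allI)
    fix a b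
    have "(0, a) \<in> ?S" "(0, b) \<in> ?S" by simp_all
    then have "id_tensor_chan 1 \<E> ?X (0, a) (0, b) = cnj (id_tensor_chan 1 \<E> ?X (0, b) (0, a))"
      using E unfolding psd_def by blast
    then show "\<E> A a b = cnj (\<E> A b a)" by (simp only: entry)
  next
    fix v :: "'a \<Rightarrow> complex"
    have *: "inner_on ?S (\<lambda>p. v (snd p)) (op_apply ?S (id_tensor_chan 1 \<E> ?X) (\<lambda>p. v (snd p)))
        = inner_on UNIV v (op_apply UNIV (\<E> A) v)"
      using inner[where X = "id_tensor_chan 1 \<E> ?X" and B = "\<E> A" and v = "\<lambda>p. v (snd p)", OF entry] by simp
    show "Im (inner_on UNIV v (op_apply UNIV (\<E> A) v)) = 0"
      "Re (inner_on UNIV v (op_apply UNIV (\<E> A) v)) \<ge> 0"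
      unfolding *[symmetric] using E unfolding psd_def by blast+
  qed
qed

section \<open>Spectral form of traces and of the relative entropy\<close>

lemma op_trace_proj: "op_trace S (proj v) = of_real (nsq S v)"
  by (simp add: op_trace_def proj_def ketbra_def nsq_def complex_norm_square del: of_real_power)

lemma sum_eigenvalues:
  assumes "spec_decomp S A u l" "finite S"
  shows "op_trace S A = of_real (sum l S)"
proof -
  have on: "orthonormal S S u" using assms spec_decomp_iff by blast
  have "op_trace S A = op_trace S (gram S l u)"
    using assms(1) by (simp add: op_trace_def spec_decomp_def op_eq_def gram_def)
  also have "\<dots> = of_real (sum l S)" using orthonormal_nsq[OF on] by (simp add: op_trace_gram)
  finally show ?thesis .
qed

lemma spec_decomp_quadratic:
  assumes "spec_decomp S A u l"
  shows "inner_on S v (op_apply S A v) = of_real (\<Sum>b\<in>S. l b * (cmod (inner_on S (u b) v))\<^sup>2)"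
proof -
  have "op_eq S A (\<lambda>a a'. \<Sum>b\<in>S. of_real (l b) * u b a * cnj (u b a'))"
    using assms by (simp add: spec_decomp_def)
  from op_eq_apply[OF this] show ?thesis by (simp only: quadratic_form_spectral)
qed

lemma op_trace_mult_spectral:
  "op_trace S (op_mult S A (\<lambda>a a'. \<Sum>b\<in>S. of_real (f b) * u b a * cnj (u b a')))
    = (\<Sum>b\<in>S. of_real (f b) * inner_on S (u b) (op_apply S A (u b)))"
proof -
  have "op_trace S (op_mult S A (\<lambda>a a'. \<Sum>b\<in>S. of_real (f b) * u b a * cnj (u b a')))
      = (\<Sum>a\<in>S. \<Sum>c\<in>S. \<Sum>b\<in>S. of_real (f b) * (cnj (u b a) * A a c * u b c))"
    unfolding op_trace_def op_mult_def sum_distrib_left by (simp add: mult_ac)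
  also have "\<dots> = (\<Sum>a\<in>S. \<Sum>b\<in>S. \<Sum>c\<in>S. of_real (f b) * (cnj (u b a) * A a c * u b c))"
    by (intro sum.cong refl sum.swap)
  also have "\<dots> = (\<Sum>b\<in>S. \<Sum>a\<in>S. \<Sum>c\<in>S. of_real (f b) * (cnj (u b a) * A a c * u b c))"
    by (rule sum.swap)
  finally show ?thesis by (simp add: inner_on_op_apply sum_distrib_left)
qed

text \<open>The decomposition that \<open>mfun\<close> picks with \<open>SOME\<close> depends on
  \<open>A\<close> but not on \<open>f\<close>. Exposing this very choice makes the formula hold for
  all \<open>f\<close> at once, and the main argument works in the eigenbases chosen here.\<close>

lemma mfun_spectral:
  assumes "finite S" "hermitian_on S A"
  obtains u l where "spec_decomp S A u l"
    "\<And>f. mfun S f A = (\<lambda>a a'. \<Sum>b\<in>S. of_real (f (l b)) * u b a * cnj (u b a'))"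
proof -
  define ul where "ul = (SOME (u, l). spec_decomp S A u l)"
  obtain u l where ul: "ul = (u, l)" by fastforce
  obtain u' l' where "spec_decomp S A u' l'" using spec_decomp_exists[OF assms] .
  then have "case (u', l') of (u, l) \<Rightarrow> spec_decomp S A u l" by simp
  then have "case ul of (u, l) \<Rightarrow> spec_decomp S A u l" unfolding ul_def by (rule someI)
  then have "spec_decomp S A u l" by (simp add: ul)
  moreover have "mfun S f A = (\<lambda>a a'. \<Sum>b\<in>S. of_real (f (l b)) * u b a * cnj (u b a'))" for f
    unfolding mfun_def ul_def[symmetric] by (simp add: ul)
  ultimately show ?thesis using that by blast
qed

text \<open>The convention \<open>log 2 0 = 0\<close> makes \<open>log_supp\<close> redundant here.\<close>
lemma rel_entropy_spectral:
  assumes fin: "finite S" and psd: "psd S \<rho>" "psd S \<sigma>" and supp: "supp S \<rho> \<subseteq> supp S \<sigma>"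
  obtains u l v k where "spec_decomp S \<rho> u l" "spec_decomp S \<sigma> v k"
    "rel_entropy S \<rho> \<sigma> = ereal ((\<Sum>a\<in>S. l a * log 2 (l a))
       - (\<Sum>b\<in>S. (\<Sum>a\<in>S. l a * (cmod (inner_on S (u a) (v b)))\<^sup>2) * log 2 (k b)))"
proof -
  obtain u l where u: "spec_decomp S \<rho> u l"
    "\<And>f. mfun S f \<rho> = (\<lambda>a a'. \<Sum>b\<in>S. of_real (f (l b)) * u b a * cnj (u b a'))"
    using mfun_spectral[OF fin psd_hermitian[OF psd(1)]] by blast
  obtain v k where v: "spec_decomp S \<sigma> v k"
    "\<And>f. mfun S f \<sigma> = (\<lambda>a a'. \<Sum>b\<in>S. of_real (f (k b)) * v b a * cnj (v b a'))"
    using mfun_spectral[OF fin psd_hermitian[OF psd(2)]] by blast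
  have ls: "log_supp (l b) = log 2 (l b)" "log_supp (k b) = log 2 (k b)" if "b \<in> S" for b
    using psd_eigenvalue_nonneg[OF psd(1) u(1) fin that] psd_eigenvalue_nonneg[OF psd(2) v(1) fin that]
    by (auto simp: log_supp_def log_def)
  have "op_trace S (op_mult S \<rho> (\<lambda>a b. mfun S log_supp \<rho> a b - mfun S log_supp \<sigma> a b))
      = op_trace S (op_mult S \<rho> (mfun S log_supp \<rho>)) - op_trace S (op_mult S \<rho> (mfun S log_supp \<sigma>))"
    by (simp add: op_trace_def op_mult_def right_diff_distrib sum_subtractf)
  also have "op_trace S (op_mult S \<rho> (mfun S log_supp \<rho>)) = of_real (\<Sum>a\<in>S. l a * log 2 (l a))"
    unfolding u(2) op_trace_mult_spectral
    using ls by (simp add: spec_decomp_value[OF u(1) fin] mult.commute)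
  also have "op_trace S (op_mult S \<rho> (mfun S log_supp \<sigma>))
      = of_real (\<Sum>b\<in>S. (\<Sum>a\<in>S. l a * (cmod (inner_on S (u a) (v b)))\<^sup>2) * log 2 (k b))"
    unfolding v(2) op_trace_mult_spectral spec_decomp_quadratic[OF u(1)]
    using ls by (simp add: mult.commute del: of_real_power)
  finally show ?thesis using that[OF u(1) v(1)] supp by (simp add: rel_entropy_def del: of_real_power)
qed

text \<open>A kernel vector of \<open>\<sigma>\<close> is orthogonal to the range of \<open>\<sigma>\<close>, hence to that of \<open>\<rho>\<close>.\<close>
lemma supp_eigenvalue_pos:
  assumes fin: "finite S" and psd: "psd S \<sigma>" and supp: "supp S \<rho> \<subseteq> supp S \<sigma>"
    and v: "spec_decomp S \<sigma> v k" and b: "b \<in> S" and nz: "inner_on S (v b) (op_apply S \<rho> (v b)) \<noteq> 0"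
  shows "k b > 0"
proof (rule ccontr)
  assume "\<not> k b > 0"
  then have k0: "k b = 0" using psd_eigenvalue_nonneg[OF psd v fin b] by simp
  have "op_apply S \<rho> (v b) \<in> supp S \<sigma>" using supp by (auto simp: supp_def)
  then obtain w where w: "op_apply S \<rho> (v b) = op_apply S \<sigma> w" by (auto simp: supp_def)
  have "inner_on S (v b) (op_apply S \<sigma> w) = inner_on S (op_apply S \<sigma> (v b)) w"
    by (rule hermitian_inner_swap[OF psd_hermitian[OF psd]])
  also have "\<dots> = inner_on S (\<lambda>_. 0) w"
    using spec_decomp_eigen[OF v fin b] k0 by (intro inner_on_cong) auto
  also have "\<dots> = 0" by (simp add: inner_on_def)
  finally show False using nz w by simp
qed

text \<open>Comparing the average state with the product of its unperturbed factors costs the relative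
  entropy of a single factor, because the product states differ in one position only.\<close>
lemma pulse_position_mean:
  fixes u1 u0 :: "'a \<Rightarrow> 'a \<Rightarrow> complex" and l1 l0 :: "'a \<Rightarrow> real" and q :: "'a list \<Rightarrow> real"
  assumes fin: "finite S" and on: "orthonormal S S u1" "orthonormal S S u0" and m: "m \<ge> 1"
    and l1: "\<And>a. a \<in> S \<Longrightarrow> l1 a \<ge> 0" "sum l1 S = 1" and l0: "\<And>a. a \<in> S \<Longrightarrow> l0 a \<ge> 0" "sum l0 S = 1"
  defines "f1 \<equiv> \<lambda>b. \<Sum>a\<in>S. l1 a * (cmod (inner_on S (u1 a) (u0 b)))\<^sup>2"
  assumes supp: "\<And>b. b \<in> S \<Longrightarrow> f1 b \<noteq> 0 \<Longrightarrow> l0 b > 0"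
  defines "G \<equiv> lists_len m S"
    and "V \<equiv> \<lambda>x. tensor_vec m (\<lambda>i. if Suc i = x then u1 else u0)"
    and "p \<equiv> \<lambda>x as. (\<Prod>i<m. if Suc i = x then l1 (as ! i) else l0 (as ! i)) / real m"
  assumes onW: "orthonormal G G W" and q: "\<And>b. b \<in> G \<Longrightarrow> q b \<ge> 0" "sum q G = 1"
    and quad: "\<And>f. (\<Sum>b\<in>G. q b * (cmod (inner_on G (W b) f))\<^sup>2)
        = (\<Sum>x\<in>{1..m}. \<Sum>a\<in>G. p x a * (cmod (inner_on G (V x a) f))\<^sup>2)"
  shows "log 2 (real m) - ((\<Sum>a\<in>S. l1 a * log 2 (l1 a)) - (\<Sum>b\<in>S. f1 b * log 2 (l0 b)))
    \<le> (\<Sum>x\<in>{1..m}. \<Sum>a\<in>G. \<Sum>b\<in>G. p x a * (cmod (inner_on G (W b) (V x a)))\<^sup>2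
        * (log 2 (q b) - log 2 (p x a)))"
proof -
  let ?c = "\<lambda>x a b. (cmod (inner_on G (W b) (V x a)))\<^sup>2"
  \<comment> \<open>List indices start at 0 and pulse positions at 1, hence
    \<open>Suc i = x\<close>. \<open>e\<close> holds the eigenvalues of the local states,
    \<open>e'\<close> their diagonals in the basis \<open>u0\<close>.\<close>
  define e where "e = (\<lambda>x i a. if Suc i = x then l1 a else l0 a)"
  define e' where "e' = (\<lambda>x i b. if Suc i = x then f1 b else l0 b)"
  define \<pi> where "\<pi> = (\<lambda>x as. \<Prod>i<m. e x i (as ! i))"
  define r where "r = (\<lambda>c. \<Prod>i<m. l0 (c ! i))"
  define Z where "Z = tensor_vec m (\<lambda>i::nat. u0)"
  define D where "D = (\<Sum>a\<in>S. l1 a * log 2 (l1 a)) - (\<Sum>b\<in>S. f1 b * log 2 (l0 b))"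
  have p_pi: "p x as = \<pi> x as / real m" for x as unfolding p_def \<pi>_def e_def by (rule refl)
  have finG: "finite G" unfolding G_def by (rule finite_lists_len[OF fin])
  have onV: "orthonormal G G (V x)" for x
    unfolding G_def V_def using on by (intro orthonormal_tensor_vec) simp
  have onZ: "orthonormal G G Z" unfolding G_def Z_def using on by (intro orthonormal_tensor_vec)
  have e0: "e x i a \<ge> 0" if "a \<in> S" for x i a using that l1 l0 by (simp add: e_def)
  have e1: "(\<Sum>a\<in>S. e x i a) = 1" for x i by (cases "Suc i = x") (simp_all add: e_def l1 l0)
  have f1_nonneg: "f1 b \<ge> 0" for b unfolding f1_def using l1 by (intro sum_nonneg mult_nonneg_nonneg) auto
  have f1_sum: "(\<Sum>b\<in>S. f1 b) = 1"
  proof -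
    have "(\<Sum>b\<in>S. f1 b) = (\<Sum>a\<in>S. l1 a * (\<Sum>b\<in>S. (cmod (inner_on S (u1 a) (u0 b)))\<^sup>2))"
      unfolding f1_def sum_distrib_left by (rule sum.swap)
    also have "\<dots> = (\<Sum>a\<in>S. l1 a)"
      using parseval[OF on(2) fin fin refl] orthonormal_nsq[OF on(1)]
      by (intro sum.cong) (simp_all add: cmod_inner_on_commute[of S "u1 _"])
    finally show ?thesis using l1 by simp
  qed
  have e'1: "(\<Sum>b\<in>S. e' x i b) = 1" for x i by (cases "Suc i = x") (simp_all add: e'_def f1_sum l0)
  have pi0: "\<pi> x as \<ge> 0" if "as \<in> G" for x as
    unfolding \<pi>_def using that by (intro prod_nonneg) (auto intro!: e0 lists_len_nth simp: G_def)
  have pi1: "(\<Sum>as\<in>G. \<pi> x as) = 1" for x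
    unfolding \<pi>_def G_def by (simp only: sum_prod_lists[where f = "e x"] e1) simp
  \<comment> \<open>The blocks together put the weight \<open>q b\<close> on \<open>W b\<close>, by
    \<open>quad\<close> tested on \<open>W b\<close>; so this part is the negative entropy of
    \<open>q\<close>.\<close>
  have A: "(\<Sum>x\<in>{1..m}. \<Sum>a\<in>G. \<Sum>b\<in>G. p x a * ?c x a b * log 2 (q b)) = (\<Sum>b\<in>G. q b * log 2 (q b))"
  proof -
    have qb: "(\<Sum>x\<in>{1..m}. \<Sum>a\<in>G. p x a * ?c x a b) = q b" if b: "b \<in> G" for b
    proof -
      have "(\<Sum>x\<in>{1..m}. \<Sum>a\<in>G. p x a * ?c x a b) = (\<Sum>b'\<in>G. q b' * (cmod (inner_on G (W b') (W b)))\<^sup>2)"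
        unfolding quad cmod_inner_on_commute[of G "W b"] by (rule refl)
      also have "\<dots> = (\<Sum>b'\<in>G. if b' = b then q b else 0)"
        using onW b by (intro sum.cong) (auto simp: orthonormal_def)
      finally show ?thesis using b finG by simp
    qed
    have "(\<Sum>x\<in>{1..m}. \<Sum>a\<in>G. \<Sum>b\<in>G. p x a * ?c x a b * log 2 (q b))
        = (\<Sum>x\<in>{1..m}. \<Sum>b\<in>G. \<Sum>a\<in>G. p x a * ?c x a b * log 2 (q b))"
      by (intro sum.cong refl sum.swap)
    also have "\<dots> = (\<Sum>b\<in>G. \<Sum>x\<in>{1..m}. \<Sum>a\<in>G. p x a * ?c x a b * log 2 (q b))" by (rule sum.swap)
    also have "\<dots> = (\<Sum>b\<in>G. (\<Sum>x\<in>{1..m}. \<Sum>a\<in>G. p x a * ?c x a b) * log 2 (q b))"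
      by (simp only: sum_distrib_right)
    also have "\<dots> = (\<Sum>b\<in>G. q b * log 2 (q b))" by (intro sum.cong refl) (simp only: qb)
    finally show ?thesis .
  qed
  have B: "(\<Sum>x\<in>{1..m}. \<Sum>a\<in>G. \<Sum>b\<in>G. p x a * ?c x a b * log 2 (p x a))
      = (\<Sum>x\<in>{1..m}. (\<Sum>j<m. \<Sum>a\<in>S. e x j a * log 2 (e x j a)) / real m) - log 2 (real m)"
  proof -
    have row: "(\<Sum>b\<in>G. p x a * ?c x a b * log 2 (p x a)) = (\<pi> x a * log 2 (\<pi> x a) - \<pi> x a * log 2 (real m)) / real m"
      if a: "a \<in> G" for x a
    proof -
      have "(\<Sum>b\<in>G. p x a * ?c x a b * log 2 (p x a)) = p x a * log 2 (p x a) * (\<Sum>b\<in>G. ?c x a b)"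
        unfolding sum_distrib_left by (simp only: mult_ac)
      also have "(\<Sum>b\<in>G. ?c x a b) = 1"
        unfolding parseval[OF onW finG finG refl] by (rule orthonormal_nsq[OF onV a])
      finally have *: "(\<Sum>b\<in>G. p x a * ?c x a b * log 2 (p x a)) = p x a * log 2 (p x a)" by simp
      show ?thesis
      proof (cases "\<pi> x a = 0")
        case False
        then have "\<pi> x a > 0" using pi0[OF a, of x] by simp
        then have "log 2 (p x a) = log 2 (\<pi> x a) - log 2 (real m)"
          using m by (simp add: p_pi log_def ln_div diff_divide_distrib)
        then show ?thesis unfolding * by (simp add: p_pi right_diff_distrib diff_divide_distrib)
      qed (use * in \<open>simp add: p_pi\<close>)
    qed
    have ent: "(\<Sum>a\<in>G. \<pi> x a * log 2 (\<pi> x a)) = (\<Sum>j<m. \<Sum>a\<in>S. e x j a * log 2 (e x j a))" for x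
      unfolding \<pi>_def G_def
    proof (rule sum_lists_log_prod[OF e1])
      show "e x i a > 0" if "a \<in> S" "e x i a \<noteq> 0" for i a using e0[OF that(1), of x i] that(2) by simp
    qed
    have "(\<Sum>x\<in>{1..m}. \<Sum>a\<in>G. \<Sum>b\<in>G. p x a * ?c x a b * log 2 (p x a))
        = (\<Sum>x\<in>{1..m}. \<Sum>a\<in>G. (\<pi> x a * log 2 (\<pi> x a) - \<pi> x a * log 2 (real m)) / real m)"
      by (intro sum.cong refl row)
    also have "\<dots> = (\<Sum>x\<in>{1..m}. ((\<Sum>a\<in>G. \<pi> x a * log 2 (\<pi> x a)) - (\<Sum>a\<in>G. \<pi> x a) * log 2 (real m)) / real m)"
      by (simp only: sum_divide_distrib[symmetric] sum_subtractf sum_distrib_right)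
    also have "\<dots> = (\<Sum>x\<in>{1..m}. (\<Sum>j<m. \<Sum>a\<in>S. e x j a * log 2 (e x j a)) / real m - log 2 (real m) / real m)"
      by (simp only: ent pi1 diff_divide_distrib mult_1)
    also have "\<dots> = (\<Sum>x\<in>{1..m}. (\<Sum>j<m. \<Sum>a\<in>S. e x j a * log 2 (e x j a)) / real m) - log 2 (real m)"
      using m by (simp add: sum_subtractf)
    finally show ?thesis .
  qed
  \<comment> \<open>Overlaps of the eigenbasis \<open>W\<close> with the product basis
    \<open>Z\<close>. By \<open>d\<close> the diagonal of the averaged state in the basis
    \<open>Z\<close> is an average of product weights, although \<open>W\<close> itself has no
    product form in general.\<close>
  define k where "k = (\<lambda>b c. (cmod (inner_on G (W b) (Z c)))\<^sup>2)"
  have d: "(\<Sum>b\<in>G. q b * k b c) = (\<Sum>x\<in>{1..m}. (\<Prod>i<m. e' x i (c ! i)) / real m)" if c: "c \<in> G" for c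
  proof -
    have "(\<Sum>a\<in>G. p x a * (cmod (inner_on G (V x a) (Z c)))\<^sup>2) = (\<Prod>i<m. e' x i (c ! i)) / real m" for x
    proof -
      let ?u = "\<lambda>i. if Suc i = x then u1 else u0"
      let ?g = "\<lambda>i a. e x i a * (cmod (inner_on S (?u i a) (u0 (c ! i))))\<^sup>2"
      have "(\<Sum>a\<in>G. p x a * (cmod (inner_on G (V x a) (Z c)))\<^sup>2)
          = (\<Sum>a\<in>lists_len m S. \<Prod>i<m. ?g i (a ! i)) / real m"
        unfolding sum_divide_distrib
      proof (intro sum.cong)
        fix a
        have "inner_on G (V x a) (Z c) = (\<Prod>i<m. inner_on S (?u i (a ! i)) (u0 (c ! i)))"
          unfolding G_def V_def Z_def by (rule inner_on_tensor_vec)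
        then have "(cmod (inner_on G (V x a) (Z c)))\<^sup>2 = (\<Prod>i<m. (cmod (inner_on S (?u i (a ! i)) (u0 (c ! i))))\<^sup>2)"
          by (simp only: prod_norm[symmetric] prod_power_distrib)
        then show "p x a * (cmod (inner_on G (V x a) (Z c)))\<^sup>2 = (\<Prod>i<m. ?g i (a ! i)) / real m"
          by (simp only: p_pi \<pi>_def prod.distrib times_divide_eq_left)
      qed (simp add: G_def)
      also have "(\<Sum>a\<in>lists_len m S. \<Prod>i<m. ?g i (a ! i)) = (\<Prod>i<m. \<Sum>a\<in>S. ?g i a)"
        by (rule sum_prod_lists)
      also have "\<dots> = (\<Prod>i<m. e' x i (c ! i))"
      proof (rule prod.cong[OF refl])
        fix i assume "i \<in> {..<m}"
        then have ci: "c ! i \<in> S" using c lists_len_nth unfolding G_def by blast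
        show "(\<Sum>a\<in>S. ?g i a) = e' x i (c ! i)"
        proof (cases "Suc i = x")
          case True
          then show ?thesis by (simp add: e_def e'_def f1_def)
        next
          case False
          have "(\<Sum>a\<in>S. ?g i a) = (\<Sum>a\<in>S. if a = c ! i then l0 (c ! i) else 0)"
            using on(2) ci False by (intro sum.cong) (auto simp: e_def orthonormal_def)
          then show ?thesis using ci fin False by (simp add: e'_def)
        qed
      qed
      finally show ?thesis .
    qed
    then show ?thesis unfolding k_def quad by simp
  qed
  have e'_supp: "l0 b > 0" if "b \<in> S" "e' x i b \<noteq> 0" for x i b
    using that supp l0(1)[of b] by (auto simp: e'_def order_less_le split: if_splits)
  have "(\<Sum>c\<in>G. (\<Sum>b\<in>G. q b * k b c) * log 2 (r c)) \<le> (\<Sum>b\<in>G. q b * log 2 (q b))"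
  proof (rule klein_inequality)
    show "(\<Sum>c\<in>G. k b c) = 1" if "b \<in> G" for b
      using parseval[OF onZ finG finG refl, of "W b"] orthonormal_nsq[OF onW that]
      by (simp add: k_def cmod_inner_on_commute[of G "W b"])
    show "(\<Sum>b\<in>G. k b c) = 1" if "c \<in> G" for c
      unfolding k_def parseval[OF onW finG finG refl] by (rule orthonormal_nsq[OF onZ that])
    show "r c \<ge> 0" if "c \<in> G" for c
      unfolding r_def using that by (intro prod_nonneg) (auto intro!: l0 lists_len_nth simp: G_def)
    have "sum r G = 1" unfolding r_def G_def by (simp only: sum_prod_lists[where f = "\<lambda>_. l0"] l0) simp
    then show "sum r G \<le> sum q G" using q by simp
    \<comment> \<open>A positive overlap with \<open>Z c\<close> makes one of the averaged product
      weights at \<open>c\<close> nonzero, hence all its factors, and these are nonzero only where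
      \<open>l0\<close> is positive.\<close>
    show "r c > 0" if b: "b \<in> G" and c: "c \<in> G" and pos: "q b * k b c > 0" for b c
    proof -
      have "q b * k b c \<le> (\<Sum>b\<in>G. q b * k b c)"
        using b finG q by (intro member_le_sum) (auto simp: k_def)
      then have "(\<Sum>x\<in>{1..m}. (\<Prod>i<m. e' x i (c ! i)) / real m) \<noteq> 0" using pos d[OF c] by simp
      then obtain x where "(\<Prod>i<m. e' x i (c ! i)) / real m \<noteq> 0" by (metis (no_types, lifting) sum.neutral)
      then have "e' x i (c ! i) \<noteq> 0" if "i < m" for i using that by (auto simp: prod_zero_iff)
      then have "l0 (c ! i) > 0" if "i < m" for i
        using that e'_supp[of "c ! i" x i] c lists_len_nth unfolding G_def by blast
      then show ?thesis unfolding r_def by (intro prod_pos) simp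
    qed
  qed (use q in \<open>auto simp: k_def\<close>)
  also have "(\<Sum>c\<in>G. (\<Sum>b\<in>G. q b * k b c) * log 2 (r c))
      = (\<Sum>x\<in>{1..m}. (\<Sum>j<m. \<Sum>b\<in>S. e' x j b * log 2 (l0 b)) / real m)"
  proof -
    have ent: "(\<Sum>c\<in>G. (\<Prod>i<m. e' x i (c ! i)) * log 2 (r c)) = (\<Sum>j<m. \<Sum>b\<in>S. e' x j b * log 2 (l0 b))" for x
      unfolding r_def G_def by (rule sum_lists_log_prod[OF e'1 e'_supp])
    have "(\<Sum>c\<in>G. (\<Sum>b\<in>G. q b * k b c) * log 2 (r c))
        = (\<Sum>c\<in>G. \<Sum>x\<in>{1..m}. (\<Prod>i<m. e' x i (c ! i)) * log 2 (r c) / real m)"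
      by (intro sum.cong refl) (simp add: d sum_distrib_right)
    also have "\<dots> = (\<Sum>x\<in>{1..m}. (\<Sum>c\<in>G. (\<Prod>i<m. e' x i (c ! i)) * log 2 (r c)) / real m)"
      unfolding sum_divide_distrib by (rule sum.swap)
    finally show ?thesis by (simp only: ent)
  qed
  finally have klein: "(\<Sum>x\<in>{1..m}. (\<Sum>j<m. \<Sum>b\<in>S. e' x j b * log 2 (l0 b)) / real m)
      \<le> (\<Sum>b\<in>G. q b * log 2 (q b))" .
  \<comment> \<open>Away from position \<open>x\<close> both local terms are the same sum over
    \<open>l0\<close> and cancel; position \<open>x\<close> contributes \<open>D\<close>. Averaging
    over the \<open>m\<close> positions leaves \<open>D\<close>.\<close>
  have diff: "(\<Sum>x\<in>{1..m}. (\<Sum>j<m. \<Sum>a\<in>S. e x j a * log 2 (e x j a)) / real m)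
      - (\<Sum>x\<in>{1..m}. (\<Sum>j<m. \<Sum>b\<in>S. e' x j b * log 2 (l0 b)) / real m) = D"
  proof -
    have "(\<Sum>j<m. \<Sum>a\<in>S. e x j a * log 2 (e x j a)) - (\<Sum>j<m. \<Sum>b\<in>S. e' x j b * log 2 (l0 b)) = D"
      if x: "x \<in> {1..m}" for x
    proof -
      have "(\<Sum>j<m. \<Sum>a\<in>S. e x j a * log 2 (e x j a)) - (\<Sum>j<m. \<Sum>b\<in>S. e' x j b * log 2 (l0 b))
          = (\<Sum>j<m. (\<Sum>a\<in>S. e x j a * log 2 (e x j a)) - (\<Sum>b\<in>S. e' x j b * log 2 (l0 b)))"
        by (rule sum_subtractf[symmetric])
      also have "\<dots> = (\<Sum>j<m. if j = x - 1 then D else 0)"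
      proof (rule sum.cong[OF refl])
        fix j
        show "(\<Sum>a\<in>S. e x j a * log 2 (e x j a)) - (\<Sum>b\<in>S. e' x j b * log 2 (l0 b)) = (if j = x - 1 then D else 0)"
        proof (cases "Suc j = x")
          case True
          then show ?thesis by (auto simp: e_def e'_def D_def)
        next
          case False
          then have "j \<noteq> x - 1" using x by auto
          then show ?thesis using False by (simp add: e_def e'_def)
        qed
      qed
      also have "\<dots> = D"
      proof -
        have "x - 1 < m" using x by auto
        then show ?thesis by (simp add: sum.delta)
      qed
      finally show ?thesis .
    qed
    then have "(\<Sum>x\<in>{1..m}. ((\<Sum>j<m. \<Sum>a\<in>S. e x j a * log 2 (e x j a))
        - (\<Sum>j<m. \<Sum>b\<in>S. e' x j b * log 2 (l0 b))) / real m) = (\<Sum>x\<in>{1..m}. D / real m)"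
      by (intro sum.cong refl) simp
    then show ?thesis using m by (simp add: diff_divide_distrib sum_subtractf)
  qed
  have "(\<Sum>x\<in>{1..m}. \<Sum>a\<in>G. \<Sum>b\<in>G. p x a * ?c x a b * (log 2 (q b) - log 2 (p x a)))
      = (\<Sum>b\<in>G. q b * log 2 (q b))
        - ((\<Sum>x\<in>{1..m}. (\<Sum>j<m. \<Sum>a\<in>S. e x j a * log 2 (e x j a)) / real m) - log 2 (real m))"
    unfolding A[symmetric] B[symmetric] by (simp only: right_diff_distrib sum_subtractf)
  then show ?thesis using klein diff unfolding D_def by linarith
qed

section \<open>Tensor powers of the attack and the final estimate\<close>

lemma push_tensor:
  "push (lists_len n G) (tensor_iso n T) (tensor_vec n v as) \<kappa>s es
    = (\<Prod>i<n. push G T (v i (as ! i)) (\<kappa>s ! i) (es ! i))"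
proof -
  have "push (lists_len n G) (tensor_iso n T) (tensor_vec n v as) \<kappa>s es
      = (\<Sum>gs\<in>lists_len n G. \<Prod>i<n. v i (as ! i) (gs ! i) * T (\<kappa>s ! i, es ! i) (gs ! i))"
    by (simp add: push_def tensor_vec_def tensor_iso_def prod.distrib)
  also have "\<dots> = (\<Prod>i<n. \<Sum>g\<in>G. v i (as ! i) g * T (\<kappa>s ! i, es ! i) g)"
    by (rule sum_prod_lists)
  finally show ?thesis by (simp only: push_def)
qed

text \<open>Both indices share the same \<open>\<kappa>\<close>, as these are the entries that the
  partial trace sums; each is a sum of rank-one terms of pushed vectors.\<close>

lemma iso_conj_spectral:
  assumes "finite G" "\<And>g g'. g \<in> G \<Longrightarrow> g' \<in> G \<Longrightarrow> X g g' = (\<Sum>c\<in>G. of_real (l c) * V c g * cnj (V c g'))"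
  shows "iso_conj G U X (\<kappa>, e) (\<kappa>, e') = (\<Sum>c\<in>G. of_real (l c) * push G U (V c) \<kappa> e * cnj (push G U (V c) \<kappa> e'))"
proof -
  let ?t = "\<lambda>c g g'. of_real (l c) * (V c g * U (\<kappa>, e) g) * cnj (V c g' * U (\<kappa>, e') g')"
  have "iso_conj G U X (\<kappa>, e) (\<kappa>, e') = (\<Sum>g\<in>G. \<Sum>g'\<in>G. \<Sum>c\<in>G. ?t c g g')"
    unfolding iso_conj_def using assms(2)
    by (intro sum.cong refl) (simp add: sum_distrib_left sum_distrib_right mult_ac)
  also have "\<dots> = (\<Sum>g\<in>G. \<Sum>c\<in>G. \<Sum>g'\<in>G. ?t c g g')" by (intro sum.cong refl sum.swap)
  also have "\<dots> = (\<Sum>c\<in>G. \<Sum>g\<in>G. \<Sum>g'\<in>G. ?t c g g')" by (rule sum.swap)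
  also have "\<dots> = (\<Sum>c\<in>G. of_real (l c) * push G U (V c) \<kappa> e * cnj (push G U (V c) \<kappa> e'))"
    by (intro sum.cong refl) (simp only: push_def cnj_sum mult.assoc sum_product, simp only: sum_distrib_left mult.assoc)
  finally show ?thesis .
qed

theorem theorem3:
  fixes z \<phi> :: "'q::finite \<Rightarrow> complex"
    and \<E> :: "'q op \<Rightarrow> 'q op"
    and mx ell :: nat
    and U :: "('q list \<times> 'e::finite) \<Rightarrow> 'q list \<Rightarrow> complex"
    and \<eta> :: "nat \<Rightarrow> real"
    and \<epsilon> :: real
    and \<rho>0 \<rho>1 :: "'q op"
    and QL :: "'q list set"
    and \<tau>t \<tau>Q :: "nat \<Rightarrow> 'q list op"
    and \<tau>QE :: "nat \<Rightarrow> ('q list \<times> 'e) op"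
    and \<tau> :: "(nat \<times> ('q list \<times> 'e)) op"
    and \<sigma> :: "(nat \<times> ('q list \<times> 'e)) list op"
    and \<sigma>XE :: "(nat list \<times> 'e list) op"
    and \<rho>0t \<rho>0Q :: "'q list op"
    and \<rho>0QE :: "('q list \<times> 'e) op"
    and \<delta>0 \<delta>1 \<delta> f0 :: real
    and lam :: "nat \<Rightarrow> real"
  assumes unit_z: "inner_on UNIV z z = 1"
    and unit_\<phi>: "inner_on UNIV \<phi> \<phi> = 1"
    and overlap: "inner_on UNIV \<phi> z \<noteq> 0"
    and chan: "quantum_channel \<E>"
    and \<rho>0_def: "\<rho>0 = \<E> (proj z)"
    and \<rho>1_def: "\<rho>1 = \<E> (proj \<phi>)"
    and supp_incl: "supp UNIV \<rho>1 \<subseteq> supp UNIV \<rho>0"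
    and mx_pos: "mx \<ge> 1" and ell_pos: "ell \<ge> 1"
    and QL_def: "QL = lists_len mx UNIV"
    and iso: "isometry QL (QL \<times> UNIV) U"
    and \<tau>t_def: "\<tau>t = (\<lambda>x. chan_pow mx \<E>
          (tensor_list (map (\<lambda>i. if i = x then proj \<phi> else proj z) [1..<mx+1])))"
    and \<tau>QE_def: "\<tau>QE = (\<lambda>x. iso_conj QL U (\<tau>t x))"
    and \<tau>_def: "\<tau> = (\<lambda>(x, p) (x', p'). if x = x' then \<tau>QE x p p' / of_nat mx else 0)"
    and \<sigma>_def: "\<sigma> = (\<lambda>bs bs'. \<Prod>i<ell. \<tau> (bs ! i) (bs' ! i))"
    and \<rho>0t_def: "\<rho>0t = tensor_list (replicate mx \<rho>0)"
    and \<rho>0QE_def: "\<rho>0QE = iso_conj QL U \<rho>0t"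
    and \<tau>Q_def: "\<tau>Q = (\<lambda>x. ptrace2 UNIV (\<tau>QE x))"
    and \<rho>0Q_def: "\<rho>0Q = ptrace2 UNIV \<rho>0QE"
    and \<sigma>XE_def: "\<sigma>XE = (\<lambda>(xs, es) (xs', es'). \<Sum>qss\<in>lists_len ell QL.
          \<sigma> (zip xs (zip qss es)) (zip xs' (zip qss es')))"
    and \<delta>0_def: "\<delta>0 = purif_C UNIV (proj z) \<rho>0"
    and \<delta>1_def: "\<delta>1 = purif_C UNIV (proj \<phi>) \<rho>1"
    and \<delta>_def: "\<delta> = \<delta>0 + \<delta>1"
    and f0_def: "f0 = fidelity UNIV (proj z) (proj \<phi>)"
    and \<eta>_range: "\<forall>x\<in>{1..mx}. 0 < \<eta> x \<and> \<eta> x < 1"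
    and lam_def: "lam = (\<lambda>x. 2 * \<delta>0 + sqrt (\<eta> x + 4 * sqrt (\<eta> x) * \<delta>1 + 4 * \<delta>1\<^sup>2))"
    and fid_bound: "\<forall>x\<in>{1..mx}. fidelity QL (\<tau>Q x) \<rho>0Q
          \<le> aleph (lam x) f0 - 2 * sqrt (1 - f0) * \<delta> - \<delta>\<^sup>2"
    and \<epsilon>_range: "0 < \<epsilon>" "\<epsilon> < 1"
  shows "smooth_hmin \<epsilon> (lists_len ell {1..mx}) (lists_len ell UNIV) \<sigma>XE
     \<ge> ereal (log 2 (real mx)) - rel_entropy UNIV \<rho>1 \<rho>0
        + ereal ((1 / real mx) * (\<Sum>x=1..mx. log 2 (1 - \<eta> x))
           - (2 * log 2 (real mx) + 3) * sqrt ((log 2 (1 / \<epsilon>) + 1) / real ell))"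
proof -
  have finU: "finite (UNIV :: 'q set)" and finE: "finite (UNIV :: 'e set)" by simp_all
  have psd0: "psd UNIV \<rho>0" and psd1: "psd UNIV \<rho>1"
    unfolding \<rho>0_def \<rho>1_def using chan channel_psd psd_proj by blast+
  have tr: "op_trace UNIV \<rho>0 = 1" "op_trace UNIV \<rho>1 = 1"
    using chan unit_z unit_\<phi> unfolding \<rho>0_def \<rho>1_def quantum_channel_def
    by (simp_all add: op_trace_proj inner_on_self)
  obtain u1 l1 u0 l0 where dec1: "spec_decomp UNIV \<rho>1 u1 l1" and dec0: "spec_decomp UNIV \<rho>0 u0 l0"
    and relent: "rel_entropy UNIV \<rho>1 \<rho>0 = ereal ((\<Sum>a\<in>UNIV. l1 a * log 2 (l1 a))
       - (\<Sum>b\<in>UNIV. (\<Sum>a\<in>UNIV. l1 a * (cmod (inner_on UNIV (u1 a) (u0 b)))\<^sup>2) * log 2 (l0 b)))"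
    using rel_entropy_spectral[OF finU psd1 psd0 supp_incl] .
  have on: "orthonormal UNIV UNIV u1" "orthonormal UNIV UNIV u0"
    using dec1[unfolded spec_decomp_iff[OF finU]] dec0[unfolded spec_decomp_iff[OF finU]] by blast+
  have l1: "l1 a \<ge> 0" "sum l1 UNIV = 1" for a
  proof -
    show "l1 a \<ge> 0" by (rule psd_eigenvalue_nonneg[OF psd1 dec1 finU]) simp
    have "complex_of_real (sum l1 UNIV) = 1" using sum_eigenvalues[OF dec1 finU] tr by simp
    then show "sum l1 UNIV = 1" by (simp only: of_real_eq_1_iff)
  qed
  have l0: "l0 a \<ge> 0" "sum l0 UNIV = 1" for a
  proof -
    show "l0 a \<ge> 0" by (rule psd_eigenvalue_nonneg[OF psd0 dec0 finU]) simp
    have "complex_of_real (sum l0 UNIV) = 1" using sum_eigenvalues[OF dec0 finU] tr by simp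
    then show "sum l0 UNIV = 1" by (simp only: of_real_eq_1_iff)
  qed
  have supp: "l0 b > 0" if "(\<Sum>a\<in>UNIV. l1 a * (cmod (inner_on UNIV (u1 a) (u0 b)))\<^sup>2) \<noteq> 0" for b
  proof (rule supp_eigenvalue_pos[OF finU psd0 supp_incl dec0])
    show "inner_on UNIV (u0 b) (op_apply UNIV \<rho>1 (u0 b)) \<noteq> 0"
      unfolding spec_decomp_quadratic[OF dec1] using that by (simp only: of_real_eq_0_iff not_False_eq_True)
  qed simp
  define D where "D = (\<Sum>a\<in>UNIV. l1 a * log 2 (l1 a))
       - (\<Sum>b\<in>UNIV. (\<Sum>a\<in>UNIV. l1 a * (cmod (inner_on UNIV (u1 a) (u0 b)))\<^sup>2) * log 2 (l0 b))"
  define V where "V = (\<lambda>x. tensor_vec mx (\<lambda>i. if Suc i = x then u1 else u0))"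
  define \<pi> where "\<pi> = (\<lambda>x as. \<Prod>i<mx. if Suc i = x then l1 (as ! i) else l0 (as ! i))"
  define p where "p = (\<lambda>x as. \<pi> x as / real mx)"
  have finQL: "finite QL" unfolding QL_def by (rule finite_lists_len) simp
  have onV: "orthonormal QL QL (V x)" for x
    unfolding QL_def V_def using on by (intro orthonormal_tensor_vec) simp
  have \<pi>0: "\<pi> x as \<ge> 0" for x as unfolding \<pi>_def using l1 l0 by (intro prod_nonneg) auto
  have \<pi>1: "(\<Sum>as\<in>QL. \<pi> x as) = 1" for x
  proof -
    have "(\<Sum>as\<in>QL. \<pi> x as) = (\<Prod>i<mx. \<Sum>a\<in>UNIV. if Suc i = x then l1 a else l0 a)"
      unfolding \<pi>_def QL_def by (rule sum_prod_lists)
    also have "\<dots> = (\<Prod>i<mx. 1)"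
    proof (rule prod.cong[OF refl])
      fix i
      show "(\<Sum>a\<in>UNIV. if Suc i = x then l1 a else l0 a) = 1"
        by (cases "Suc i = x") (simp_all add: l1 l0)
    qed
    finally show ?thesis by simp
  qed
  have p0: "p x as \<ge> 0" for x as by (simp add: p_def \<pi>0)
  have p1: "(\<Sum>x\<in>{1..mx}. \<Sum>as\<in>QL. p x as) = 1"
    using mx_pos by (simp add: p_def \<pi>1 flip: sum_divide_distrib)
  \<comment> \<open>Entry \<open>i\<close> of the list over \<open>[1..<mx+1]\<close> belongs to
    position \<open>Suc i\<close>. The channel acts on each factor separately, so products of
    eigenvectors of \<open>\<rho>1\<close> and \<open>\<rho>0\<close> diagonalise the
    output.\<close>
  have \<tau>t: "\<tau>t x gs hs = (\<Sum>c\<in>QL. of_real (\<pi> x c) * V x c gs * cnj (V x c hs))" for x gs hs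
  proof -
    let ?l = "\<lambda>i. if Suc i = x then l1 else l0" and ?u = "\<lambda>i. if Suc i = x then u1 else u0"
    have "\<tau>t x gs hs = (\<Prod>i<mx. (if Suc i = x then \<rho>1 else \<rho>0) (gs ! i) (hs ! i))"
      unfolding \<tau>t_def by (subst chan_pow_tensor_list[OF chan]) (auto intro!: prod.cong simp: \<rho>0_def \<rho>1_def simp del: upt_Suc)
    also have "\<dots> = (\<Prod>i<mx. \<Sum>c\<in>UNIV. of_real (?l i c) * ?u i c (gs ! i) * cnj (?u i c (hs ! i)))"
    proof (rule prod.cong[OF refl])
      fix i
      show "(if Suc i = x then \<rho>1 else \<rho>0) (gs ! i) (hs ! i)
          = (\<Sum>c\<in>UNIV. of_real (?l i c) * ?u i c (gs ! i) * cnj (?u i c (hs ! i)))"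
        using dec1 dec0 by (simp add: spec_decomp_def op_eq_def)
    qed
    also have "\<dots> = (\<Sum>cs\<in>QL. \<Prod>i<mx. of_real (?l i (cs ! i)) * ?u i (cs ! i) (gs ! i) * cnj (?u i (cs ! i) (hs ! i)))"
      unfolding QL_def by (rule sum_prod_lists[symmetric])
    also have "\<dots> = (\<Sum>c\<in>QL. of_real (\<pi> x c) * V x c gs * cnj (V x c hs))"
      by (intro sum.cong refl) (simp add: prod.distrib \<pi>_def V_def tensor_vec_def if_distrib[of "\<lambda>f. f _"] cong: if_cong)
    finally show ?thesis .
  qed
  \<comment> \<open>The factor \<open>1 / mx\<close> is contained in \<open>p\<close>, so
    \<open>\<tau>bar\<close> is the plain sum of the weighted blocks and dominates each of them with
    constant 1.\<close>
  define \<tau>bar where "\<tau>bar = gram ({1..mx} \<times> QL) (\<lambda>(x, a). p x a) (\<lambda>(x, a). V x a)"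
  have psd_bar: "psd QL \<tau>bar" unfolding \<tau>bar_def using p0 by (intro psd_gram) auto
  obtain W q where dec: "spec_decomp QL \<tau>bar W q" using spec_decomp_exists[OF finQL psd_hermitian[OF psd_bar]] .
  have onW: "orthonormal QL QL W" using dec spec_decomp_iff[OF finQL] by blast
  have q0: "q b \<ge> 0" if "b \<in> QL" for b by (rule psd_eigenvalue_nonneg[OF psd_bar dec finQL that])
  have q1: "sum q QL = 1"
  proof -
    have "complex_of_real (sum q QL) = op_trace QL \<tau>bar" by (rule sum_eigenvalues[OF dec finQL, symmetric])
    also have "\<dots> = of_real (\<Sum>x\<in>{1..mx}. \<Sum>a\<in>QL. p x a * nsq QL (V x a))"
      unfolding \<tau>bar_def op_trace_gram sum.cartesian_product' by simp
    also have "(\<Sum>x\<in>{1..mx}. \<Sum>a\<in>QL. p x a * nsq QL (V x a)) = 1"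
      using p1 orthonormal_nsq[OF onV] by simp
    finally show ?thesis by (simp only: of_real_eq_iff)
  qed
  have quad: "(\<Sum>b\<in>QL. q b * (cmod (inner_on QL (W b) f))\<^sup>2)
      = (\<Sum>x\<in>{1..mx}. \<Sum>a\<in>QL. p x a * (cmod (inner_on QL (V x a) f))\<^sup>2)" for f
  proof -
    have "complex_of_real (\<Sum>b\<in>QL. q b * (cmod (inner_on QL (W b) f))\<^sup>2)
        = of_real (\<Sum>i\<in>{1..mx} \<times> QL. (case i of (x, a) \<Rightarrow> p x a) * (cmod (inner_on QL (case i of (x, a) \<Rightarrow> V x a) f))\<^sup>2)"
      unfolding spec_decomp_quadratic[OF dec, symmetric] \<tau>bar_def gram_quadratic ..
    then show ?thesis unfolding of_real_eq_iff sum.cartesian_product' by simp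
  qed
  define h where "h = log 2 (real mx) - D"
  have "h \<le> (\<Sum>x\<in>{1..mx}. \<Sum>a\<in>QL. \<Sum>b\<in>QL. p x a * (cmod (inner_on QL (W b) (V x a)))\<^sup>2
        * (log 2 (q b) - log 2 (p x a)))"
    unfolding h_def D_def p_def \<pi>_def V_def QL_def
    by (rule pulse_position_mean[OF finU on mx_pos l1 l0 supp])
       (use onW q0 q1 quad in \<open>simp_all add: p_def \<pi>_def V_def QL_def\<close>)
  moreover have "(\<Sum>a\<in>QL. p x a * (cmod (inner_on QL (V x a) f))\<^sup>2) \<le> (\<Sum>b\<in>QL. q b * (cmod (inner_on QL (W b) f))\<^sup>2)"
    if "x \<in> {1..mx}" for x f
    unfolding quad using that p0 by (intro member_le_sum sum_nonneg mult_nonneg_nonneg) auto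
  \<comment> \<open>Bob's lists of labels \<open>qss\<close> take the role of the register
    \<open>K\<close>: the isometry outputs \<open>QL\<close> and \<open>'e\<close>, and tracing out
    \<open>QL\<close> leaves the classical register and Eve's system.\<close>
  moreover have "op_eq (lists_len ell {1..mx} \<times> lists_len ell UNIV) \<sigma>XE
      (pushed_state (lists_len ell {1..mx}) (lists_len ell QL) (lists_len ell QL) (tensor_iso ell U)
        (\<lambda>xs as. \<Prod>i<ell. p (xs ! i) (as ! i)) (\<lambda>xs. tensor_vec ell (\<lambda>i. V (xs ! i))))"
    unfolding op_eq_def
  proof (intro ballI)
    fix w w' assume "w \<in> lists_len ell {1..mx} \<times> lists_len ell (UNIV::'e set)"
      and "w' \<in> lists_len ell {1..mx} \<times> lists_len ell (UNIV::'e set)"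
    then obtain xs es xs' es' where w: "w = (xs, es)" "w' = (xs', es')"
      and xs: "xs \<in> lists_len ell {1..mx}" "xs' \<in> lists_len ell {1..mx}"
      and es: "length es = ell" "length es' = ell" by (auto simp: lists_len_def)
    have len: "length xs = ell" "length xs' = ell" using xs by (auto simp: lists_len_def)
    let ?t = "\<lambda>i \<kappa> a. of_real (p (xs ! i) a) * push QL U (V (xs ! i) a) \<kappa> (es ! i) * cnj (push QL U (V (xs ! i) a) \<kappa> (es' ! i))"
    have "\<sigma>XE w w' = (\<Sum>qss\<in>lists_len ell QL. \<Prod>i<ell. \<tau> (xs ! i, qss ! i, es ! i) (xs' ! i, qss ! i, es' ! i))"
      unfolding w \<sigma>XE_def \<sigma>_def prod.case
      by (intro sum.cong prod.cong refl) (auto simp: lists_len_def len es)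
    also have "\<dots> = (if xs = xs' then \<Sum>qss\<in>lists_len ell QL. \<Prod>i<ell. \<Sum>a\<in>QL. ?t i (qss ! i) a else 0)"
    proof (cases "xs = xs'")
      case True
      have "\<tau> (xs ! i, \<kappa>, es ! i) (xs' ! i, \<kappa>, es' ! i) = (\<Sum>a\<in>QL. ?t i \<kappa> a)" for i \<kappa>
      proof -
        have "\<tau> (xs ! i, \<kappa>, es ! i) (xs' ! i, \<kappa>, es' ! i) = \<tau>QE (xs ! i) (\<kappa>, es ! i) (\<kappa>, es' ! i) / of_nat mx"
          using True by (simp add: \<tau>_def)
        also have "\<tau>QE (xs ! i) (\<kappa>, es ! i) (\<kappa>, es' ! i) = (\<Sum>a\<in>QL. of_real (\<pi> (xs ! i) a)
            * push QL U (V (xs ! i) a) \<kappa> (es ! i) * cnj (push QL U (V (xs ! i) a) \<kappa> (es' ! i)))"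
          unfolding \<tau>QE_def by (rule iso_conj_spectral[OF finQL]) (rule \<tau>t)
        finally show ?thesis by (simp add: sum_divide_distrib p_def)
      qed
      then show ?thesis using True by simp
    next
      case False
      then obtain i where i: "i < ell" "xs ! i \<noteq> xs' ! i" using len by (auto simp: list_eq_iff_nth_eq)
      then have "\<tau> (xs ! i, \<kappa>, e) (xs' ! i, \<kappa>, e') = 0" for \<kappa> e e' by (simp add: \<tau>_def)
      then have z: "(\<Prod>i<ell. \<tau> (xs ! i, qss ! i, es ! i) (xs' ! i, qss ! i, es' ! i)) = 0" for qss
        using i by (intro prod_zero) auto
      show ?thesis unfolding z using False by simp
    qed
    also have "\<dots> = (if xs = xs' then \<Sum>qss\<in>lists_len ell QL. \<Sum>as\<in>lists_len ell QL. \<Prod>i<ell. ?t i (qss ! i) (as ! i) else 0)"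
      by (simp only: sum_prod_lists[symmetric])
    also have "\<dots> = pushed_state (lists_len ell {1..mx}) (lists_len ell QL) (lists_len ell QL) (tensor_iso ell U)
        (\<lambda>xs as. \<Prod>i<ell. p (xs ! i) (as ! i)) (\<lambda>xs. tensor_vec ell (\<lambda>i. V (xs ! i))) w w'"
      unfolding w pushed_state_def using xs
      by (subst cq_gram_apply) (auto simp: finite_lists_len gram_def sum.cartesian_product' push_tensor prod.distrib)
    finally show "\<sigma>XE w w' = pushed_state (lists_len ell {1..mx}) (lists_len ell QL) (lists_len ell QL) (tensor_iso ell U)
        (\<lambda>xs as. \<Prod>i<ell. p (xs ! i) (as ! i)) (\<lambda>xs. tensor_vec ell (\<lambda>i. V (xs ! i))) w w'" .
  qed
  ultimately have aep: "smooth_hmin \<epsilon> (lists_len ell {1..mx}) (lists_len ell UNIV) \<sigma>XE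
      \<ge> ereal (h - (2 * log 2 (card {1..mx}) + 3) * sqrt ((log 2 (1 / \<epsilon>) + 1) / ell))"
    by (intro smooth_hmin_aep[OF _ finQL finE finQL iso onV onW p0 p1 q0 q1 _ _ _ \<epsilon>_range ell_pos]) auto
  have "(\<Sum>x=1..mx. log 2 (1 - \<eta> x)) \<le> 0"
  proof (rule sum_nonpos)
    fix x assume "x \<in> {1..mx}"
    with \<eta>_range have "0 < \<eta> x \<and> \<eta> x < 1" by blast
    then show "log 2 (1 - \<eta> x) \<le> 0" by simp
  qed
  then have "(1 / real mx) * (\<Sum>x=1..mx. log 2 (1 - \<eta> x)) \<le> 0" by (intro mult_nonneg_nonpos) auto
  then have "ereal (log 2 (real mx)) - rel_entropy UNIV \<rho>1 \<rho>0
        + ereal ((1 / real mx) * (\<Sum>x=1..mx. log 2 (1 - \<eta> x))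
           - (2 * log 2 (real mx) + 3) * sqrt ((log 2 (1 / \<epsilon>) + 1) / real ell))
      \<le> ereal (h - (2 * log 2 (card {1..mx}) + 3) * sqrt ((log 2 (1 / \<epsilon>) + 1) / ell))"
    unfolding relent h_def D_def by simp
  then show ?thesis using aep by (rule order_trans)
qed

end
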